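(* Let $(X,\mathsf d,\mathsf m)$ be a metric space equipped with a Borel measure with $\mathsf m(X)<+\infty$, let $p\ge2$, and assume that $H^{1,p}(X)$ is compactly embedded in $L^p(X,\mathsf m)$. Let $f_0\in\mathrm S$ satisfy $\mathsf{Ch}_p(f_0)<+\infty$ and $\int_XJ_p(f_0)\,d\mathsf m=0$, put $M:=p(\mathsf{Ch}_p(f_0)+1)$, and let $(f_t)_{t\ge0}$ be a $\Psi$-mirror flow for $\Phi=\Phi_M$ starting from $f_0$. Let $$\omega(f_t):=\{f_*\in L^p(X,\mathsf m):\ \exists\, t_n\to+\infty \text{ with } \|f_{t_n}-f_*\|_{L^p}\to0\},$$ $$\widetilde\lambda_{1,p}:=\inf\Big\{p\,\mathsf{Ch}_p(f): f\in\mathrm S,\ \int_XJ_p(f)\,d\mathsf m=0\Big\}.$$ Then: (1) the limit $\lambda_*:=\lim_{t\to+\infty}p\,\mathsf{Ch}_p(f_t)$ exists, is finite and satisfies $\widetilde\lambda_{1,p}\le\lambda_*$; moreover $\lambda_*$ is an eigenvalue of the $p$-Laplacian $\Delta_p$ and every element $f_*\in\omega(f_t)$ is an eigenfunction for $\lambda_*$; (2) $\widetilde\lambda_{1,p}$ is an eigenvalue of $\Delta_p$; and if $\widetilde\lambda_{1,p}$ is simple and isolated and $p\,\mathsf{Ch}_p(f_0)$ is sufficiently close to $\widetilde\lambda_{1,p}$ (that is, $p\,\mathsf{Ch}_p(f_0)\le\widetilde\lambda_{1,p}+\delta$ for some $\delta>0$ depending only on $(X,\mathsf d,\mathsf m)$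 and $p$), then there exists an eigenfunction $f_*\in\mathrm S$ for $\lambda_*$ such that $\|f_t-f_*\|_{L^p}\to0$ as $t\to+\infty$.
   Context: $L^p(X,\mathsf m)$ is the real Lebesgue space, $\mathrm S$ its unit sphere $\{\|f\|_{L^p}=1\}$, $q$ the Hölder conjugate of $p$, $\Psi(f):=\frac1p\|f\|_{L^p}^p$, and $J_p(f):=|f|^{p-2}f=\nabla\Psi(f)\in L^q$. Cheeger energy. For a Lipschitz function $h:X\to\mathbb R$ put $|Dh|(x):=\limsup_{y\to x}|h(y)-h(x)|/\mathsf d(y,x)$ ($0$ at isolated points). A function $G\in L^p(X,\mathsf m)$ is a $p$-relaxed slope of $f\in L^p(X,\mathsf m)$ if there are $\tilde G\in L^p(X,\mathsf m)$ and Lipschitz functions $h_n\in L^p(X,\mathsf m)$ with $h_n\to f$ in $L^p$, $|Dh_n|\rightharpoonup\tilde G$ weakly in $L^p$ and $\tilde G\le G$ $\mathsf m$-a.e.; the $p$-minimal relaxed slope $|\mathrm Df|_*$ is the $p$-relaxed slope of minimal $L^p$-norm (it exists as soon as some $p$-relaxed slope exists). $\mathsf{Ch}_p(f):=\frac1p\int_X|\mathrm Df|_*^p\,d\mathsf m$ if $|\mathrm Df|_*$ exists and $+\infty$ otherwise. $H^{1,p}(X):=\{\mathsf{Ch}_p<+\infty\}$. Compact embedding means: if $f_n\in L^p(X,\mathsf m)$ and $\sup_n(\|f_n\|_{L^p}+\mathsf{Ch}_p(f_n))<+\infty$, then some subsequence converges in $L^p$. $p$-Laplacian. $\partial\mathsf{Ch}_p(f)\subset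 L^q(X,\mathsf m)$ is the convex subdifferential of $\mathsf{Ch}_p$ on $L^p$. If it is nonempty, $\Delta_pf$ is the element of minimal $L^q$-norm in $-\partial\mathsf{Ch}_p(f)$. A real $\lambda$ is an eigenvalue of $\Delta_p$ if there is $f\in H^{1,p}(X)\setminus\{0\}$ with $\Delta_pf=-\lambda J_p(f)$; such $f$ is an eigenfunction for $\lambda$. An eigenvalue $\lambda$ is isolated if there is $\delta>0$ such that there are no eigenvalues in $(\lambda,\lambda+\delta]$; it is simple if any two eigenfunctions for $\lambda$ are linearly dependent. The functional. For $M>0$: $\Phi_M(f):=\mathsf{Ch}_p(f)-(M+1)\Psi(f)$ if $\|f\|_{L^p}\le1$ and $\mathsf{Ch}_p(f)\le\frac Mp$, and $\Phi_M(f):=+\infty$ otherwise. Mirror flow. The Fréchet subdifferential of $\Phi:L^p\to(-\infty,+\infty]$ at $f$ with $\Phi(f)<+\infty$ is $\partial_F\Phi(f):=\{\xi\in L^q:\liminf_{g\to f}\frac{\Phi(g)-\Phi(f)-\langle\xi,g-f\rangle}{\|g-f\|_{L^p}}\ge0\}$ (empty if $\Phi(f)=+\infty$). A $\Psi$-mirror flow for $\Phi$ starting from $f_0$ is a map $t\in[0,+\infty)\mapsto f_t\in L^p$ with value $f_0$ at $t=0$ such that $t\mapsto J_p(f_t)\in L^q$ is locally absolutely continuous on $[0,+\infty)$ and $\frac{d}{dt}J_p(f_t)\in-\partial_F\Phi(f_t)$ for Lebesgue-a.e. $t>0$. *)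

theory Defs
  imports "HOL-Analysis.Analysis"
begin

text \<open>
  The metric space is the carrier type \<open>'a :: metric_space\<close> and \<open>m\<close> is a measure on it.
  Elements of \<open>L\<^sup>p(X,m)\<close> are represented by functions \<open>'a \<Rightarrow> real\<close>; all notions below
  depend only on the \<open>m\<close>-a.e. class of their arguments, except for the slope \<open>|Dh|\<close> of a
  Lipschitz function, which is a pointwise object.
\<close>

section \<open>Lebesgue spaces\<close>

definition Lp :: "'a measure \<Rightarrow> real \<Rightarrow> ('a \<Rightarrow> real) set" where
  "Lp m p = {f \<in> borel_measurable m. integrable m (\<lambda>x. \<bar>f x\<bar> powr p)}"

definition Lp_norm :: "'a measure \<Rightarrow> real \<Rightarrow> ('a \<Rightarrow> real) \<Rightarrow> real" where
  "Lp_norm m p f = (\<integral>x. \<bar>f x\<bar> powr p \<partial>m) powr (1 / p)"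

definition conj_exp :: "real \<Rightarrow> real" where
  "conj_exp p = p / (p - 1)"

definition pairing :: "'a measure \<Rightarrow> ('a \<Rightarrow> real) \<Rightarrow> ('a \<Rightarrow> real) \<Rightarrow> real" where
  "pairing m \<xi> f = (\<integral>x. \<xi> x * f x \<partial>m)"

definition Lp_conv ::
    "'a measure \<Rightarrow> real \<Rightarrow> ('b \<Rightarrow> 'a \<Rightarrow> real) \<Rightarrow> ('a \<Rightarrow> real) \<Rightarrow> 'b filter \<Rightarrow> bool" where
  "Lp_conv m p u f F \<longleftrightarrow> ((\<lambda>n. Lp_norm m p (\<lambda>x. u n x - f x)) \<longlongrightarrow> 0) F"

definition Lp_weak_conv ::
    "'a measure \<Rightarrow> real \<Rightarrow> (nat \<Rightarrow> 'a \<Rightarrow> real) \<Rightarrow> ('a \<Rightarrow> real) \<Rightarrow> bool" where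
  "Lp_weak_conv m p u f \<longleftrightarrow>
     (\<forall>n. u n \<in> Lp m p) \<and> f \<in> Lp m p \<and>
     (\<forall>\<phi> \<in> Lp m (conj_exp p). (\<lambda>n. pairing m \<phi> (u n)) \<longlonglongrightarrow> pairing m \<phi> f)"

definition Lp_sphere :: "'a measure \<Rightarrow> real \<Rightarrow> ('a \<Rightarrow> real) set" where
  "Lp_sphere m p = {f \<in> Lp m p. Lp_norm m p f = 1}"

definition Psi :: "'a measure \<Rightarrow> real \<Rightarrow> ('a \<Rightarrow> real) \<Rightarrow> real" where
  "Psi m p f = (1 / p) * Lp_norm m p f powr p"

text \<open>For \<open>p = 2\<close> the factor \<open>0 powr 0 = 0\<close> at zeros of \<open>f\<close> is harmless, as it multiplies \<open>f x = 0\<close>.\<close>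

definition J :: "real \<Rightarrow> ('a \<Rightarrow> real) \<Rightarrow> 'a \<Rightarrow> real" where
  "J p f = (\<lambda>x. \<bar>f x\<bar> powr (p - 2) * f x)"

section \<open>Cheeger energy\<close>

text \<open>For Lipschitz \<open>h\<close> the upper limit is finite, so \<open>real_of_ereal\<close> loses nothing.\<close>

definition slope :: "('a::metric_space \<Rightarrow> real) \<Rightarrow> 'a \<Rightarrow> real" where
  "slope h x =
     (if open {x} then 0
      else real_of_ereal (Limsup (at x) (\<lambda>y. ereal (\<bar>h y - h x\<bar> / dist y x))))"

definition relaxed_slope ::
    "('a::metric_space) measure \<Rightarrow> real \<Rightarrow> ('a \<Rightarrow> real) \<Rightarrow> ('a \<Rightarrow> real) \<Rightarrow> bool" where
  "relaxed_slope m p f G \<longleftrightarrow>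
     f \<in> Lp m p \<and> G \<in> Lp m p \<and>
     (\<exists>G' \<in> Lp m p. \<exists>h :: nat \<Rightarrow> 'a \<Rightarrow> real.
        (\<forall>n. h n \<in> Lp m p \<and> (\<exists>L. L-lipschitz_on UNIV (h n))) \<and>
        Lp_conv m p h f sequentially \<and>
        Lp_weak_conv m p (\<lambda>n. slope (h n)) G' \<and>
        (AE x in m. G' x \<le> G x))"

definition is_minimal_relaxed_slope ::
    "('a::metric_space) measure \<Rightarrow> real \<Rightarrow> ('a \<Rightarrow> real) \<Rightarrow> ('a \<Rightarrow> real) \<Rightarrow> bool" where
  "is_minimal_relaxed_slope m p f G \<longleftrightarrow>
     relaxed_slope m p f G \<and>
     (\<forall>G'. relaxed_slope m p f G' \<longrightarrow> Lp_norm m p G \<le> Lp_norm m p G')"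

definition minimal_relaxed_slope ::
    "('a::metric_space) measure \<Rightarrow> real \<Rightarrow> ('a \<Rightarrow> real) \<Rightarrow> 'a \<Rightarrow> real" where
  "minimal_relaxed_slope m p f = (SOME G. is_minimal_relaxed_slope m p f G)"

text \<open>
  Relaxed slopes are nonnegative only almost everywhere, hence the absolute value. The integral
  does not depend on the choice made by \<open>SOME\<close>, since all minimal slopes have the same norm.
\<close>

definition Ch :: "('a::metric_space) measure \<Rightarrow> real \<Rightarrow> ('a \<Rightarrow> real) \<Rightarrow> ereal" where
  "Ch m p f =
     (if \<exists>G. is_minimal_relaxed_slope m p f G
      then ereal ((1 / p) * (\<integral>x. \<bar>minimal_relaxed_slope m p f x\<bar> powr p \<partial>m))
      else \<infinity>)"

definition H1p :: "('a::metric_space) measure \<Rightarrow> real \<Rightarrow> ('a \<Rightarrow> real) set" where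
  "H1p m p = {f \<in> Lp m p. Ch m p f < \<infinity>}"

definition compact_embedding :: "('a::metric_space) measure \<Rightarrow> real \<Rightarrow> bool" where
  "compact_embedding m p \<longleftrightarrow>
     (\<forall>u :: nat \<Rightarrow> 'a \<Rightarrow> real.
        (\<forall>n. u n \<in> Lp m p) \<and> (SUP n. ereal (Lp_norm m p (u n)) + Ch m p (u n)) < \<infinity> \<longrightarrow>
        (\<exists>r. strict_mono (r :: nat \<Rightarrow> nat) \<and>
           (\<exists>f \<in> Lp m p. Lp_conv m p (\<lambda>n. u (r n)) f sequentially)))"

section \<open>The p-Laplacian and its eigenvalues\<close>

definition Ch_subdiff ::
    "('a::metric_space) measure \<Rightarrow> real \<Rightarrow> ('a \<Rightarrow> real) \<Rightarrow> ('a \<Rightarrow> real) set" where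
  "Ch_subdiff m p f =
     {\<xi> \<in> Lp m (conj_exp p). f \<in> Lp m p \<and> Ch m p f < \<infinity> \<and>
        (\<forall>g \<in> Lp m p. Ch m p f + ereal (pairing m \<xi> (\<lambda>x. g x - f x)) \<le> Ch m p g)}"

text \<open>\<open>is_p_Laplacian m p f \<zeta>\<close> means that \<open>\<Delta>\<^sub>p f\<close> is defined and is the class of \<open>\<zeta>\<close>.\<close>

definition is_p_Laplacian ::
    "('a::metric_space) measure \<Rightarrow> real \<Rightarrow> ('a \<Rightarrow> real) \<Rightarrow> ('a \<Rightarrow> real) \<Rightarrow> bool" where
  "is_p_Laplacian m p f \<zeta> \<longleftrightarrow>
     (\<lambda>x. - \<zeta> x) \<in> Ch_subdiff m p f \<and>
     (\<forall>\<eta>. (\<lambda>x. - \<eta> x) \<in> Ch_subdiff m p f \<longrightarrow>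
        Lp_norm m (conj_exp p) \<zeta> \<le> Lp_norm m (conj_exp p) \<eta>)"

definition eigenfunction ::
    "('a::metric_space) measure \<Rightarrow> real \<Rightarrow> real \<Rightarrow> ('a \<Rightarrow> real) \<Rightarrow> bool" where
  "eigenfunction m p l f \<longleftrightarrow>
     f \<in> H1p m p \<and> \<not> (AE x in m. f x = 0) \<and> is_p_Laplacian m p f (\<lambda>x. - l * J p f x)"

definition eigenvalue :: "('a::metric_space) measure \<Rightarrow> real \<Rightarrow> real \<Rightarrow> bool" where
  "eigenvalue m p l \<longleftrightarrow> (\<exists>f. eigenfunction m p l f)"

definition isolated_eigenvalue :: "('a::metric_space) measure \<Rightarrow> real \<Rightarrow> real \<Rightarrow> bool" where
  "isolated_eigenvalue m p l \<longleftrightarrow>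
     eigenvalue m p l \<and> (\<exists>\<delta>>0. \<forall>k \<in> {l<..l + \<delta>}. \<not> eigenvalue m p k)"

definition simple_eigenvalue :: "('a::metric_space) measure \<Rightarrow> real \<Rightarrow> real \<Rightarrow> bool" where
  "simple_eigenvalue m p l \<longleftrightarrow>
     eigenvalue m p l \<and>
     (\<forall>f g. eigenfunction m p l f \<and> eigenfunction m p l g \<longrightarrow>
        (\<exists>a b :: real. (a, b) \<noteq> (0, 0) \<and> (AE x in m. a * f x + b * g x = 0)))"

definition lambda1 :: "('a::metric_space) measure \<Rightarrow> real \<Rightarrow> ereal" where
  "lambda1 m p =
     Inf {ereal p * Ch m p f | f. f \<in> Lp_sphere m p \<and> (\<integral>x. J p f x \<partial>m) = 0}"

section \<open>Mirror flows\<close>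

definition Phi :: "('a::metric_space) measure \<Rightarrow> real \<Rightarrow> real \<Rightarrow> ('a \<Rightarrow> real) \<Rightarrow> ereal" where
  "Phi m p M f =
     (if Lp_norm m p f \<le> 1 \<and> Ch m p f \<le> ereal (M / p)
      then Ch m p f - ereal ((M + 1) * Psi m p f)
      else \<infinity>)"

text \<open>The filter of punctured neighbourhoods of \<open>f\<close> in \<open>L\<^sup>p\<close>.\<close>

definition Lp_at :: "'a measure \<Rightarrow> real \<Rightarrow> ('a \<Rightarrow> real) \<Rightarrow> ('a \<Rightarrow> real) filter" where
  "Lp_at m p f =
     (INF r \<in> {0<..}. principal {g \<in> Lp m p.
        0 < Lp_norm m p (\<lambda>x. g x - f x) \<and> Lp_norm m p (\<lambda>x. g x - f x) < r})"

definition Frechet_subdiff ::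
    "'a measure \<Rightarrow> real \<Rightarrow> (('a \<Rightarrow> real) \<Rightarrow> ereal) \<Rightarrow> ('a \<Rightarrow> real) \<Rightarrow> ('a \<Rightarrow> real) set" where
  "Frechet_subdiff m p \<Phi> f =
     {\<xi> \<in> Lp m (conj_exp p). f \<in> Lp m p \<and> \<Phi> f < \<infinity> \<and>
        0 \<le> Liminf (Lp_at m p f)
              (\<lambda>g. (\<Phi> g - \<Phi> f - ereal (pairing m \<xi> (\<lambda>x. g x - f x)))
                    / ereal (Lp_norm m p (\<lambda>x. g x - f x)))}"

definition Lp_abs_cont ::
    "'a measure \<Rightarrow> real \<Rightarrow> real \<Rightarrow> real \<Rightarrow> (real \<Rightarrow> 'a \<Rightarrow> real) \<Rightarrow> bool" where
  "Lp_abs_cont m q a b g \<longleftrightarrow>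
     (\<forall>t \<in> {a..b}. g t \<in> Lp m q) \<and>
     (\<forall>\<epsilon>>0. \<exists>\<delta>>0. \<forall>(n::nat) (s :: nat \<Rightarrow> real) (t :: nat \<Rightarrow> real).
        (\<forall>i<n. a \<le> s i \<and> s i \<le> t i \<and> t i \<le> b) \<and>
        disjoint_family_on (\<lambda>i. {s i<..<t i}) {..<n} \<and>
        (\<Sum>i<n. t i - s i) < \<delta> \<longrightarrow>
        (\<Sum>i<n. Lp_norm m q (\<lambda>x. g (t i) x - g (s i) x)) < \<epsilon>)"

definition Lp_has_derivative ::
    "'a measure \<Rightarrow> real \<Rightarrow> (real \<Rightarrow> 'a \<Rightarrow> real) \<Rightarrow> ('a \<Rightarrow> real) \<Rightarrow> real \<Rightarrow> bool" where
  "Lp_has_derivative m q g v t \<longleftrightarrow>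
     v \<in> Lp m q \<and> Lp_conv m q (\<lambda>h x. (g (t + h) x - g t x) / h) v (at 0)"

text \<open>Only the values \<open>f t\<close> with \<open>t \<ge> 0\<close> matter.\<close>

definition mirror_flow ::
    "'a measure \<Rightarrow> real \<Rightarrow> (('a \<Rightarrow> real) \<Rightarrow> ereal) \<Rightarrow> ('a \<Rightarrow> real) \<Rightarrow> (real \<Rightarrow> 'a \<Rightarrow> real) \<Rightarrow> bool"
  where
  "mirror_flow m p \<Phi> f0 f \<longleftrightarrow>
     (\<forall>t\<ge>0. f t \<in> Lp m p) \<and>
     (AE x in m. f 0 x = f0 x) \<and>
     (\<forall>T>0. Lp_abs_cont m (conj_exp p) 0 T (\<lambda>t. J p (f t))) \<and>
     (AE t in lborel. t > 0 \<longrightarrow>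
        (\<exists>\<xi> \<in> Frechet_subdiff m p \<Phi> (f t).
           Lp_has_derivative m (conj_exp p) (\<lambda>s. J p (f s)) (\<lambda>x. - \<xi> x) t))"

definition omega_limit :: "'a measure \<Rightarrow> real \<Rightarrow> (real \<Rightarrow> 'a \<Rightarrow> real) \<Rightarrow> ('a \<Rightarrow> real) set" where
  "omega_limit m p f =
     {fs \<in> Lp m p. \<exists>t :: nat \<Rightarrow> real. (\<forall>n. 0 \<le> t n) \<and> filterlim t at_top sequentially \<and>
        Lp_conv m p (\<lambda>n. f (t n)) fs sequentially}"

end

theory Submission
  imports Defs
begin

text \<open>
  Write \<open>K = M + 1\<close>, \<open>\<phi> = Ch - K \<Psi>\<close> and let \<open>D\<close> be the Bregman divergence of \<open>\<Psi>\<close>, which for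
  \<open>p \<ge> 2\<close> dominates a multiple of \<open>\<parallel>g - f\<parallel>\<^sup>p\<close>. As \<open>\<phi> + K \<Psi>\<close> is convex, the flow satisfies the
  evolution variational inequality \<open>d/dt D(g, f t) \<le> \<phi>(g) - \<phi>(f t) + K D(g, f t)\<close> for every
  admissible \<open>g\<close>. It implies that \<open>\<phi>\<close> decreases along the flow; this makes the constraint on \<open>Ch\<close>
  inactive and, through the choice of \<open>M\<close>, forbids the norm to drop below \<open>1\<close>. On the sphere the
  normal cone is explicit, so that \<open>\<integral>J(f t) = 0\<close> is preserved. Taking \<open>g = f s\<close> in the inequality
  shows that \<open>f\<close> hardly moves over unit time intervals once \<open>Ch\<close> is close to its limit; passing to
  the limit in the inequality then exhibits \<open>K J f\<^sub>*\<close> as a constrained subgradient at every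
  \<open>\<omega>\<close>-limit point \<open>f\<^sub>*\<close>, which is the eigenvalue equation.

  For \<open>\<lambda>\<^sub>1\<close> one minimises directly: each \<open>g\<close> can be centred by adding a constant without changing
  its energy, so \<open>p Ch(g) \<ge> \<lambda>\<^sub>1 \<parallel>g - c\<parallel>\<^sup>p\<close> for some \<open>c\<close>, and convexity of the norm turns this
  into the subgradient inequality at a minimiser.

  Reflexivity of \<open>L\<^sup>p\<close> is never used: Clarkson's inequality makes minimising sequences of slopes
  converge strongly, which gives the minimal relaxed slope and describes \<open>Ch\<close> as the relaxation of the
  slope energy of Lipschitz functions.
\<close>

section \<open>Elementary inequalities\<close>

text \<open>The Bregman divergence is the distance that fits the flow: its time derivative is the
  pairing of the velocity of \<open>J p (f t)\<close> with f t - g, and K times the divergence is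
  exactly what the concave term -K Psi costs in the subgradient inequality. Thus only quantities
  that depend on \<open>J p (f t)\<close> are ever differentiated. The size of M gives K = p Ch(f0)
  + p + 1. Inside the unit ball, testing the equation with f t shows that the dual energy Psi*(J f
  t) grows at rate at least K - p Ch(f0) = p + 1 > 0, so the sphere cannot be left. On the sphere
  this energy is constant, hence the velocity of J f t annihilates f t; this fixes the Lagrange
  multiplier, and testing with the constant 1 gives a linear equation for the mean of J f t. The
  last statement rests on a squeeze: the limit is an eigenvalue between the first one and p Ch(f0),
  so a gap above the first eigenvalue leaves a single possibility.\<close>

lemma powr_above_tangent:
  fixes a b r :: real
  assumes "1 \<le> r" "0 \<le> a" "0 \<le> b"
  shows "a powr r + r * a powr (r - 1) * (b - a) \<le> b powr r"
proof (cases "a = 0")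
  case True then show ?thesis by simp
next
  case False
  then have a: "a > 0" using assms by simp
  show ?thesis
  proof (cases "b = 0")
    case True
    have "a powr r = a powr (r-1) * a"
      using a powr_mult_base[of a "r - 1"] by (simp add: mult.commute)
    then show ?thesis using True assms a
      by (simp add: algebra_simps mult_right_mono)
  next
    case False
    then have b: "b > 0" using assms by simp
    have "b powr r - a powr r \<ge> (r * a powr (r - 1)) * (b - a)"
    proof (rule convex_on_imp_above_tangent[where A="{0<..}"])
      show "convex_on {0<..} (\<lambda>x. x powr r)" using powr_convex assms by blast
      show "((\<lambda>x. x powr r) has_field_derivative r * a powr (r - 1)) (at a within {0<..})"
        using a by (auto intro!: derivative_eq_intros)
    qed (use a b in \<open>auto simp: interior_open\<close>)
    then show ?thesis by simp
  qed
qed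

lemma abs_powr_convex:
  fixes x y r s :: real
  assumes "1 \<le> r" "0 \<le> s" "s \<le> 1"
  shows "\<bar>(1 - s) * x + s * y\<bar> powr r \<le> (1 - s) * \<bar>x\<bar> powr r + s * \<bar>y\<bar> powr r"
proof -
  define z where "z = (1 - s) * \<bar>x\<bar> + s * \<bar>y\<bar>"
  have z0: "z \<ge> 0" unfolding z_def using assms by simp
  have "\<bar>(1 - s) * x + s * y\<bar> \<le> z"
    unfolding z_def using assms by (metis abs_mult abs_of_nonneg abs_triangle_ineq diff_ge_0_iff_ge)
  then have "\<bar>(1 - s) * x + s * y\<bar> powr r \<le> z powr r"
    using assms by (intro powr_mono2) auto
  \<comment> \<open>Both tangents are taken at the average \<open>z\<close>, so their linear parts
    cancel when averaged.\<close>
  also have "\<dots> = (1 - s) * (z powr r + r * z powr (r-1) * (\<bar>x\<bar> - z)) + s * (z powr r + r * z powr (r-1) * (\<bar>y\<bar> - z))"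
  proof -
    have "(1 - s) * (\<bar>x\<bar> - z) + s * (\<bar>y\<bar> - z) = 0" unfolding z_def by algebra
    then have "r * z powr (r-1) * ((1 - s) * (\<bar>x\<bar> - z) + s * (\<bar>y\<bar> - z)) = 0" by simp
    then show ?thesis by (simp add: algebra_simps)
  qed
  also have "\<dots> \<le> (1 - s) * \<bar>x\<bar> powr r + s * \<bar>y\<bar> powr r"
    using assms powr_above_tangent[OF assms(1) z0, of "\<bar>x\<bar>"] powr_above_tangent[OF assms(1) z0, of "\<bar>y\<bar>"]
    by (intro add_mono mult_left_mono) auto
  finally show ?thesis .
qed

lemma abs_add_powr_le:
  fixes x y r :: real
  assumes "1 \<le> r"
  shows "\<bar>x + y\<bar> powr r \<le> 2 powr r * (\<bar>x\<bar> powr r + \<bar>y\<bar> powr r)"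
proof -
  have "\<bar>x + y\<bar> powr r = 2 powr r * \<bar>(1 - 1/2) * x + (1/2) * y\<bar> powr r"
  proof -
    have "\<bar>x + y\<bar> = 2 * \<bar>(1 - 1/2) * x + (1/2) * y\<bar>" by (simp add: abs_if field_simps)
    then show ?thesis by (simp only: powr_mult)
  qed
  also have "\<dots> \<le> 2 powr r * ((1 - 1/2) * \<bar>x\<bar> powr r + (1/2) * \<bar>y\<bar> powr r)"
    by (intro mult_left_mono abs_powr_convex assms) auto
  also have "\<dots> \<le> 2 powr r * (\<bar>x\<bar> powr r + \<bar>y\<bar> powr r)"
    by (intro mult_left_mono add_mono) auto
  finally show ?thesis .
qed

text \<open>Each summand z is bounded by z^r <= z (x + y)^(r - 1), and these bounds add up to the
  right-hand side.\<close>

lemma powr_superadditive: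
  fixes x y r :: real
  assumes "1 \<le> r" "0 \<le> x" "0 \<le> y"
  shows "x powr r + y powr r \<le> (x + y) powr r"
proof (cases "x + y = 0")
  case True then have "x = 0" "y = 0" using assms by auto
  then show ?thesis by simp
next
  case False
  then have s: "x + y > 0" using assms by simp
  have *: "z powr r \<le> z * (x+y) powr (r-1)" if "0 \<le> z" "z \<le> x + y" for z
  proof (cases "z = 0")
    case False
    have "z powr r = z * z powr (r-1)" using that False by (simp add: powr_mult_base)
    also have "\<dots> \<le> z * (x+y) powr (r-1)" using that assms by (intro mult_left_mono powr_mono2) auto
    finally show ?thesis .
  qed simp
  have "x powr r + y powr r \<le> x * (x+y) powr (r-1) + y * (x+y) powr (r-1)"
    using assms by (intro add_mono *) auto
  also have "\<dots> = (x+y) powr r" using s by (simp add: powr_mult_base flip: distrib_right)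
  finally show ?thesis .
qed

text \<open>For squares this is the parallelogram identity. Superadditivity of t^(p/2) merges the
  two squares on the left, and convexity of the same power splits (a^2 + b^2)/2; both use p/2 >=
  1.\<close>

lemma clarkson_pointwise:
  fixes a b p :: real
  assumes "2 \<le> p"
  shows "\<bar>(a + b) / 2\<bar> powr p + \<bar>(a - b) / 2\<bar> powr p \<le> (\<bar>a\<bar> powr p + \<bar>b\<bar> powr p) / 2"
proof -
  have sq: "\<bar>x\<bar> powr p = (x\<^sup>2) powr (p/2)" for x :: real
  proof (cases "x = 0")
    case False
    then have "(x\<^sup>2) powr (p/2) = (\<bar>x\<bar> powr 2) powr (p/2)" by (simp add: powr_numeral)
    then show ?thesis by (simp only: powr_powr) simp
  qed simp
  have "\<bar>(a + b) / 2\<bar> powr p + \<bar>(a - b) / 2\<bar> powr p \<le> (((a+b)/2)\<^sup>2 + ((a-b)/2)\<^sup>2) powr (p/2)"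
    unfolding sq using assms by (intro powr_superadditive) auto
  also have "((a+b)/2)\<^sup>2 + ((a-b)/2)\<^sup>2 = (1 - 1/2) * a\<^sup>2 + (1/2) * b\<^sup>2"
    by (simp add: power2_eq_square field_simps)
  also have "\<dots> powr (p/2) \<le> (1 - 1/2) * (a\<^sup>2) powr (p/2) + (1/2) * (b\<^sup>2) powr (p/2)"
    using abs_powr_convex[of "p/2" "1/2" "a\<^sup>2" "b\<^sup>2"] assms by simp
  finally show ?thesis unfolding sq by simp
qed

text \<open>The derivative of |a|^p / p. This scalar form of \<open>J\<close> lets inequalities be
  proved pointwise and integrated afterwards.\<close>

definition spow :: "real \<Rightarrow> real \<Rightarrow> real" where
  "spow p a = \<bar>a\<bar> powr (p - 2) * a"

lemma J_eq_spow: "J p f = (\<lambda>x. spow p (f x))"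
  by (simp add: J_def spow_def)

lemma abs_spow: "\<bar>spow p a\<bar> = \<bar>a\<bar> powr (p - 1)"
proof (cases "a = 0")
  case False
  then have "\<bar>a\<bar> powr (p - 2) * \<bar>a\<bar> = \<bar>a\<bar> powr (p - 1)"
    by (simp add: powr_mult_base mult.commute)
  then show ?thesis by (simp add: spow_def abs_mult)
qed (simp add: spow_def)

lemma spow_mult_self: "spow p a * a = \<bar>a\<bar> powr p"
proof (cases "a = 0")
  case False
  have "spow p a * a = \<bar>a\<bar> powr (p - 2) * \<bar>a\<bar> powr 2" using False by (simp add: spow_def powr_numeral power2_eq_square mult.assoc flip: abs_mult)
  also have "\<dots> = \<bar>a\<bar> powr p" by (simp only: powr_add[symmetric]) simp
  finally show ?thesis .
qed (simp add: spow_def)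

lemma spow_above_tangent:
  assumes "1 \<le> p"
  shows "\<bar>a\<bar> powr p + p * spow p a * (b - a) \<le> \<bar>b\<bar> powr p"
proof -
  have 1: "\<bar>a\<bar> powr p + p * \<bar>a\<bar> powr (p - 1) * (\<bar>b\<bar> - \<bar>a\<bar>) \<le> \<bar>b\<bar> powr p"
    using powr_above_tangent[of p "\<bar>a\<bar>" "\<bar>b\<bar>"] assms by simp
  have "spow p a * b \<le> \<bar>a\<bar> powr (p - 1) * \<bar>b\<bar>"
    by (metis abs_spow abs_ge_self abs_mult)
  moreover have "spow p a * a = \<bar>a\<bar> powr (p - 1) * \<bar>a\<bar>"
    by (metis abs_spow abs_mult spow_mult_self abs_of_nonneg powr_ge_zero)
  ultimately have "spow p a * (b - a) \<le> \<bar>a\<bar> powr (p - 1) * (\<bar>b\<bar> - \<bar>a\<bar>)"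
    by (simp add: algebra_simps)
  then have "p * (spow p a * (b - a)) \<le> p * (\<bar>a\<bar> powr (p - 1) * (\<bar>b\<bar> - \<bar>a\<bar>))"
    using assms by (intro mult_left_mono) auto
  with 1 show ?thesis by (simp add: mult.assoc)
qed

text \<open>The tangent at a is followed only up to the midpoint, and Clarkson's inequality leads
  from there to b. Its defect |(a - b)/2|^p, doubled, is the additional term; hence the constant
  2^(1 - p).\<close>

lemma spow_strongly_above_tangent:
  assumes "2 \<le> p"
  shows "\<bar>a\<bar> powr p + p * spow p a * (b - a) + 2 powr (1 - p) * \<bar>b - a\<bar> powr p \<le> \<bar>b\<bar> powr p"
proof -
  have "\<bar>a\<bar> powr p + p * spow p a * ((a + b) / 2 - a) \<le> \<bar>(a + b) / 2\<bar> powr p"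
    using assms by (intro spow_above_tangent) simp
  moreover have "\<bar>(a + b) / 2\<bar> powr p + \<bar>(a - b) / 2\<bar> powr p \<le> (\<bar>a\<bar> powr p + \<bar>b\<bar> powr p) / 2"
    by (rule clarkson_pointwise[OF assms])
  moreover have "\<bar>(a - b) / 2\<bar> powr p = 2 powr (1 - p) * \<bar>b - a\<bar> powr p / 2"
    by (simp add: powr_divide powr_diff abs_minus_commute)
  moreover have "p * spow p a * ((a + b) / 2 - a) = p * spow p a * (b - a) / 2" by (simp add: field_simps)
  ultimately show ?thesis by (simp add: field_simps)
qed

lemma spow_minus: "spow p (- a) = - spow p a"
  by (simp add: spow_def)

lemma spow_mult: "spow p (c * a) = spow p c * spow p a"
  by (simp add: spow_def abs_mult powr_mult)

text \<open>For equal signs this comes from the tangent inequality for the power p - 1 >= 1. For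
  opposite signs |a - b| = |a| + |b|, and the triangle inequality is enough. Symmetry and oddness
  reduce the six cases to these two.\<close>

lemma spow_diff_le:
  assumes "2 \<le> p"
  shows "\<bar>spow p a - spow p b\<bar> \<le> (p - 1) * \<bar>a - b\<bar> * (\<bar>a\<bar> + \<bar>b\<bar>) powr (p - 2)"
proof -
  have spowpos: "spow p a = a powr (p - 1)" if "a \<ge> 0" for a
    using that abs_spow[of p a] by (simp add: spow_def)
  have pos: "\<bar>spow p a - spow p b\<bar> \<le> (p - 1) * \<bar>a - b\<bar> * (\<bar>a\<bar> + \<bar>b\<bar>) powr (p - 2)" if "0 \<le> b" "b \<le> a" for a b
  proof -
    have "b powr (p - 1) \<le> a powr (p - 1)" using that assms by (intro powr_mono2) auto
    then have "\<bar>spow p a - spow p b\<bar> = a powr (p - 1) - b powr (p - 1)" using that by (simp add: spowpos)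
    also have "\<dots> \<le> (p - 1) * (a - b) * a powr (p - 2)"
      using powr_above_tangent[of "p - 1" a b] assms that by (simp add: algebra_simps)
    also have "\<dots> \<le> (p - 1) * (a - b) * (\<bar>a\<bar> + \<bar>b\<bar>) powr (p - 2)"
      using that assms by (intro mult_left_mono powr_mono2) auto
    finally show ?thesis using that by simp
  qed
  have opp: "\<bar>spow p a - spow p b\<bar> \<le> (p - 1) * \<bar>a - b\<bar> * (\<bar>a\<bar> + \<bar>b\<bar>) powr (p - 2)" if "b \<le> 0" "0 \<le> a" for a b
  proof -
    have 1: "\<bar>spow p z\<bar> \<le> \<bar>z\<bar> * (\<bar>a\<bar> + \<bar>b\<bar>) powr (p - 2)" if "\<bar>z\<bar> \<le> \<bar>a\<bar> + \<bar>b\<bar>" for z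
      unfolding spow_def abs_mult using that assms
      by (subst mult.commute) (intro mult_left_mono, auto intro!: powr_mono2)
    have "\<bar>spow p a - spow p b\<bar> \<le> \<bar>spow p a\<bar> + \<bar>spow p b\<bar>" by simp
    also have "\<dots> \<le> \<bar>a\<bar> * (\<bar>a\<bar> + \<bar>b\<bar>) powr (p - 2) + \<bar>b\<bar> * (\<bar>a\<bar> + \<bar>b\<bar>) powr (p - 2)"
      by (intro add_mono 1) auto
    also have "\<dots> = 1 * (\<bar>a - b\<bar> * (\<bar>a\<bar> + \<bar>b\<bar>) powr (p - 2))" using that by (simp add: algebra_simps)
    also have "\<dots> \<le> (p - 1) * (\<bar>a - b\<bar> * (\<bar>a\<bar> + \<bar>b\<bar>) powr (p - 2))"
      using assms by (intro mult_right_mono) auto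
    finally show ?thesis by (simp add: mult.assoc)
  qed
  consider "0 \<le> b" "b \<le> a" | "0 \<le> a" "a \<le> b" | "b \<le> 0" "0 \<le> a" | "a \<le> 0" "0 \<le> b"
    | "0 \<le> -b" "-b \<le> -a" | "0 \<le> -a" "-a \<le> -b" by linarith
  then show ?thesis
  proof cases
    case 1 then show ?thesis by (rule pos)
  next
    case 2 then show ?thesis using pos[of a b] by (simp add: abs_minus_commute add.commute)
  next
    case 3 then show ?thesis by (rule opp)
  next
    case 4 then show ?thesis using opp[of a b] by (simp add: abs_minus_commute add.commute)
  next
    case 5 then show ?thesis using pos[of "-b" "-a"] by (simp add: spow_minus abs_minus_commute add.commute)
  next
    case 6 then show ?thesis using pos[of "-a" "-b"] by (simp add: spow_minus abs_minus_commute add.commute)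
  qed
qed

lemma borel_measurable_spow [measurable]: "spow p \<in> borel_measurable borel"
  unfolding spow_def by measurable

section \<open>Lebesgue spaces\<close>

text \<open>The r-th power of the norm. Being an integral, it inherits pointwise inequalities
  directly and is differentiated without excluding the zero function.\<close>

definition Lp_pow :: "'a measure \<Rightarrow> real \<Rightarrow> ('a \<Rightarrow> real) \<Rightarrow> real" where
  "Lp_pow m r f = (\<integral>x. \<bar>f x\<bar> powr r \<partial>m)"

lemma Lp_pow_nonneg [simp]: "0 \<le> Lp_pow m r f"
  by (simp add: Lp_pow_def)

lemma Lp_norm_nonneg [simp]: "0 \<le> Lp_norm m r f"
  by (simp add: Lp_norm_def)

lemma Lp_norm_eq_pow: "Lp_norm m r f = Lp_pow m r f powr (1 / r)"
  by (simp add: Lp_norm_def Lp_pow_def)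

lemma Lp_norm_powr: "0 < r \<Longrightarrow> Lp_norm m r f powr r = Lp_pow m r f"
  by (simp add: Lp_norm_eq_pow powr_powr)

lemma Lp_measurable: "f \<in> Lp m r \<Longrightarrow> f \<in> borel_measurable m"
  and Lp_integrable: "f \<in> Lp m r \<Longrightarrow> integrable m (\<lambda>x. \<bar>f x\<bar> powr r)"
  by (auto simp: Lp_def)

lemma LpI: "f \<in> borel_measurable m \<Longrightarrow> integrable m (\<lambda>x. \<bar>f x\<bar> powr r) \<Longrightarrow> f \<in> Lp m r"
  by (auto simp: Lp_def)

lemma Lp_dominated:
  assumes "g \<in> Lp m r" "f \<in> borel_measurable m" "AE x in m. \<bar>f x\<bar> \<le> \<bar>g x\<bar>" "0 \<le> r"
  shows "f \<in> Lp m r"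
proof (rule LpI)
  show "integrable m (\<lambda>x. \<bar>f x\<bar> powr r)"
  proof (rule Bochner_Integration.integrable_bound[OF Lp_integrable[OF assms(1)]])
    show "AE x in m. norm (\<bar>f x\<bar> powr r) \<le> norm (\<bar>g x\<bar> powr r)"
      using assms(3) by eventually_elim (use assms(4) in \<open>auto intro!: powr_mono2\<close>)
  qed (use assms(2) in measurable)
qed fact

lemma Lp_pow_mono:
  assumes "g \<in> Lp m r" "f \<in> borel_measurable m" "AE x in m. \<bar>f x\<bar> \<le> \<bar>g x\<bar>" "0 \<le> r"
  shows "Lp_pow m r f \<le> Lp_pow m r g"
  unfolding Lp_pow_def
proof (rule integral_mono_AE)
  show "integrable m (\<lambda>x. \<bar>f x\<bar> powr r)" using Lp_dominated[OF assms] Lp_integrable by blast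
  show "AE x in m. \<bar>f x\<bar> powr r \<le> \<bar>g x\<bar> powr r"
    using assms(3) by eventually_elim (use assms(4) in \<open>auto intro!: powr_mono2\<close>)
qed (use assms Lp_integrable in blast)

lemma Lp_norm_mono:
  assumes "g \<in> Lp m r" "f \<in> borel_measurable m" "AE x in m. \<bar>f x\<bar> \<le> \<bar>g x\<bar>" "0 \<le> r"
  shows "Lp_norm m r f \<le> Lp_norm m r g"
  unfolding Lp_norm_eq_pow using Lp_pow_mono[OF assms] assms(4) by (intro powr_mono2) auto

lemma Lp_pow_cong_AE:
  assumes "f \<in> borel_measurable m" "g \<in> borel_measurable m" "AE x in m. f x = g x"
  shows "Lp_pow m r f = Lp_pow m r g"
  unfolding Lp_pow_def using assms by (intro integral_cong_AE) (auto elim: eventually_mono)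

lemma Lp_norm_cong_AE:
  assumes "f \<in> borel_measurable m" "g \<in> borel_measurable m" "AE x in m. f x = g x"
  shows "Lp_norm m r f = Lp_norm m r g"
  unfolding Lp_norm_eq_pow using Lp_pow_cong_AE[OF assms] by simp

lemma Lp_cmult: "f \<in> Lp m r \<Longrightarrow> (\<lambda>x. c * f x) \<in> Lp m r"
  by (auto simp: Lp_def abs_mult powr_mult)

lemma Lp_pow_cmult: "Lp_pow m r (\<lambda>x. c * f x) = \<bar>c\<bar> powr r * Lp_pow m r f"
  by (simp add: Lp_pow_def abs_mult powr_mult)

lemma Lp_norm_cmult: "0 < r \<Longrightarrow> Lp_norm m r (\<lambda>x. c * f x) = \<bar>c\<bar> * Lp_norm m r f"
  by (simp add: Lp_norm_eq_pow Lp_pow_cmult powr_mult powr_powr)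

lemma Lp_add:
  assumes "1 \<le> r" "f \<in> Lp m r" "g \<in> Lp m r"
  shows "(\<lambda>x. f x + g x) \<in> Lp m r"
proof (rule LpI)
  note [measurable] = Lp_measurable[OF assms(2)] Lp_measurable[OF assms(3)]
  show "(\<lambda>x. f x + g x) \<in> borel_measurable m" by measurable
  show "integrable m (\<lambda>x. \<bar>f x + g x\<bar> powr r)"
  proof (rule Bochner_Integration.integrable_bound)
    show "integrable m (\<lambda>x. 2 powr r * (\<bar>f x\<bar> powr r + \<bar>g x\<bar> powr r))"
      using Lp_integrable[OF assms(2)] Lp_integrable[OF assms(3)] by simp
    show "AE x in m. norm (\<bar>f x + g x\<bar> powr r) \<le> norm (2 powr r * (\<bar>f x\<bar> powr r + \<bar>g x\<bar> powr r))"
      using abs_add_powr_le[OF assms(1)] by (intro AE_I2) auto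
  qed measurable
qed

lemma Lp_uminus: "f \<in> Lp m r \<Longrightarrow> (\<lambda>x. - f x) \<in> Lp m r"
  using Lp_cmult[of f m r "-1"] by simp

lemma Lp_diff:
  assumes "1 \<le> r" "f \<in> Lp m r" "g \<in> Lp m r"
  shows "(\<lambda>x. f x - g x) \<in> Lp m r"
  using Lp_add[OF assms(1,2) Lp_uminus[OF assms(3)]] by simp

lemma Lp_abs: "f \<in> Lp m r \<Longrightarrow> (\<lambda>x. \<bar>f x\<bar>) \<in> Lp m r"
  by (auto simp: Lp_def)

lemma Lp_norm_abs: "Lp_norm m r (\<lambda>x. \<bar>f x\<bar>) = Lp_norm m r f"
  by (simp add: Lp_norm_def)

lemma (in finite_measure) Lp_const: "(\<lambda>x. c) \<in> Lp M r"
  by (auto simp: Lp_def)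

lemma Lp_norm_minus_commute: "Lp_norm m r (\<lambda>x. f x - g x) = Lp_norm m r (\<lambda>x. g x - f x)"
  by (simp add: Lp_norm_def abs_minus_commute)

lemma Lp_pow_eq_0_iff:
  assumes "f \<in> Lp m r" "0 < r"
  shows "Lp_pow m r f = 0 \<longleftrightarrow> (AE x in m. f x = 0)"
  unfolding Lp_pow_def
  by (subst integral_nonneg_eq_0_iff_AE[OF Lp_integrable[OF assms(1)]]) auto

lemma Lp_norm_eq_0_iff:
  assumes "f \<in> Lp m r" "0 < r"
  shows "Lp_norm m r f = 0 \<longleftrightarrow> (AE x in m. f x = 0)"
  unfolding Lp_norm_eq_pow using Lp_pow_eq_0_iff[OF assms] by simp

lemma Lp_pow_convex:
  assumes "1 \<le> r" "f \<in> Lp m r" "g \<in> Lp m r" "0 \<le> s" "s \<le> 1"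
  shows "Lp_pow m r (\<lambda>x. (1 - s) * f x + s * g x) \<le> (1 - s) * Lp_pow m r f + s * Lp_pow m r g"
proof -
  have "Lp_pow m r (\<lambda>x. (1 - s) * f x + s * g x)
      \<le> (\<integral>x. (1 - s) * \<bar>f x\<bar> powr r + s * \<bar>g x\<bar> powr r \<partial>m)"
    unfolding Lp_pow_def
    using assms by (intro integral_mono abs_powr_convex Lp_integrable Lp_add Lp_cmult
        Bochner_Integration.integrable_add integrable_mult_right) auto
  also have "\<dots> = (1 - s) * Lp_pow m r f + s * Lp_pow m r g"
    using Lp_integrable[OF assms(2)] Lp_integrable[OF assms(3)] by (simp add: Lp_pow_def)
  finally show ?thesis .
qed

text \<open>Divided by A + B, the sum f + g is a convex combination of the normalised functions, and
  convexity of the r-th power bounds its norm by 1. Vanishing norms, where normalising fails, are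
  set apart.\<close>

lemma Lp_norm_triangle:
  assumes "1 \<le> r" "f \<in> Lp m r" "g \<in> Lp m r"
  shows "Lp_norm m r (\<lambda>x. f x + g x) \<le> Lp_norm m r f + Lp_norm m r g"
proof -
  define A B where "A = Lp_norm m r f" and "B = Lp_norm m r g"
  have r: "r > 0" using assms by simp
  have meas [measurable]: "f \<in> borel_measurable m" "g \<in> borel_measurable m" using assms Lp_measurable by auto
  have AB: "A \<ge> 0" "B \<ge> 0" by (auto simp: A_def B_def)
  consider "A = 0" | "B = 0" | "A > 0" "B > 0" using AB by linarith
  then show ?thesis
  proof cases
    case 1
    then have "AE x in m. f x = 0" using Lp_norm_eq_0_iff[OF assms(2) r] by (simp add: A_def)
    then have "Lp_norm m r (\<lambda>x. f x + g x) = Lp_norm m r g" by (intro Lp_norm_cong_AE) auto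
    then show ?thesis by simp
  next
    case 2
    then have "AE x in m. g x = 0" using Lp_norm_eq_0_iff[OF assms(3) r] by (simp add: B_def)
    then have "Lp_norm m r (\<lambda>x. f x + g x) = Lp_norm m r f" by (intro Lp_norm_cong_AE) auto
    then show ?thesis by simp
  next
    case 3
    define s where "s = B / (A + B)"
    have s: "0 \<le> s" "s \<le> 1" "1 - s = A / (A + B)" using 3 by (auto simp: s_def field_simps)
    define f' g' where "f' = (\<lambda>x. inverse A * f x)" and "g' = (\<lambda>x. inverse B * g x)"
    have "Lp_norm m r f' = 1" "Lp_norm m r g' = 1"
      unfolding f'_def g'_def using 3 r by (auto simp: Lp_norm_cmult A_def[symmetric] B_def[symmetric])
    then have n1: "Lp_pow m r f' = 1" "Lp_pow m r g' = 1" using Lp_norm_powr[OF r] by (metis powr_one_eq_one)+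
    have in': "f' \<in> Lp m r" "g' \<in> Lp m r" unfolding f'_def g'_def by (auto intro: Lp_cmult assms)
    have "Lp_pow m r (\<lambda>x. (1 - s) * f' x + s * g' x) \<le> 1"
      using Lp_pow_convex[OF assms(1) in' s(1,2)] n1 by simp
    then have "Lp_norm m r (\<lambda>x. (1 - s) * f' x + s * g' x) \<le> 1"
      unfolding Lp_norm_eq_pow using r powr_mono2[of "1/r" "Lp_pow m r (\<lambda>x. (1 - s) * f' x + s * g' x)" 1] by simp
    moreover have "(\<lambda>x. (1 - s) * f' x + s * g' x) = (\<lambda>x. inverse (A + B) * (f x + g x))"
    proof -
      have "(1 - s) * inverse A = inverse (A + B)" "s * inverse B = inverse (A + B)"
        unfolding s(3) using 3 by (auto simp: s_def field_simps)
      then show ?thesis by (simp add: f'_def g'_def distrib_left flip: mult.assoc)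
    qed
    ultimately have "inverse (A + B) * Lp_norm m r (\<lambda>x. f x + g x) \<le> 1"
      using 3 r by (simp add: Lp_norm_cmult)
    then show ?thesis using 3 by (simp add: field_simps A_def B_def)
  qed
qed

lemma Lp_norm_triangle_diff:
  assumes "1 \<le> r" "f \<in> Lp m r" "g \<in> Lp m r" "h \<in> Lp m r"
  shows "Lp_norm m r (\<lambda>x. f x - h x) \<le> Lp_norm m r (\<lambda>x. f x - g x) + Lp_norm m r (\<lambda>x. g x - h x)"
  using Lp_norm_triangle[OF assms(1) Lp_diff[OF assms(1,2,3)] Lp_diff[OF assms(1,3,4)]] by simp

lemma Lp_norm_reverse_triangle:
  assumes "1 \<le> r" "f \<in> Lp m r" "g \<in> Lp m r"
  shows "\<bar>Lp_norm m r f - Lp_norm m r g\<bar> \<le> Lp_norm m r (\<lambda>x. f x - g x)"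
proof -
  have "Lp_norm m r f \<le> Lp_norm m r (\<lambda>x. f x - g x) + Lp_norm m r g"
    using Lp_norm_triangle[OF assms(1) Lp_diff[OF assms] assms(3)] by simp
  moreover have "Lp_norm m r g \<le> Lp_norm m r (\<lambda>x. g x - f x) + Lp_norm m r f"
    using Lp_norm_triangle[OF assms(1) Lp_diff[OF assms(1,3,2)] assms(2)] by simp
  ultimately show ?thesis using Lp_norm_minus_commute[of m r f g] by linarith
qed

lemma Lp_norm_tendsto:
  assumes "1 \<le> r" "eventually (\<lambda>n. u n \<in> Lp m r) F" "f \<in> Lp m r" "Lp_conv m r u f F"
  shows "((\<lambda>n. Lp_norm m r (u n)) \<longlongrightarrow> Lp_norm m r f) F"
proof -
  have "((\<lambda>n. Lp_norm m r (u n) - Lp_norm m r f) \<longlongrightarrow> 0) F"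
    using assms(4) unfolding Lp_conv_def
    by (rule Lim_null_comparison[rotated])
      (use assms(2) in eventually_elim, use assms Lp_norm_reverse_triangle in auto)
  then show ?thesis by (simp add: LIM_zero_iff)
qed

lemma Lp_norm_sum_le:
  assumes "1 \<le> r" "\<And>i. i \<in> I \<Longrightarrow> f i \<in> Lp m r" "finite I"
  shows "(\<lambda>x. \<Sum>i\<in>I. f i x) \<in> Lp m r \<and> Lp_norm m r (\<lambda>x. \<Sum>i\<in>I. f i x) \<le> (\<Sum>i\<in>I. Lp_norm m r (f i))"
  using assms(3,2)
proof (induction rule: finite_induct)
  case empty
  show ?case by (auto simp: Lp_def Lp_norm_def)
next
  case (insert i I)
  then have i: "f i \<in> Lp m r"
    and IH: "(\<lambda>x. \<Sum>i\<in>I. f i x) \<in> Lp m r" "Lp_norm m r (\<lambda>x. \<Sum>i\<in>I. f i x) \<le> (\<Sum>i\<in>I. Lp_norm m r (f i))"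
    by auto
  show ?case
    using Lp_norm_triangle[OF assms(1) i IH(1)] Lp_add[OF assms(1) i IH(1)] IH(2) insert.hyps
    by simp
qed

section \<open>Completeness and Hoelder's inequality\<close>

lemma Lp_pow_nn_integral:
  assumes "f \<in> Lp m r"
  shows "(\<integral>\<^sup>+x. ennreal (\<bar>f x\<bar> powr r) \<partial>m) = ennreal (Lp_pow m r f)"
  unfolding Lp_pow_def by (rule nn_integral_eq_integral[OF Lp_integrable[OF assms]]) auto

text \<open>The Riesz-Fischer argument: a fast subsequence converges almost everywhere because the
  sum \<open>W\<close> of its increments stays bounded in norm, and Fatou's lemma then gives norm
  convergence of the whole sequence.\<close>

lemma Lp_complete:
  assumes r: "1 \<le> r" and u: "\<And>n. u n \<in> Lp m r"
    and Cauchy: "\<And>e. e > 0 \<Longrightarrow> \<exists>N. \<forall>i\<ge>N. \<forall>j\<ge>N. Lp_norm m r (\<lambda>x. u i x - u j x) \<le> e"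
  shows "\<exists>g\<in>Lp m r. Lp_conv m r u g sequentially"
proof -
  have r0: "r > 0" using r by simp
  have [measurable]: "u n \<in> borel_measurable m" for n using u Lp_measurable by blast
  have "\<exists>N. \<forall>k. (\<forall>i\<ge>N k. \<forall>j\<ge>N k. Lp_norm m r (\<lambda>x. u i x - u j x) \<le> (1/2)^k) \<and> True"
    using Cauchy[of "(1/2)^k" for k] by (intro choice) auto
  then obtain N where N: "\<And>k i j. i \<ge> N k \<Longrightarrow> j \<ge> N k \<Longrightarrow> Lp_norm m r (\<lambda>x. u i x - u j x) \<le> (1/2)^k"
    by blast
  \<comment> \<open>Summing the thresholds makes the indices monotone and at least
    \<open>N k\<close>; the extra k makes them unbounded.\<close>
  define n where "n k = (\<Sum>i\<le>k. N i) + k" for k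
  have n_ge: "n k \<ge> N k" for k unfolding n_def by (simp add: trans_le_add1 member_le_sum)
  have n_Suc: "n (Suc k) \<ge> n k" for k by (simp add: n_def)
  have n_k: "n k \<ge> k" for k by (simp add: n_def)
  define v where "v k = u (n k)" for k
  have v: "v k \<in> Lp m r" for k by (simp add: v_def u)
  have [measurable]: "v k \<in> borel_measurable m" for k using v Lp_measurable by blast
  define W where "W k x = (\<Sum>i<k. \<bar>v (Suc i) x - v i x\<bar>)" for k x
  have [measurable]: "W k \<in> borel_measurable m" for k unfolding W_def by measurable
  have W0: "W k x \<ge> 0" for k x by (simp add: W_def sum_nonneg)
  have W: "W k \<in> Lp m r" "Lp_norm m r (W k) \<le> 2" for k
  proof -
    have *: "(\<lambda>x. \<bar>v (Suc i) x - v i x\<bar>) \<in> Lp m r" for i using Lp_abs Lp_diff r v by blast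
    have "Lp_norm m r (\<lambda>x. \<bar>v (Suc i) x - v i x\<bar>) \<le> (1/2)^i" for i
      unfolding Lp_norm_abs v_def using n_ge[of i] n_Suc[of i] by (intro N) auto
    then have "(\<Sum>i<k. Lp_norm m r (\<lambda>x. \<bar>v (Suc i) x - v i x\<bar>)) \<le> (\<Sum>i<k. (1/2)^i)"
      by (intro sum_mono)
    also have "\<dots> \<le> (\<Sum>i. (1/2::real)^i)" by (intro sum_le_suminf) auto
    also have "\<dots> = 2" by (simp add: suminf_geometric)
    finally show "W k \<in> Lp m r" "Lp_norm m r (W k) \<le> 2"
      using Lp_norm_sum_le[OF r, of "{..<k}" "\<lambda>i x. \<bar>v (Suc i) x - v i x\<bar>" m] * unfolding W_def by auto
  qed
  have Wpow: "Lp_pow m r (W k) \<le> 2 powr r" for k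
    using W(2)[of k] powr_mono2[of r "Lp_norm m r (W k)" 2] r0 by (simp add: Lp_norm_powr)
  have "(\<integral>\<^sup>+x. (SUP k. ennreal (W k x powr r)) \<partial>m) = (SUP k. \<integral>\<^sup>+x. ennreal (W k x powr r) \<partial>m)"
  proof (rule nn_integral_monotone_convergence_SUP)
    show "incseq (\<lambda>k x. ennreal (W k x powr r))"
    proof (rule incseq_SucI, rule le_funI, rule ennreal_leI, rule powr_mono2)
      show "W i x \<le> W (Suc i) x" for i x by (simp add: W_def)
    qed (use r0 W0 in auto)
  qed measurable
  also have "\<dots> \<le> ennreal (2 powr r)"
  proof (rule SUP_least)
    fix k
    have "(\<integral>\<^sup>+x. ennreal (W k x powr r) \<partial>m) = ennreal (Lp_pow m r (W k))"
      using Lp_pow_nn_integral[OF W(1)[of k]] W0 by simp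
    then show "(\<integral>\<^sup>+x. ennreal (W k x powr r) \<partial>m) \<le> ennreal (2 powr r)" using Wpow by (simp add: ennreal_leI)
  qed
  finally have "(\<integral>\<^sup>+x. (SUP k. ennreal (W k x powr r)) \<partial>m) \<noteq> \<infinity>" by (auto simp: top_unique)
  then have AE1: "AE x in m. (SUP k. ennreal (W k x powr r)) \<noteq> \<infinity>"
    by (intro nn_integral_PInf_AE) measurable
  have AE_conv: "AE x in m. convergent (\<lambda>k. v k x)"
    using AE1
  proof eventually_elim
    case (elim x)
    then obtain C where C: "C \<ge> 0" "(SUP k. ennreal (W k x powr r)) = ennreal C"
      by (cases "(SUP k. ennreal (W k x powr r))") auto
    have "W k x \<le> C powr (1/r)" for k
    proof -
      have "ennreal (W k x powr r) \<le> ennreal C" using C(2) by (metis SUP_upper UNIV_I)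
      then have "W k x powr r \<le> C" using C by simp
      then have "(W k x powr r) powr (1/r) \<le> C powr (1/r)" using r0 by (intro powr_mono2) auto
      then show ?thesis using r0 W0 by (simp add: powr_powr)
    qed
    then have "summable (\<lambda>i. \<bar>v (Suc i) x - v i x\<bar>)"
      unfolding W_def by (intro summableI_nonneg_bounded) auto
    then have "summable (\<lambda>i. v (Suc i) x - v i x)" by (rule summable_rabs_cancel)
    then have "convergent (\<lambda>k. v k x - v 0 x)"
      unfolding summable_iff_convergent sum_lessThan_telescope[of "\<lambda>i. v i x"] .
    then obtain L where "(\<lambda>k. v k x - v 0 x) \<longlonglongrightarrow> L" by (auto simp: convergent_def)
    from tendsto_add[OF this tendsto_const[of "v 0 x"]] show ?case by (auto simp: convergent_def)
  qed
  define g where "g x = lim (\<lambda>k. v k x)" for x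
  have [measurable]: "g \<in> borel_measurable m" unfolding g_def by measurable
  have AE_g: "AE x in m. (\<lambda>k. v k x) \<longlonglongrightarrow> g x"
    using AE_conv by eventually_elim (simp add: g_def convergent_LIMSEQ_iff)
  \<comment> \<open>Fatou along the subsequence bounds the distance of every single
    \<open>u i\<close> from the limit, so the full sequence is treated at once.\<close>
  have key: "(\<integral>\<^sup>+x. ennreal (\<bar>u i x - g x\<bar> powr r) \<partial>m) \<le> ennreal (e powr r)"
    if "e > 0" "\<And>j. j \<ge> K \<Longrightarrow> Lp_norm m r (\<lambda>x. u i x - u j x) \<le> e" for e K i
  proof -
    have "(\<integral>\<^sup>+x. ennreal (\<bar>u i x - g x\<bar> powr r) \<partial>m) \<le> (\<integral>\<^sup>+x. liminf (\<lambda>k. ennreal (\<bar>u i x - v k x\<bar> powr r)) \<partial>m)"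
    proof (rule nn_integral_mono_AE, use AE_g in eventually_elim)
      case (elim x)
      have "(\<lambda>k. ennreal (\<bar>u i x - v k x\<bar> powr r)) \<longlonglongrightarrow> ennreal (\<bar>u i x - g x\<bar> powr r)"
        using elim r0 by (intro tendsto_ennrealI tendsto_powr2 tendsto_intros) auto
      then show ?case by (metis lim_imp_Liminf order_refl trivial_limit_sequentially)
    qed
    also have "\<dots> \<le> liminf (\<lambda>k. \<integral>\<^sup>+x. ennreal (\<bar>u i x - v k x\<bar> powr r) \<partial>m)"
      by (rule nn_integral_liminf) measurable
    also have "\<dots> \<le> ennreal (e powr r)"
    proof (rule order_trans[OF Liminf_le_Limsup Limsup_bounded], simp, rule eventually_sequentiallyI)
      fix k assume "k \<ge> K"
      then have "Lp_norm m r (\<lambda>x. u i x - v k x) \<le> e" unfolding v_def using n_k[of k] by (intro that(2)) auto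
      then have "Lp_pow m r (\<lambda>x. u i x - v k x) \<le> e powr r"
        using powr_mono2[of r "Lp_norm m r (\<lambda>x. u i x - v k x)" e] r0 by (simp add: Lp_norm_powr)
      then show "(\<integral>\<^sup>+x. ennreal (\<bar>u i x - v k x\<bar> powr r) \<partial>m) \<le> ennreal (e powr r)"
        by (subst Lp_pow_nn_integral) (auto intro: Lp_diff r u v ennreal_leI)
    qed
    finally show ?thesis .
  qed
  have ug: "(\<lambda>x. u i x - g x) \<in> Lp m r" "Lp_norm m r (\<lambda>x. u i x - g x) \<le> e"
    if "e > 0" "\<And>j. j \<ge> K \<Longrightarrow> Lp_norm m r (\<lambda>x. u i x - u j x) \<le> e" for e K i
  proof -
    show in': "(\<lambda>x. u i x - g x) \<in> Lp m r"
    proof (rule LpI)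
      show "integrable m (\<lambda>x. \<bar>u i x - g x\<bar> powr r)"
      proof (rule integrableI_bounded)
        show "(\<integral>\<^sup>+x. ennreal (norm (\<bar>u i x - g x\<bar> powr r)) \<partial>m) < \<infinity>"
          using order_le_less_trans[OF key[OF that] ennreal_less_top] by simp
      qed measurable
    qed measurable
    have "ennreal (Lp_pow m r (\<lambda>x. u i x - g x)) \<le> ennreal (e powr r)"
      using key[OF that] Lp_pow_nn_integral[OF in'] by simp
    then have "Lp_pow m r (\<lambda>x. u i x - g x) \<le> e powr r" by simp
    then have "Lp_norm m r (\<lambda>x. u i x - g x) \<le> (e powr r) powr (1/r)"
      unfolding Lp_norm_eq_pow using r0 by (intro powr_mono2) auto
    then show "Lp_norm m r (\<lambda>x. u i x - g x) \<le> e" using r0 that(1) by (simp add: powr_powr)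
  qed
  obtain N1 where N1: "\<forall>i\<ge>N1. \<forall>j\<ge>N1. Lp_norm m r (\<lambda>x. u i x - u j x) \<le> 1" using Cauchy[of 1] by auto
  have "(\<lambda>x. u N1 x - g x) \<in> Lp m r"
    using N1 by (intro ug(1)[of 1 N1 N1]) auto
  then have "(\<lambda>x. u N1 x - (u N1 x - g x)) \<in> Lp m r"
    by (rule Lp_diff[OF r u])
  then have "g \<in> Lp m r" by simp
  moreover have "Lp_conv m r u g sequentially"
    unfolding Lp_conv_def
  proof (rule LIMSEQ_I)
    fix e :: real assume "e > 0"
    then obtain K where K: "\<forall>i\<ge>K. \<forall>j\<ge>K. Lp_norm m r (\<lambda>x. u i x - u j x) \<le> e/2" using Cauchy[of "e/2"] by auto
    have "Lp_norm m r (\<lambda>x. u i x - g x) < e" if "i \<ge> K" for i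
      using ug(2)[of "e/2" K i] K that \<open>e > 0\<close> by auto
    then show "\<exists>no. \<forall>n\<ge>no. norm (Lp_norm m r (\<lambda>x. u n x - g x) - 0) < e" by auto
  qed
  ultimately show ?thesis by blast
qed

lemma conj_exp_gt_1: "1 < p \<Longrightarrow> 1 < conj_exp p"
  by (simp add: conj_exp_def field_simps)

lemma conj_exp_sum: "1 < p \<Longrightarrow> 1 / p + 1 / conj_exp p = 1"
  by (simp add: conj_exp_def field_simps)

lemma conj_exp_mult: "1 < p \<Longrightarrow> (p - 1) * conj_exp p = p"
  by (simp add: conj_exp_def)

text \<open>Young's inequality, integrated for the functions divided by their norms. Without
  normalisation it already gives integrability of the product.\<close>

lemma Holder:
  assumes p: "1 < p" and xi: "\<xi> \<in> Lp m (conj_exp p)" and f: "f \<in> Lp m p"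
  shows "integrable m (\<lambda>x. \<xi> x * f x)"
    and "(\<integral>x. \<bar>\<xi> x * f x\<bar> \<partial>m) \<le> Lp_norm m (conj_exp p) \<xi> * Lp_norm m p f"
    and "\<bar>pairing m \<xi> f\<bar> \<le> Lp_norm m (conj_exp p) \<xi> * Lp_norm m p f"
proof -
  define q where "q = conj_exp p"
  have q: "q > 1" using conj_exp_gt_1 p by (simp add: q_def)
  have pq: "1/q + 1/p = 1" using conj_exp_sum[OF p] by (simp add: q_def)
  note [measurable] = Lp_measurable[OF xi] Lp_measurable[OF f]
  have Y: "\<bar>a * b\<bar> \<le> \<bar>a\<bar> powr q / q + \<bar>b\<bar> powr p / p" for a b
    using Youngs_inequality[of q p "\<bar>a\<bar>" "\<bar>b\<bar>"] q p pq by (simp add: abs_mult)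
  have I: "integrable m (\<lambda>x. \<bar>a x\<bar> powr q / q + \<bar>b x\<bar> powr p / p)" if "a \<in> Lp m q" "b \<in> Lp m p" for a b
    using Lp_integrable[OF that(1)] Lp_integrable[OF that(2)] by simp
  show int: "integrable m (\<lambda>x. \<xi> x * f x)"
    by (rule Bochner_Integration.integrable_bound[OF I[of \<xi> f]])
      (use xi f Y in \<open>auto simp: q_def[symmetric] intro!: AE_I2 order_trans[OF Y]\<close>)
  define A B where "A = Lp_norm m q \<xi>" and "B = Lp_norm m p f"
  have main: "(\<integral>x. \<bar>\<xi> x * f x\<bar> \<partial>m) \<le> A * B"
  proof -
    have "A \<ge> 0" "B \<ge> 0" by (auto simp: A_def B_def)
    then consider "A = 0" | "B = 0" | "A > 0" "B > 0" by linarith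
    then show ?thesis
    proof cases
      case 1
      then have "AE x in m. \<xi> x = 0" using Lp_norm_eq_0_iff[of \<xi> m q] xi q by (auto simp: q_def A_def)
      then have "(\<integral>x. \<bar>\<xi> x * f x\<bar> \<partial>m) = (\<integral>x. 0 \<partial>m)" by (intro integral_cong_AE) auto
      then show ?thesis using 1 by simp
    next
      case 2
      then have "AE x in m. f x = 0" using Lp_norm_eq_0_iff[of f m p] f p by (auto simp: B_def)
      then have "(\<integral>x. \<bar>\<xi> x * f x\<bar> \<partial>m) = (\<integral>x. 0 \<partial>m)" by (intro integral_cong_AE) auto
      then show ?thesis using 2 by simp
    next
      case 3
      define a b where "a = (\<lambda>x. inverse A * \<xi> x)" and "b = (\<lambda>x. inverse B * f x)"
      have a: "a \<in> Lp m q" and b: "b \<in> Lp m p" unfolding a_def b_def using xi f by (auto intro: Lp_cmult simp: q_def)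
      have "Lp_norm m q a = 1" "Lp_norm m p b = 1"
        unfolding a_def b_def using 3 q p by (auto simp: Lp_norm_cmult A_def[symmetric] B_def[symmetric])
      then have n1: "Lp_pow m q a = 1" "Lp_pow m p b = 1"
        using Lp_norm_powr[of q m a] Lp_norm_powr[of p m b] p q by auto
      have "inverse (A * B) * (\<integral>x. \<bar>\<xi> x * f x\<bar> \<partial>m) = (\<integral>x. \<bar>a x * b x\<bar> \<partial>m)"
        using 3 by (simp add: a_def b_def abs_mult mult_ac)
      also have "\<dots> \<le> (\<integral>x. \<bar>a x\<bar> powr q / q + \<bar>b x\<bar> powr p / p \<partial>m)"
      proof (rule integral_mono)
        have "(\<lambda>x. \<bar>a x * b x\<bar>) = (\<lambda>x. inverse (A * B) * \<bar>\<xi> x * f x\<bar>)"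
          using 3 by (simp add: a_def b_def abs_mult mult_ac)
        then show "integrable m (\<lambda>x. \<bar>a x * b x\<bar>)" using int by simp
      qed (use I a b Y in auto)
      also have "\<dots> = Lp_pow m q a / q + Lp_pow m p b / p"
        using Lp_integrable[OF a] Lp_integrable[OF b] by (simp add: Lp_pow_def)
      also have "\<dots> = 1" using pq n1 by simp
      finally show ?thesis using 3 by (simp add: field_simps)
    qed
  qed
  show "(\<integral>x. \<bar>\<xi> x * f x\<bar> \<partial>m) \<le> Lp_norm m (conj_exp p) \<xi> * Lp_norm m p f"
    using main by (simp add: A_def B_def q_def)
  then show "\<bar>pairing m \<xi> f\<bar> \<le> Lp_norm m (conj_exp p) \<xi> * Lp_norm m p f"
    unfolding pairing_def using integral_abs_bound[of m "\<lambda>x. \<xi> x * f x"] by linarith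
qed

section \<open>The duality map\<close>

text \<open>A one-sided first-order condition, for constrained problems in which only small positive
  parameters are known to give admissible competitors.\<close>

lemma right_minimum_derivative_nonneg:
  fixes g :: "real \<Rightarrow> real"
  assumes "(g has_real_derivative D) (at 0)" "0 < d" "\<And>s. 0 < s \<Longrightarrow> s < d \<Longrightarrow> g 0 \<le> g s"
  shows "0 \<le> D"
proof (rule ccontr)
  assume "\<not> ?thesis"
  then obtain e where e: "e > 0" "\<forall>h>0. h < e \<longrightarrow> g (0 + h) < g 0"
    using has_real_derivative_neg_dec_right[OF assms(1)] by (auto simp: not_le)
  define s where "s = min d e / 2"
  have "0 < s" "s < d" "s < e" using assms(2) e(1) by (auto simp: s_def min_def)
  then show False using e(2) assms(3)[of s] by force
qed

locale finite_Lp = finite_measure m for m :: "'a measure" +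
  fixes p :: real
  assumes p_ge_2: "2 \<le> p"
begin

abbreviation "q \<equiv> conj_exp p"
abbreviation "L \<equiv> Lp m p"
abbreviation "Lq \<equiv> Lp m (conj_exp p)"
abbreviation "nrm \<equiv> Lp_norm m p"
abbreviation "N \<equiv> Lp_pow m p"

lemma p_gt_1: "1 < p" and p_ge_1: "1 \<le> p" and p_pos: "0 < p"
  using p_ge_2 by auto

lemma q_ge_1: "1 \<le> q" and q_pos: "0 < q"
  using conj_exp_gt_1[OF p_gt_1] by auto

lemma inverse_p_q: "1 / p + 1 / q = 1"
  by (rule conj_exp_sum[OF p_gt_1])

lemmas L_add = Lp_add[OF p_ge_1] and L_diff = Lp_diff[OF p_ge_1]
  and Lq_add = Lp_add[OF q_ge_1] and Lq_diff = Lp_diff[OF q_ge_1]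
  and nrm_triangle = Lp_norm_triangle[OF p_ge_1]
  and nrm_triangle_diff = Lp_norm_triangle_diff[OF p_ge_1]
  and nrm_powr = Lp_norm_powr[OF p_pos]
  and nrm_cmult = Lp_norm_cmult[OF p_pos]
  and pairing_integrable = Holder(1)[OF p_gt_1]
  and pairing_bound = Holder(3)[OF p_gt_1]

lemma L_scale_add: "f \<in> L \<Longrightarrow> v \<in> L \<Longrightarrow> (\<lambda>x. f x + s * v x) \<in> L"
  by (intro L_add Lp_cmult)

lemma nrm_le_1_iff: "nrm f \<le> 1 \<longleftrightarrow> N f \<le> 1"
proof
  assume "nrm f \<le> 1"
  then have "nrm f powr p \<le> 1 powr p" using p_pos by (intro powr_mono2) auto
  then show "N f \<le> 1" by (simp add: nrm_powr)
next
  assume "N f \<le> 1"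
  then have "N f powr (1/p) \<le> 1 powr (1/p)" using p_pos by (intro powr_mono2) auto
  then show "nrm f \<le> 1" by (simp add: Lp_norm_eq_pow)
qed

lemma nrm_eq_1_iff: "nrm f = 1 \<longleftrightarrow> N f = 1"
proof
  assume "nrm f = 1" then show "N f = 1" using nrm_powr[of m f] by simp
next
  assume "N f = 1" then show "nrm f = 1" by (simp add: Lp_norm_eq_pow)
qed

lemma pairing_add: "\<xi> \<in> Lq \<Longrightarrow> f \<in> L \<Longrightarrow> g \<in> L \<Longrightarrow>
    pairing m \<xi> (\<lambda>x. f x + g x) = pairing m \<xi> f + pairing m \<xi> g"
  unfolding pairing_def by (simp add: pairing_integrable distrib_left)

lemma pairing_diff: "\<xi> \<in> Lq \<Longrightarrow> f \<in> L \<Longrightarrow> g \<in> L \<Longrightarrow>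
    pairing m \<xi> (\<lambda>x. f x - g x) = pairing m \<xi> f - pairing m \<xi> g"
  unfolding pairing_def by (simp add: pairing_integrable right_diff_distrib)

lemma pairing_cmult: "pairing m \<xi> (\<lambda>x. c * f x) = c * pairing m \<xi> f"
  unfolding pairing_def by (simp add: mult.left_commute)

lemma pairing_scale_add: "\<xi> \<in> Lq \<Longrightarrow> f \<in> L \<Longrightarrow> v \<in> L \<Longrightarrow>
    pairing m \<xi> (\<lambda>x. f x + s * v x) = pairing m \<xi> f + s * pairing m \<xi> v"
  by (simp add: pairing_add Lp_cmult pairing_cmult)

lemma pairing_add_left: "\<xi> \<in> Lq \<Longrightarrow> \<eta> \<in> Lq \<Longrightarrow> f \<in> L \<Longrightarrow>
    pairing m (\<lambda>x. \<xi> x + \<eta> x) f = pairing m \<xi> f + pairing m \<eta> f"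
  unfolding pairing_def by (simp add: pairing_integrable distrib_right)

lemma pairing_diff_left: "\<xi> \<in> Lq \<Longrightarrow> \<eta> \<in> Lq \<Longrightarrow> f \<in> L \<Longrightarrow>
    pairing m (\<lambda>x. \<xi> x - \<eta> x) f = pairing m \<xi> f - pairing m \<eta> f"
  unfolding pairing_def by (simp add: pairing_integrable left_diff_distrib)

lemma pairing_cmult_left: "pairing m (\<lambda>x. c * \<xi> x) f = c * pairing m \<xi> f"
  unfolding pairing_def by (simp add: mult.assoc)

lemma pairing_uminus_left: "pairing m (\<lambda>x. - \<xi> x) f = - pairing m \<xi> f"
  using pairing_cmult_left[of "-1"] by simp

lemma measurable_J: "f \<in> borel_measurable m \<Longrightarrow> J p f \<in> borel_measurable m"
  unfolding J_eq_spow by measurable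

lemma J_powr_q: "\<bar>J p f x\<bar> powr q = \<bar>f x\<bar> powr p"
  by (simp add: J_eq_spow abs_spow powr_powr conj_exp_mult[OF p_gt_1])

lemma J_in_Lq: "f \<in> L \<Longrightarrow> J p f \<in> Lq"
  by (rule LpI) (auto intro: measurable_J simp: J_powr_q Lp_measurable Lp_integrable)

lemma Lp_pow_J: "Lp_pow m q (J p f) = N f"
  by (simp add: Lp_pow_def J_powr_q)

lemma Lp_norm_J: "Lp_norm m q (J p f) = nrm f powr (p - 1)"
proof -
  have "1 / q = (p - 1) / p" using p_gt_1 by (simp add: conj_exp_def)
  then show ?thesis by (simp add: Lp_norm_eq_pow[of m q] Lp_norm_eq_pow[of m p] Lp_pow_J powr_powr)
qed

lemma pairing_J_self: "pairing m (J p f) f = N f"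
  by (simp add: pairing_def Lp_pow_def J_eq_spow spow_mult_self)

lemma N_above_tangent:
  assumes f: "f \<in> L" and g: "g \<in> L"
  shows "N f + p * pairing m (J p f) (\<lambda>x. g x - f x) + 2 powr (1 - p) * N (\<lambda>x. g x - f x) \<le> N g"
proof -
  have d: "(\<lambda>x. g x - f x) \<in> L" using L_diff f g by blast
  note I = Lp_integrable[OF f] Lp_integrable[OF g] Lp_integrable[OF d] pairing_integrable[OF J_in_Lq[OF f] d]
  have "N f + p * pairing m (J p f) (\<lambda>x. g x - f x) + 2 powr (1 - p) * N (\<lambda>x. g x - f x)
     = (\<integral>x. \<bar>f x\<bar> powr p + p * (J p f x * (g x - f x)) + 2 powr (1 - p) * \<bar>g x - f x\<bar> powr p \<partial>m)"
    unfolding Lp_pow_def pairing_def using I by simp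
  also have "\<dots> \<le> (\<integral>x. \<bar>g x\<bar> powr p \<partial>m)"
    using I spow_strongly_above_tangent[OF p_ge_2]
    by (intro integral_mono) (auto simp: J_eq_spow mult.assoc)
  finally show ?thesis by (simp add: Lp_pow_def)
qed

lemma N_above_tangent':
  assumes f: "f \<in> L" and g: "g \<in> L"
  shows "N f + p * pairing m (J p f) (\<lambda>x. g x - f x) \<le> N g"
proof -
  have "0 \<le> 2 powr (1 - p) * N (\<lambda>x. g x - f x)" by simp
  then show ?thesis using N_above_tangent[OF assms] by linarith
qed

lemma N_clarkson:
  assumes f: "f \<in> L" and g: "g \<in> L"
  shows "N (\<lambda>x. (f x + g x) / 2) + N (\<lambda>x. (f x - g x) / 2) \<le> (N f + N g) / 2"
proof -
  have d: "(\<lambda>x. (f x + g x) / 2) \<in> L" "(\<lambda>x. (f x - g x) / 2) \<in> L"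
    using Lp_cmult[OF L_diff[OF f g], of "1/2"] Lp_cmult[OF L_add[OF f g], of "1/2"] by auto
  note I = Lp_integrable[OF f] Lp_integrable[OF g] Lp_integrable[OF d(1)] Lp_integrable[OF d(2)]
  have "N (\<lambda>x. (f x + g x) / 2) + N (\<lambda>x. (f x - g x) / 2)
     = (\<integral>x. \<bar>(f x + g x) / 2\<bar> powr p + \<bar>(f x - g x) / 2\<bar> powr p \<partial>m)"
    unfolding Lp_pow_def using I by simp
  also have "\<dots> \<le> (\<integral>x. (\<bar>f x\<bar> powr p + \<bar>g x\<bar> powr p) / 2 \<partial>m)"
    using I by (intro integral_mono clarkson_pointwise[OF p_ge_2]) auto
  finally show ?thesis using I by (simp add: Lp_pow_def)
qed

text \<open>The sum W = |a| + |b| + |g| dominates both the base of the power in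
  \<open>spow_diff_le\<close> and the factor g. The integrand is thus bounded by
  \<open>J p W\<close> times a - b, and Hoelder for two functions suffices.\<close>

lemma J_pairing_diff_le:
  assumes a: "a \<in> L" and b: "b \<in> L" and g: "g \<in> L"
  shows "\<bar>pairing m (J p a) g - pairing m (J p b) g\<bar>
    \<le> (p - 1) * nrm (\<lambda>x. a x - b x) * (nrm a + nrm b + nrm g) powr (p - 1)"
proof -
  define W where "W = (\<lambda>x. \<bar>a x\<bar> + \<bar>b x\<bar> + \<bar>g x\<bar>)"
  have W: "W \<in> L" unfolding W_def by (intro L_add Lp_abs a b g)
  have nW: "nrm W \<le> nrm a + nrm b + nrm g"
    using nrm_triangle[OF L_add[OF Lp_abs[OF a] Lp_abs[OF b]] Lp_abs[OF g]] nrm_triangle[OF Lp_abs[OF a] Lp_abs[OF b]]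
    by (simp add: Lp_norm_abs W_def)
  have d: "(\<lambda>x. a x - b x) \<in> L" using L_diff a b by blast
  have JW: "J p W \<in> Lq" using J_in_Lq W by blast
  have pt: "\<bar>(J p a x - J p b x) * g x\<bar> \<le> (p - 1) * \<bar>J p W x * (a x - b x)\<bar>" for x
  proof -
    have W0: "W x \<ge> 0" by (simp add: W_def)
    have "\<bar>J p a x - J p b x\<bar> * \<bar>g x\<bar> \<le> ((p - 1) * \<bar>a x - b x\<bar> * (\<bar>a x\<bar> + \<bar>b x\<bar>) powr (p - 2)) * W x"
      using spow_diff_le[OF p_ge_2, of "a x" "b x"] p_ge_2
      by (intro mult_mono) (auto simp: J_eq_spow W_def)
    also have "\<dots> \<le> ((p - 1) * \<bar>a x - b x\<bar> * W x powr (p - 2)) * W x"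
      using p_ge_2 W0 by (intro mult_right_mono mult_left_mono powr_mono2) (auto simp: W_def)
    also have "\<dots> = (p - 1) * \<bar>J p W x * (a x - b x)\<bar>"
      using W0 by (simp add: J_eq_spow spow_def abs_mult)
    finally show ?thesis by (simp add: abs_mult)
  qed
  have "pairing m (J p a) g - pairing m (J p b) g = (\<integral>x. (J p a x - J p b x) * g x \<partial>m)"
    using pairing_diff_left[OF J_in_Lq[OF a] J_in_Lq[OF b] g] by (simp add: pairing_def)
  also have "\<bar>\<dots>\<bar> \<le> (\<integral>x. \<bar>(J p a x - J p b x) * g x\<bar> \<partial>m)" by simp
  also have "\<dots> \<le> (\<integral>x. (p - 1) * \<bar>J p W x * (a x - b x)\<bar> \<partial>m)"
    using pairing_integrable[OF JW d] pairing_integrable[OF Lq_diff[OF J_in_Lq[OF a] J_in_Lq[OF b]] g] pt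
    by (intro integral_mono) auto
  also have "\<dots> = (p - 1) * (\<integral>x. \<bar>J p W x * (a x - b x)\<bar> \<partial>m)" by simp
  also have "\<dots> \<le> (p - 1) * (nrm W powr (p - 1) * nrm (\<lambda>x. a x - b x))"
    using Holder(2)[OF p_gt_1 JW d] p_gt_1 by (intro mult_left_mono) (auto simp: Lp_norm_J)
  also have "\<dots> \<le> (p - 1) * ((nrm a + nrm b + nrm g) powr (p - 1) * nrm (\<lambda>x. a x - b x))"
    using nW p_gt_1 by (intro mult_left_mono mult_right_mono powr_mono2) auto
  finally show ?thesis by (simp add: mult_ac)
qed

lemma J_pairing_tendsto:
  assumes u: "eventually (\<lambda>n. u n \<in> L) F" and f: "f \<in> L" and g: "g \<in> L" and c: "Lp_conv m p u f F"
  shows "((\<lambda>n. pairing m (J p (u n)) g) \<longlongrightarrow> pairing m (J p f) g) F"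
proof -
  have "((\<lambda>n. (p - 1) * nrm (\<lambda>x. u n x - f x) * (nrm (u n) + nrm f + nrm g) powr (p - 1)) \<longlongrightarrow>
        (p - 1) * 0 * (nrm f + nrm f + nrm g) powr (p - 1)) F"
    using Lp_norm_tendsto[OF p_ge_1 u f c] c p_gt_1
    by (intro tendsto_mult tendsto_powr2 tendsto_add tendsto_const) (auto simp: Lp_conv_def)
  then have *: "((\<lambda>n. (p - 1) * nrm (\<lambda>x. u n x - f x) * (nrm (u n) + nrm f + nrm g) powr (p - 1)) \<longlongrightarrow> 0) F"
    by simp
  have "((\<lambda>n. pairing m (J p (u n)) g - pairing m (J p f) g) \<longlongrightarrow> 0) F"
  proof (rule Lim_null_comparison[OF _ *])
    show "\<forall>\<^sub>F n in F. norm (pairing m (J p (u n)) g - pairing m (J p f) g)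
        \<le> (p - 1) * nrm (\<lambda>x. u n x - f x) * (nrm (u n) + nrm f + nrm g) powr (p - 1)"
      using u by eventually_elim (use J_pairing_diff_le f g in simp)
  qed
  then show ?thesis by (simp add: LIM_zero_iff)
qed

lemma N_tendsto:
  assumes u: "eventually (\<lambda>n. u n \<in> L) F" and f: "f \<in> L" and c: "Lp_conv m p u f F"
  shows "((\<lambda>n. N (u n)) \<longlongrightarrow> N f) F"
proof -
  have "((\<lambda>n. nrm (u n) powr p) \<longlongrightarrow> nrm f powr p) F"
    using Lp_norm_tendsto[OF p_ge_1 u f c] p_pos by (intro tendsto_powr2) auto
  then show ?thesis by (simp add: nrm_powr)
qed

text \<open>The tangent inequalities at f and at f + s v enclose the difference quotient between two
  pairings, and continuity of \<open>J\<close> closes the gap; no differentiation under the integral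
  takes place.\<close>

lemma N_has_derivative:
  assumes f: "f \<in> L" and v: "v \<in> L"
  shows "((\<lambda>s. N (\<lambda>x. f x + s * v x)) has_real_derivative p * pairing m (J p f) v) (at 0)"
proof -
  have in': "(\<lambda>x. f x + s * v x) \<in> L" for s using L_scale_add f v by blast
  have conv: "((\<lambda>s. pairing m (J p (\<lambda>x. f x + s * v x)) v) \<longlongrightarrow> pairing m (J p f) v) (at 0)"
  proof (rule J_pairing_tendsto[OF _ f v])
    have "((\<lambda>s. \<bar>s\<bar> * nrm v) \<longlongrightarrow> \<bar>0\<bar> * nrm v) (at 0)" by (intro tendsto_intros)
    then show "Lp_conv m p (\<lambda>s x. f x + s * v x) f (at 0)"
      by (simp add: Lp_conv_def nrm_cmult)
  qed (use in' in simp)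
  define E where "E s = p * \<bar>pairing m (J p (\<lambda>x. f x + s * v x)) v - pairing m (J p f) v\<bar>" for s
  have E0: "(E \<longlongrightarrow> 0) (at 0)"
    unfolding E_def using tendsto_mult_right_zero[OF tendsto_rabs_zero[OF LIM_zero[OF conv]]] by simp
  have bd: "norm ((N (\<lambda>x. f x + s * v x) - N f) / s - p * pairing m (J p f) v) \<le> E s" if "s \<noteq> 0" for s
  proof -
    have "N f + p * (s * pairing m (J p f) v) \<le> N (\<lambda>x. f x + s * v x)"
      using N_above_tangent'[OF f in'[of s]] by (simp add: pairing_cmult)
    moreover have "N (\<lambda>x. f x + s * v x) - p * (s * pairing m (J p (\<lambda>x. f x + s * v x)) v) \<le> N f"
      using N_above_tangent'[OF in'[of s] f] pairing_cmult[of _ "-s" v] by simp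
    ultimately have "\<bar>N (\<lambda>x. f x + s * v x) - N f - s * (p * pairing m (J p f) v)\<bar> \<le> \<bar>s\<bar> * E s"
    proof -
      assume a: "N f + p * (s * pairing m (J p f) v) \<le> N (\<lambda>x. f x + s * v x)"
        "N (\<lambda>x. f x + s * v x) - p * (s * pairing m (J p (\<lambda>x. f x + s * v x)) v) \<le> N f"
      have "\<bar>N (\<lambda>x. f x + s * v x) - N f - s * (p * pairing m (J p f) v)\<bar>
        \<le> p * (s * (pairing m (J p (\<lambda>x. f x + s * v x)) v - pairing m (J p f) v))"
        using a by (simp add: algebra_simps)
      also have "\<dots> \<le> p * \<bar>s * (pairing m (J p (\<lambda>x. f x + s * v x)) v - pairing m (J p f) v)\<bar>"
        using p_pos by (intro mult_left_mono) auto
      finally show ?thesis by (simp add: E_def abs_mult mult_ac)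
    qed
    moreover have "(N (\<lambda>x. f x + s * v x) - N f) / s - p * pairing m (J p f) v
        = (N (\<lambda>x. f x + s * v x) - N f - s * (p * pairing m (J p f) v)) / s"
      using that by (simp add: field_simps)
    ultimately show ?thesis using that by (simp add: field_simps)
  qed
  have "((\<lambda>s. (N (\<lambda>x. f x + s * v x) - N f) / s - p * pairing m (J p f) v) \<longlongrightarrow> 0) (at 0)"
    by (rule Lim_null_comparison[OF _ E0]) (use bd in \<open>auto simp: eventually_at_filter\<close>)
  then have "((\<lambda>s. (N (\<lambda>x. f x + s * v x) - N f) / s) \<longlongrightarrow> p * pairing m (J p f) v) (at 0)"
    by (simp add: LIM_zero_iff)
  then show ?thesis by (simp add: has_field_derivative_iff)
qed

text \<open>
  The Bregman divergence \<open>\<Psi>(g) - \<Psi>(f) - \<langle>J f, g - f\<rangle>\<close>, written with the dual energy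
  \<open>\<Psi>\<^sup>*(J f) = N f / q\<close> because along a mirror flow only \<open>J f\<close> is absolutely continuous.
\<close>

definition Breg :: "('a \<Rightarrow> real) \<Rightarrow> ('a \<Rightarrow> real) \<Rightarrow> real" where
  "Breg g f = N g / p + N f / q - pairing m (J p f) g"

lemma Breg_alt:
  assumes "f \<in> L" "g \<in> L"
  shows "Breg g f = N g / p - N f / p - pairing m (J p f) (\<lambda>x. g x - f x)"
proof -
  have "N f / q = N f - N f / p" using inverse_p_q by (metis (no_types) add_diff_cancel_left' mult.right_neutral right_diff_distrib times_divide_eq_right)
  then show ?thesis
    unfolding Breg_def pairing_diff[OF J_in_Lq[OF assms(1)] assms(2,1)] pairing_J_self by simp
qed

lemma Breg_ge:
  assumes "f \<in> L" "g \<in> L"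
  shows "2 powr (1 - p) / p * N (\<lambda>x. g x - f x) \<le> Breg g f"
  using N_above_tangent[OF assms] p_pos unfolding Breg_alt[OF assms] by (simp add: field_simps)

lemma Breg_nonneg:
  assumes "f \<in> L" "g \<in> L"
  shows "0 \<le> Breg g f"
  using Breg_ge[OF assms] p_pos by (smt (verit) Lp_pow_nonneg divide_nonneg_pos mult_nonneg_nonneg powr_ge_zero)

lemma Breg_self: "f \<in> L \<Longrightarrow> Breg f f = 0"
  by (simp add: Breg_alt pairing_def)

text \<open>The symmetrised divergence equals the pairing of J g - J f with g - f, so Hoelder and
  \<open>Breg_ge\<close> leave one power of the norm to cancel. This is Hoelder continuity of the
  inverse of J, through which regularity of \<open>J p (f t)\<close> passes to
  \<open>f t\<close>.\<close>

lemma Breg_symm_le: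
  assumes f: "f \<in> L" and g: "g \<in> L"
  shows "2 * 2 powr (1 - p) / p * nrm (\<lambda>x. g x - f x) powr (p - 1) \<le> Lp_norm m q (\<lambda>x. J p g x - J p f x)"
proof -
  define d where "d = (\<lambda>x. g x - f x)"
  have d: "d \<in> L" unfolding d_def using L_diff f g by blast
  have Nd: "N (\<lambda>x. f x - g x) = N d" by (simp add: Lp_pow_def d_def abs_minus_commute)
  have "2 * 2 powr (1 - p) / p * N d \<le> Breg g f + Breg f g"
    using Breg_ge[OF f g] Breg_ge[OF g f] unfolding Nd d_def[symmetric] by simp
  also have "\<dots> = pairing m (J p g) d - pairing m (J p f) d"
    unfolding Breg_alt[OF f g] Breg_alt[OF g f] d_def
    using pairing_diff[OF J_in_Lq[OF g] g f] pairing_diff[OF J_in_Lq[OF g] f g] by simp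
  also have "\<dots> \<le> Lp_norm m q (\<lambda>x. J p g x - J p f x) * nrm d"
    using pairing_bound[OF Lq_diff[OF J_in_Lq[OF g] J_in_Lq[OF f]] d]
      pairing_diff_left[OF J_in_Lq[OF g] J_in_Lq[OF f] d] by simp
  finally have *: "2 * 2 powr (1 - p) / p * N d \<le> Lp_norm m q (\<lambda>x. J p g x - J p f x) * nrm d" .
  show ?thesis
  proof (cases "nrm d = 0")
    case True
    then show ?thesis by (simp add: d_def)
  next
    case False
    then have pos: "nrm d > 0" using Lp_norm_nonneg[of m p d] by linarith
    have "N d = nrm d powr (p - 1) * nrm d" using pos powr_mult_base[of "nrm d" "p - 1"] by (simp add: nrm_powr mult.commute)
    then have "(2 * 2 powr (1 - p) / p * nrm d powr (p - 1)) * nrm d \<le> Lp_norm m q (\<lambda>x. J p g x - J p f x) * nrm d"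
      using * by (simp add: mult.assoc)
    then show ?thesis using pos unfolding d_def by (rule mult_right_le_imp_le)
  qed
qed

text \<open>\<open>N f / q\<close> is the conjugate energy evaluated at J f, and f is its gradient
  there. Both bounds are nonnegativity of the divergence, with the arguments in either
  order.\<close>

lemma N_over_q_diff:
  assumes f: "f \<in> L" and g: "g \<in> L"
  shows "pairing m (\<lambda>x. J p g x - J p f x) f \<le> N g / q - N f / q"
    and "N g / q - N f / q \<le> pairing m (\<lambda>x. J p g x - J p f x) g"
proof -
  have e: "N h = N h / p + N h / q" for h
    using inverse_p_q by (metis distrib_left mult.right_neutral times_divide_eq_right)
  have "pairing m (J p g) f - N f \<le> N g / q - N f / q"
    using Breg_nonneg[OF g f] e[of f] unfolding Breg_def by linarith
  then show "pairing m (\<lambda>x. J p g x - J p f x) f \<le> N g / q - N f / q"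
    by (simp add: pairing_diff_left J_in_Lq f g pairing_J_self)
  have "N g / q - N f / q \<le> N g - pairing m (J p f) g"
    using Breg_nonneg[OF f g] e[of g] unfolding Breg_def by linarith
  then show "N g / q - N f / q \<le> pairing m (\<lambda>x. J p g x - J p f x) g"
    by (simp add: pairing_diff_left J_in_Lq f g pairing_J_self)
qed

end

section \<open>Slopes and the Cheeger energy\<close>

abbreviation is_Lipschitz :: "('a::metric_space \<Rightarrow> real) \<Rightarrow> bool" where
  "is_Lipschitz h \<equiv> \<exists>L. L-lipschitz_on UNIV h"

lemma lipschitz_quotient_le:
  fixes h :: "'a::metric_space \<Rightarrow> real"
  assumes "L-lipschitz_on UNIV h"
  shows "\<bar>h y - h x\<bar> / dist y x \<le> L"
  using lipschitz_onD[OF assms, of y x] lipschitz_on_nonneg[OF assms]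
  by (cases "dist y x = 0") (auto simp: dist_real_def field_simps)

text \<open>Removes upper limits and extended reals from what follows. At an isolated point the
  filter \<open>at x\<close> is trivial, so the right-hand side holds vacuously, in agreement with
  slope 0.\<close>

lemma slope_le_iff:
  fixes h :: "'a::metric_space \<Rightarrow> real"
  assumes "is_Lipschitz h" "0 \<le> c"
  shows "slope h x \<le> c \<longleftrightarrow> (\<forall>e>0. \<forall>\<^sub>F y in at x. \<bar>h y - h x\<bar> / dist y x \<le> c + e)"
proof (cases "open {x}")
  case True
  then have "at x = bot" by (simp add: at_eq_bot_iff)
  then show ?thesis using True assms by (simp add: slope_def)
next
  case False
  then have nb: "at x \<noteq> bot" by (simp add: at_eq_bot_iff)
  obtain L where L: "L-lipschitz_on UNIV h" using assms by blast
  define S where "S = Limsup (at x) (\<lambda>y. ereal (\<bar>h y - h x\<bar> / dist y x))"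
  have S1: "S \<le> ereal L" unfolding S_def
    by (intro Limsup_bounded always_eventually) (simp add: lipschitz_quotient_le[OF L])
  have S0: "S \<ge> 0" unfolding S_def
    by (rule order_trans[OF Liminf_bounded Liminf_le_Limsup[OF nb]]) (simp add: always_eventually)
  have s: "slope h x \<le> c \<longleftrightarrow> S \<le> ereal c"
    using False S0 S1 unfolding slope_def S_def[symmetric] by (cases S) auto
  show ?thesis
  proof
    assume "slope h x \<le> c"
    then have "S \<le> ereal c" using s by simp
    then have *: "\<forall>y>ereal c. \<forall>\<^sub>F z in at x. ereal (\<bar>h z - h x\<bar> / dist z x) < y"
      unfolding S_def Limsup_le_iff .
    show "\<forall>e>0. \<forall>\<^sub>F y in at x. \<bar>h y - h x\<bar> / dist y x \<le> c + e"
    proof (intro allI impI)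
      fix e :: real assume "e > 0"
      then have "ereal c < ereal (c + e)" by simp
      with * have "\<forall>\<^sub>F z in at x. ereal (\<bar>h z - h x\<bar> / dist z x) < ereal (c + e)" by blast
      then show "\<forall>\<^sub>F y in at x. \<bar>h y - h x\<bar> / dist y x \<le> c + e" by eventually_elim simp
    qed
  next
    assume *: "\<forall>e>0. \<forall>\<^sub>F y in at x. \<bar>h y - h x\<bar> / dist y x \<le> c + e"
    have "S \<le> ereal (c + e)" if "e > 0" for e
      unfolding S_def using * that by (intro Limsup_bounded) simp
    moreover obtain s where "S = ereal s" using S0 S1 by (cases S) auto
    ultimately have "S \<le> ereal c" by (auto intro: field_le_epsilon)
    then show "slope h x \<le> c" using s by simp
  qed
qed

lemma slope_nonneg:
  assumes "is_Lipschitz h"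
  shows "0 \<le> slope h x"
proof (cases "open {x}")
  case True then show ?thesis by (simp add: slope_def)
next
  case False
  then have nb: "at x \<noteq> bot" by (simp add: at_eq_bot_iff)
  have "0 \<le> Limsup (at x) (\<lambda>y. ereal (\<bar>h y - h x\<bar> / dist y x))"
    by (rule order_trans[OF Liminf_bounded Liminf_le_Limsup[OF nb]]) (simp add: always_eventually)
  then show ?thesis using False by (simp add: slope_def real_of_ereal_pos)
qed

lemma slope_le_Lipschitz:
  assumes "L-lipschitz_on UNIV h"
  shows "slope h x \<le> L"
proof -
  have "\<forall>e>0. \<forall>\<^sub>F y in at x. \<bar>h y - h x\<bar> / dist y x \<le> L + e"
    using lipschitz_quotient_le[OF assms]
    by (intro allI impI always_eventually) (meson add_increasing2 less_imp_le)
  then show ?thesis using assms lipschitz_on_nonneg[OF assms] by (subst slope_le_iff) auto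
qed

lemma is_Lipschitz_lincomb:
  fixes h k :: "'a::metric_space \<Rightarrow> real"
  assumes "is_Lipschitz h" "is_Lipschitz k"
  shows "is_Lipschitz (\<lambda>x. a * h x + b * k x)"
proof -
  obtain L M where L: "L-lipschitz_on UNIV h" and M: "M-lipschitz_on UNIV k" using assms by blast
  have "(\<bar>a\<bar> * L + \<bar>b\<bar> * M)-lipschitz_on UNIV (\<lambda>x. a * h x + b * k x)"
    using lipschitz_on_add[OF lipschitz_on_cmult_real[OF L, of a] lipschitz_on_cmult_real[OF M, of b]] .
  then show ?thesis by blast
qed

lemma slope_lincomb_le:
  fixes h k :: "'a::metric_space \<Rightarrow> real"
  assumes h: "is_Lipschitz h" and k: "is_Lipschitz k"
  shows "slope (\<lambda>x. a * h x + b * k x) x \<le> \<bar>a\<bar> * slope h x + \<bar>b\<bar> * slope k x"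
proof (subst slope_le_iff)
  show "0 \<le> \<bar>a\<bar> * slope h x + \<bar>b\<bar> * slope k x"
    by (intro add_nonneg_nonneg mult_nonneg_nonneg slope_nonneg h k) auto
  show "\<forall>e>0. \<forall>\<^sub>F y in at x. \<bar>a * h y + b * k y - (a * h x + b * k x)\<bar> / dist y x
      \<le> \<bar>a\<bar> * slope h x + \<bar>b\<bar> * slope k x + e"
  proof (intro allI impI)
    fix e :: real assume e: "e > 0"
    define d where "d = e / (\<bar>a\<bar> + \<bar>b\<bar> + 1)"
    have d: "d > 0" "\<bar>a\<bar> * d + \<bar>b\<bar> * d \<le> e"
      using e by (auto simp: d_def field_simps add_pos_nonneg)
    have "\<forall>\<^sub>F y in at x. \<bar>h y - h x\<bar> / dist y x \<le> slope h x + d"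
      using slope_le_iff[OF h slope_nonneg[OF h], of x x] d by simp
    moreover have "\<forall>\<^sub>F y in at x. \<bar>k y - k x\<bar> / dist y x \<le> slope k x + d"
      using slope_le_iff[OF k slope_nonneg[OF k], of x x] d by simp
    ultimately show "\<forall>\<^sub>F y in at x. \<bar>a * h y + b * k y - (a * h x + b * k x)\<bar> / dist y x
        \<le> \<bar>a\<bar> * slope h x + \<bar>b\<bar> * slope k x + e"
    proof eventually_elim
      case (elim y)
      have "\<bar>a * h y + b * k y - (a * h x + b * k x)\<bar> = \<bar>a * (h y - h x) + b * (k y - k x)\<bar>"
        by (simp add: algebra_simps)
      also have "\<dots> \<le> \<bar>a\<bar> * \<bar>h y - h x\<bar> + \<bar>b\<bar> * \<bar>k y - k x\<bar>"
        by (metis abs_mult abs_triangle_ineq)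
      finally have "\<bar>a * h y + b * k y - (a * h x + b * k x)\<bar> / dist y x
          \<le> (\<bar>a\<bar> * \<bar>h y - h x\<bar> + \<bar>b\<bar> * \<bar>k y - k x\<bar>) / dist y x" by (intro divide_right_mono) auto
      also have "\<dots> = \<bar>a\<bar> * (\<bar>h y - h x\<bar> / dist y x) + \<bar>b\<bar> * (\<bar>k y - k x\<bar> / dist y x)"
        by (simp add: add_divide_distrib)
      also have "\<dots> \<le> \<bar>a\<bar> * (slope h x + d) + \<bar>b\<bar> * (slope k x + d)"
        using elim by (intro add_mono mult_left_mono) auto
      also have "\<dots> \<le> \<bar>a\<bar> * slope h x + \<bar>b\<bar> * slope k x + e" using d by (simp add: algebra_simps)
      finally show ?case .
    qed
  qed
qed (rule is_Lipschitz_lincomb[OF h k])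

lemma is_Lipschitz_const: "is_Lipschitz (\<lambda>x. c :: real)"
  using lipschitz_on_constant by blast

lemma slope_const: "slope (\<lambda>x. c) x = 0"
  using slope_le_Lipschitz[OF lipschitz_on_constant] slope_nonneg[OF is_Lipschitz_const]
  by (metis order_antisym)

text \<open>For a fixed radius the bound on difference quotients defines a closed set of x: its
  complement is a union, over arbitrary y, of open sets, by continuity of h. Countably many radii
  and tolerances then describe a sublevel set of the slope, so separability of the space does not
  enter.\<close>

lemma borel_measurable_slope:
  fixes h :: "'a::metric_space \<Rightarrow> real"
  assumes h: "is_Lipschitz h"
  shows "slope h \<in> borel_measurable borel"
proof -
  have ch [continuous_intros]: "continuous_on UNIV h" using h lipschitz_on_continuous_on by blast
  define A where "A r c = {x. \<forall>y. 0 < dist y x \<and> dist y x < r \<longrightarrow> \<bar>h y - h x\<bar> / dist y x \<le> c}" for r c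
  have A: "closed (A r c)" for r c
  proof -
    have "open ({x. 0 < dist y x} \<inter> {x. dist y x < r} \<inter> {x. c * dist y x < \<bar>h y - h x\<bar>})" for y
      by (intro open_Int open_Collect_less continuous_intros)
    then have "open (\<Union>y. {x. 0 < dist y x} \<inter> {x. dist y x < r} \<inter> {x. c * dist y x < \<bar>h y - h x\<bar>})" by blast
    moreover have "(\<Union>y. {x. 0 < dist y x} \<inter> {x. dist y x < r} \<inter> {x. c * dist y x < \<bar>h y - h x\<bar>}) = - A r c"
    proof -
      have "c * dist y x < \<bar>h y - h x\<bar> \<longleftrightarrow> \<not> \<bar>h y - h x\<bar> / dist y x \<le> c" if "0 < dist y x" for x y
        using that by (simp add: not_le pos_less_divide_eq)
      then show ?thesis unfolding A_def by blast
    qed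
    ultimately show ?thesis by (simp add: closed_def)
  qed
  have eq: "{x. slope h x \<le> c} = (\<Inter>n. \<Union>k. A (1 / Suc k) (c + 1 / Suc n))" if c: "c \<ge> 0" for c
  proof (intro equalityI subsetI)
    fix x assume "x \<in> {x. slope h x \<le> c}"
    then have *: "\<forall>\<^sub>F y in at x. \<bar>h y - h x\<bar> / dist y x \<le> c + e" if "e > 0" for e
      using slope_le_iff[OF h c] that by simp
    have "x \<in> (\<Union>k. A (1 / Suc k) (c + 1 / Suc n))" for n
    proof -
      obtain d where d: "d > 0" "\<And>y. y \<noteq> x \<and> dist y x < d \<Longrightarrow> \<bar>h y - h x\<bar> / dist y x \<le> c + 1 / Suc n"
        using *[of "1 / Suc n"] by (auto simp: eventually_at)
      obtain k where k: "1 / Suc k < d" using d(1) nat_approx_posE by blast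
      have "x \<in> A (1 / Suc k) (c + 1 / Suc n)" unfolding A_def using d(2) k by (auto intro!: d(2))
      then show ?thesis by blast
    qed
    then show "x \<in> (\<Inter>n. \<Union>k. A (1 / Suc k) (c + 1 / Suc n))" by blast
  next
    fix x assume x: "x \<in> (\<Inter>n. \<Union>k. A (1 / Suc k) (c + 1 / Suc n))"
    have "\<forall>\<^sub>F y in at x. \<bar>h y - h x\<bar> / dist y x \<le> c + e" if e: "e > 0" for e
    proof -
      obtain n where n: "1 / Suc n < e" using e nat_approx_posE by blast
      obtain k where k: "x \<in> A (1 / Suc k) (c + 1 / Suc n)" using x by blast
      have "\<bar>h y - h x\<bar> / dist y x \<le> c + e" if "y \<noteq> x" "dist y x < 1 / Suc k" for y
        using k that n by (force simp: A_def)
      then show ?thesis unfolding eventually_at by (intro exI[of _ "1 / Suc k"]) auto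
    qed
    then show "x \<in> {x. slope h x \<le> c}" using slope_le_iff[OF h c] by simp
  qed
  have "{x. slope h x \<le> c} \<in> sets borel" for c
  proof (cases "c \<ge> 0")
    case True
    have [measurable]: "A r c \<in> sets borel" for r c using A by (rule borel_closed)
    show ?thesis unfolding eq[OF True] by measurable
  next
    case False
    then have "{x. slope h x \<le> c} = {}" using slope_nonneg[OF h] by (auto simp: not_le intro: order_less_le_trans)
    then show ?thesis by simp
  qed
  then show ?thesis by (simp add: borel_measurable_iff_le)
qed

section \<open>The Cheeger energy as a relaxation of the slope energy\<close>

locale cheeger = finite_Lp m p for m :: "('a::metric_space) measure" and p +
  assumes sets_m: "sets m = sets borel"
begin

text \<open>The slope is bounded by the Lipschitz constant, and constants are in L^p because the
  measure is finite.\<close>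

lemma slope_in_L:
  assumes "is_Lipschitz h"
  shows "slope h \<in> L"
proof -
  obtain L where L: "L-lipschitz_on UNIV h" using assms by blast
  show ?thesis
  proof (rule Lp_dominated[OF Lp_const[of L]])
    show "slope h \<in> borel_measurable m"
      using borel_measurable_slope[OF assms] measurable_cong_sets[OF sets_m refl] by blast
    show "AE x in m. \<bar>slope h x\<bar> \<le> \<bar>L\<bar>"
      using slope_le_Lipschitz[OF L] slope_nonneg[OF assms] lipschitz_on_nonneg[OF L] by (intro AE_I2) auto
  qed (use p_pos in simp)
qed

text \<open>Says that the lower semicontinuous relaxation of the Lipschitz slope energy is at most C
  at f. One tolerance serves both for the distance and for the energy.\<close>

definition approx :: "('a \<Rightarrow> real) \<Rightarrow> real \<Rightarrow> bool" where
  "approx f C \<longleftrightarrow> (\<forall>e>0. \<exists>h. is_Lipschitz h \<and> h \<in> L \<and> nrm (\<lambda>x. h x - f x) \<le> e \<and> N (slope h) \<le> C + e)"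

lemma approx_nonneg: "approx f C \<Longrightarrow> 0 \<le> C"
  unfolding approx_def
  by (rule field_le_epsilon) (meson Lp_pow_nonneg order_trans)

lemma approx_mono: "approx f C \<Longrightarrow> C \<le> D \<Longrightarrow> approx f D"
  unfolding approx_def by (meson add_right_mono order_trans)

lemma approx_closed:
  assumes "\<And>D. D > C \<Longrightarrow> approx f D"
  shows "approx f C"
  unfolding approx_def
proof (intro allI impI)
  fix e :: real assume e: "e > 0"
  then have "approx f (C + e / 2)" using assms by simp
  then obtain h where h: "is_Lipschitz h" "h \<in> L" "nrm (\<lambda>x. h x - f x) \<le> e / 2" "N (slope h) \<le> C + e / 2 + e / 2"
    unfolding approx_def using e half_gt_zero by blast
  then show "\<exists>h. is_Lipschitz h \<and> h \<in> L \<and> nrm (\<lambda>x. h x - f x) \<le> e \<and> N (slope h) \<le> C + e"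
    using e by (intro exI[of _ h]) auto
qed

text \<open>Uniform convexity in the form needed: if the energies of midpoints cannot fall much
  below the level that the sequence approaches, Clarkson's inequality leaves no room for the
  differences.\<close>

lemma midpoint_minimizing_convergent:
  assumes u: "\<And>n. u n \<in> L"
    and min: "\<And>d. d > 0 \<Longrightarrow> \<exists>K. \<forall>i\<ge>K. \<forall>j\<ge>K. N (u i) \<le> I + d \<and> I - d \<le> N (\<lambda>x. (u i x + u j x) / 2)"
  shows "\<exists>g\<in>L. Lp_conv m p u g sequentially \<and> N g = I"
proof -
  have "\<exists>g\<in>L. Lp_conv m p u g sequentially"
  proof (rule Lp_complete[OF p_ge_1 u])
    fix e :: real assume e: "e > 0"
    \<comment> \<open>Clarkson leaves 2 d for the p-th power of the norm of half the
      difference.\<close>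
    define d where "d = (e / 2) powr p / 2"
    have d: "d > 0" using e by (simp add: d_def)
    obtain K where K: "\<forall>i\<ge>K. \<forall>j\<ge>K. N (u i) \<le> I + d \<and> I - d \<le> N (\<lambda>x. (u i x + u j x) / 2)"
      using min[OF d] by blast
    have "nrm (\<lambda>x. u i x - u j x) \<le> e" if "i \<ge> K" "j \<ge> K" for i j
    proof -
      have "N (\<lambda>x. (u i x + u j x) / 2) + N (\<lambda>x. (u i x - u j x) / 2) \<le> (N (u i) + N (u j)) / 2"
        by (rule N_clarkson[OF u u])
      moreover have "N (u i) \<le> I + d" "N (u j) \<le> I + d" "I - d \<le> N (\<lambda>x. (u i x + u j x) / 2)"
        using K that by blast+
      moreover have "A \<le> 2 * d" if "B + A \<le> (a + b) / 2" "a \<le> I + d" "b \<le> I + d" "I - d \<le> B" for A B a b :: real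
        using that by simp
      ultimately have "N (\<lambda>x. (u i x - u j x) / 2) \<le> 2 * d" by blast
      also have "\<dots> = (e / 2) powr p" by (simp add: d_def)
      finally have "N (\<lambda>x. (u i x - u j x) / 2) powr (1/p) \<le> ((e / 2) powr p) powr (1/p)"
        using p_pos by (intro powr_mono2) auto
      then have "nrm (\<lambda>x. (1/2) * (u i x - u j x)) \<le> e / 2"
        using p_pos e by (simp add: powr_powr Lp_norm_eq_pow)
      then show ?thesis unfolding nrm_cmult by simp
    qed
    then show "\<exists>N. \<forall>i\<ge>N. \<forall>j\<ge>N. nrm (\<lambda>x. u i x - u j x) \<le> e" by blast
  qed
  then obtain g where g: "g \<in> L" "Lp_conv m p u g sequentially" by blast
  have lim: "(\<lambda>n. N (u n)) \<longlonglongrightarrow> N g" using N_tendsto[OF _ g] u by simp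
  have "N g \<le> I + d" if "d > 0" for d
    using min[OF that] by (intro LIMSEQ_le_const2[OF lim]) blast
  then have 1: "N g \<le> I" by (rule field_le_epsilon)
  have "I - d \<le> N g" if d: "d > 0" for d
  proof (rule LIMSEQ_le_const[OF lim])
    obtain K where K: "\<forall>i\<ge>K. \<forall>j\<ge>K. N (u i) \<le> I + d \<and> I - d \<le> N (\<lambda>x. (u i x + u j x) / 2)"
      using min[OF d] by blast
    \<comment> \<open>For j = i the midpoint is \<open>u i\<close> itself, so its lower bound holds
      for the sequence as well.\<close>
    then have "\<forall>i\<ge>K. I - d \<le> N (u i)" by fastforce
    then show "\<exists>K. \<forall>n\<ge>K. I - d \<le> N (u n)" by blast
  qed
  then have "I \<le> N g + d" if "d > 0" for d using that by (simp add: diff_le_eq)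
  then have "I \<le> N g" by (rule field_le_epsilon)
  with 1 g show ?thesis by (intro bexI[of _ g]) auto
qed

text \<open>
  A version of Mazur's lemma: instead of convex combinations of the slopes one uses the element
  of least norm in the closure of a convex set that contains all of them, and the variational
  inequality it satisfies.
\<close>

lemma relaxed_slope_approx:
  assumes "relaxed_slope m p f G"
  shows "approx f (N G)"
  unfolding approx_def
proof (intro allI impI)
  fix e :: real assume e: "e > 0"
  have f: "f \<in> L" and G: "G \<in> L" using assms by (auto simp: relaxed_slope_def)
  obtain G' h where G': "G' \<in> L" and "\<forall>n. h n \<in> L \<and> is_Lipschitz (h n)"
    and conv: "Lp_conv m p h f sequentially" and weak: "Lp_weak_conv m p (\<lambda>n. slope (h n)) G'"
    and le: "AE x in m. G' x \<le> G x"
    using assms unfolding relaxed_slope_def by (elim conjE bexE exE)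
  then have h: "h n \<in> L" "is_Lipschitz (h n)" for n by auto
  define U where "U = {u \<in> L. \<exists>k. is_Lipschitz k \<and> k \<in> L \<and> nrm (\<lambda>x. k x - f x) \<le> e \<and> (\<forall>x. slope k x \<le> u x)}"
  have U_L: "u \<in> L" if "u \<in> U" for u using that by (simp add: U_def)
  have U_pos: "0 \<le> u x" if u: "u \<in> U" for u x
  proof -
    obtain k where k: "is_Lipschitz k" "slope k x \<le> u x" using u by (auto simp: U_def)
    then show ?thesis using slope_nonneg[OF k(1), of x] by linarith
  qed
  have U_convex: "(\<lambda>x. (1 - s) * u x + s * w x) \<in> U" if uw: "u \<in> U" "w \<in> U" and s: "0 \<le> s" "s \<le> 1" for u w s
  proof -
    obtain k l where k: "is_Lipschitz k" "k \<in> L" "nrm (\<lambda>x. k x - f x) \<le> e" "\<And>x. slope k x \<le> u x"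
      and l: "is_Lipschitz l" "l \<in> L" "nrm (\<lambda>x. l x - f x) \<le> e" "\<And>x. slope l x \<le> w x"
      using uw by (auto simp: U_def)
    define z where "z = (\<lambda>x. (1 - s) * k x + s * l x)"
    have "is_Lipschitz z" unfolding z_def by (rule is_Lipschitz_lincomb[OF k(1) l(1)])
    moreover have "z \<in> L" unfolding z_def by (intro L_add Lp_cmult k l)
    moreover have "nrm (\<lambda>x. z x - f x) \<le> e"
    proof -
      have "nrm (\<lambda>x. z x - f x) = nrm (\<lambda>x. (1 - s) * (k x - f x) + s * (l x - f x))"
        by (rule arg_cong[of _ _ nrm]) (auto simp: z_def algebra_simps)
      also have "\<dots> \<le> nrm (\<lambda>x. (1 - s) * (k x - f x)) + nrm (\<lambda>x. s * (l x - f x))"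
        by (intro nrm_triangle Lp_cmult L_diff k l f)
      also have "\<dots> \<le> (1 - s) * e + s * e"
        unfolding nrm_cmult using that k l by (intro add_mono mult_mono) auto
      finally show ?thesis by (simp add: algebra_simps)
    qed
    moreover have "slope z x \<le> (1 - s) * u x + s * w x" for x
    proof -
      have "slope z x \<le> \<bar>1 - s\<bar> * slope k x + \<bar>s\<bar> * slope l x"
        unfolding z_def by (rule slope_lincomb_le[OF k(1) l(1)])
      also have "\<dots> \<le> (1 - s) * u x + s * w x" using that k l by (intro add_mono mult_mono) (auto intro: slope_nonneg)
      finally show ?thesis .
    qed
    moreover have "(\<lambda>x. (1 - s) * u x + s * w x) \<in> L" by (intro L_add Lp_cmult U_L that)
    ultimately show ?thesis unfolding U_def by blast
  qed
  have "\<forall>\<^sub>F n in sequentially. nrm (\<lambda>x. h n x - f x) < e"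
    using conv e unfolding Lp_conv_def by (rule order_tendstoD)
  then have ev: "\<forall>\<^sub>F n in sequentially. slope (h n) \<in> U"
  proof eventually_elim
    case (elim n)
    have "slope (h n) \<in> L" by (rule slope_in_L[OF h(2)])
    then show ?case
      unfolding U_def using h[of n] elim by (intro CollectI conjI exI[of _ "h n"]) simp_all
  qed
  then have ne: "U \<noteq> {}" using eventually_happens trivial_limit_sequentially by fastforce
  define I where "I = Inf (N ` U)"
  have bdd: "bdd_below (N ` U)" by (rule bdd_belowI2[of _ 0]) simp
  have I_le: "I \<le> N u" if "u \<in> U" for u unfolding I_def using bdd that by (intro cInf_lower) auto
  have ex: "\<exists>u\<in>U. N u \<le> I + d" if "d > 0" for d
  proof -
    have "Inf (N ` U) < I + d" using that by (simp add: I_def)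
    then show ?thesis using cInf_lessD[of "N ` U" "I + d"] ne by force
  qed
  then have "\<forall>n. \<exists>u. u \<in> U \<and> N u \<le> I + 1 / Suc n" by (meson divide_pos_pos of_nat_0_less_iff zero_less_Suc zero_less_one)
  then obtain u where u: "\<And>n. u n \<in> U" "\<And>n. N (u n) \<le> I + 1 / Suc n" by metis
  have "\<exists>g0\<in>L. Lp_conv m p u g0 sequentially \<and> N g0 = I"
  proof (rule midpoint_minimizing_convergent)
    fix d :: real assume "d > 0"
    then obtain K where K: "1 / Suc K < d" using nat_approx_posE by blast
    have "N (u i) \<le> I + d" if "i \<ge> K" for i
    proof -
      have "1 / Suc i \<le> 1 / Suc K" using that by (simp add: frac_le)
      then show ?thesis using u(2)[of i] K by linarith
    qed
    moreover have "I - d \<le> N (\<lambda>x. (u i x + u j x) / 2)" for i j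
      using I_le[OF U_convex[OF u(1)[of i] u(1)[of j], of "1/2"]] \<open>d > 0\<close> by (simp add: add_divide_distrib)
    ultimately show "\<exists>K. \<forall>i\<ge>K. \<forall>j\<ge>K. N (u i) \<le> I + d \<and> I - d \<le> N (\<lambda>x. (u i x + u j x) / 2)" by blast
  qed (use u U_L in blast)
  then obtain g0 where g0: "g0 \<in> L" "Lp_conv m p u g0 sequentially" "N g0 = I" by blast
  \<comment> \<open>A limit of nonnegative functions is nonnegative only almost everywhere. The
    absolute value is nonnegative everywhere and is still the limit, since all \<open>u n\<close>
    are nonnegative; this makes \<open>J p g\<close> nonnegative.\<close>
  define g where "g = (\<lambda>x. \<bar>g0 x\<bar>)"
  have g: "g \<in> L" "N g = I" using g0 Lp_abs by (auto simp: g_def Lp_pow_def)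
  have gconv: "Lp_conv m p u g sequentially"
    unfolding Lp_conv_def
  proof (rule Lim_null_comparison[OF always_eventually])
    show "\<forall>n. norm (nrm (\<lambda>x. u n x - g x)) \<le> nrm (\<lambda>x. u n x - g0 x)"
    proof
      fix n
      have "nrm (\<lambda>x. u n x - g x) \<le> nrm (\<lambda>x. u n x - g0 x)"
      proof (rule Lp_norm_mono)
        show "(\<lambda>x. u n x - g0 x) \<in> L" by (intro L_diff g0 U_L u)
        show "(\<lambda>x. u n x - g x) \<in> borel_measurable m" by (rule Lp_measurable[OF L_diff[OF U_L[OF u(1)] g(1)]])
        have "\<bar>u n x - g x\<bar> \<le> \<bar>u n x - g0 x\<bar>" for x using U_pos[OF u(1)[of n], of x] by (auto simp: g_def abs_if)
        then show "AE x in m. \<bar>u n x - g x\<bar> \<le> \<bar>u n x - g0 x\<bar>" by simp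
      qed (use p_pos in simp)
      then show "norm (nrm (\<lambda>x. u n x - g x)) \<le> nrm (\<lambda>x. u n x - g0 x)" by simp
    qed
  qed (use g0 in \<open>simp add: Lp_conv_def\<close>)
  have var: "N g \<le> pairing m (J p g) w" if w: "w \<in> U" for w
  proof -
    define v where "v = (\<lambda>x. w x - g x)"
    have v: "v \<in> L" unfolding v_def by (intro L_diff U_L w g)
    \<comment> \<open>\<open>g\<close> need not lie in \<open>U\<close>; the segment from
      \<open>g\<close> to \<open>w\<close> is the limit of segments from \<open>u n\<close> to
      \<open>w\<close>, on which I is a lower bound.\<close>
    have min: "N g \<le> N (\<lambda>x. g x + s * v x)" if s: "0 \<le> s" "s \<le> 1" for s
    proof -
      have "(\<lambda>n. N (\<lambda>x. (1 - s) * u n x + s * w x)) \<longlonglongrightarrow> N (\<lambda>x. (1 - s) * g x + s * w x)"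
      proof (rule N_tendsto)
        have "(\<lambda>n. \<bar>1 - s\<bar> * nrm (\<lambda>x. u n x - g x)) \<longlonglongrightarrow> \<bar>1 - s\<bar> * 0"
          using gconv unfolding Lp_conv_def by (intro tendsto_intros)
        moreover have "nrm (\<lambda>x. (1 - s) * u n x + s * w x - ((1 - s) * g x + s * w x)) = \<bar>1 - s\<bar> * nrm (\<lambda>x. u n x - g x)" for n
          unfolding nrm_cmult[symmetric] by (simp add: algebra_simps)
        ultimately show "Lp_conv m p (\<lambda>n x. (1 - s) * u n x + s * w x) (\<lambda>x. (1 - s) * g x + s * w x) sequentially"
          by (simp add: Lp_conv_def)
      next
        show "(\<lambda>x. (1 - s) * g x + s * w x) \<in> L" by (intro L_add Lp_cmult g U_L[OF w])
        show "\<forall>\<^sub>F n in sequentially. (\<lambda>x. (1 - s) * u n x + s * w x) \<in> L"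
          by (intro always_eventually allI L_add Lp_cmult U_L[OF u(1)] U_L[OF w])
      qed
      moreover have "I \<le> N (\<lambda>x. (1 - s) * u n x + s * w x)" for n
        by (intro I_le U_convex u w s)
      ultimately have "I \<le> N (\<lambda>x. (1 - s) * g x + s * w x)" by (intro LIMSEQ_le_const) auto
      moreover have "(\<lambda>x. (1 - s) * g x + s * w x) = (\<lambda>x. g x + s * v x)" by (auto simp: v_def algebra_simps)
      ultimately show ?thesis using g by simp
    qed
    have "0 \<le> p * pairing m (J p g) v"
      by (rule right_minimum_derivative_nonneg[OF N_has_derivative[OF g(1) v], of 1]) (use min in auto)
    then have "0 \<le> pairing m (J p g) v" using p_pos by (simp add: zero_le_mult_iff)
    then show ?thesis unfolding v_def using pairing_diff[OF J_in_Lq[OF g(1)] U_L[OF w] g(1)] by (simp add: pairing_J_self)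
  qed
  \<comment> \<open>\<open>J p g\<close> is a test function for the weak convergence, so
    \<open>var\<close> survives for \<open>G'\<close>. As \<open>J p g\<close> is nonnegative,
    \<open>G'\<close> may be replaced by the larger \<open>G\<close>, and the tangent inequality for
    N at \<open>g\<close> yields I <= N G.\<close>
  have "(\<lambda>n. pairing m (J p g) (slope (h n))) \<longlonglongrightarrow> pairing m (J p g) G'"
    using weak J_in_Lq[OF g(1)] unfolding Lp_weak_conv_def by blast
  moreover have "\<forall>\<^sub>F n in sequentially. N g \<le> pairing m (J p g) (slope (h n))"
    using ev by eventually_elim (rule var)
  ultimately have "N g \<le> pairing m (J p g) G'" by (rule tendsto_lowerbound) simp
  also have "\<dots> \<le> pairing m (J p g) G"
    unfolding pairing_def
  proof (rule integral_mono_AE)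
    show "AE x in m. J p g x * G' x \<le> J p g x * G x"
      using le by eventually_elim (auto simp: J_def g_def intro!: mult_left_mono)
  qed (intro pairing_integrable J_in_Lq g G G')+
  finally have "0 \<le> p * pairing m (J p g) (\<lambda>x. G x - g x)"
    using p_pos by (simp add: pairing_diff[OF J_in_Lq[OF g(1)] G g(1)] pairing_J_self)
  then have "I \<le> N G" using N_above_tangent'[OF g(1) G] g by simp
  moreover obtain w where w: "w \<in> U" "N w \<le> I + e" using ex[OF e] by blast
  moreover obtain k where k: "is_Lipschitz k" "k \<in> L" "nrm (\<lambda>x. k x - f x) \<le> e" "\<And>x. slope k x \<le> w x"
    using w by (auto simp: U_def)
  moreover have "N (slope k) \<le> N w"
  proof (rule Lp_pow_mono[OF U_L[OF w(1)] Lp_measurable[OF slope_in_L[OF k(1)]]])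
    have "\<bar>slope k x\<bar> \<le> \<bar>w x\<bar>" for x using k(4)[of x] slope_nonneg[OF k(1), of x] by linarith
    then show "AE x in m. \<bar>slope k x\<bar> \<le> \<bar>w x\<bar>" by simp
  qed (use p_pos in simp)
  ultimately show "\<exists>h. is_Lipschitz h \<and> h \<in> L \<and> nrm (\<lambda>x. h x - f x) \<le> e \<and> N (slope h) \<le> N G + e"
    by (intro exI[of _ k]) auto
qed

text \<open>At the least admissible level c, midpoints of near-optimal Lipschitz functions are again
  competitors, so their slopes converge strongly. The limit is a relaxed slope, and by
  \<open>relaxed_slope_approx\<close> no relaxed slope has energy below c.\<close>

lemma approx_imp_minimal_slope:
  assumes f: "f \<in> L" and "approx f C"
  shows "\<exists>G. is_minimal_relaxed_slope m p f G \<and> N G \<le> C"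
proof -
  define S where "S = Collect (approx f)"
  have ne: "S \<noteq> {}" using assms by (auto simp: S_def)
  have bdd: "bdd_below S" by (rule bdd_belowI[of _ 0]) (simp add: S_def approx_nonneg)
  define c where "c = Inf S"
  have c_le: "c \<le> D" if "approx f D" for D unfolding c_def using bdd that by (intro cInf_lower) (auto simp: S_def)
  have "approx f D" if D: "D > c" for D
  proof -
    obtain D' where "D' \<in> S" "D' < D" using cInf_lessD[OF ne, of D] D unfolding c_def by blast
    then show ?thesis using approx_mono by (auto simp: S_def)
  qed
  then have ac: "approx f c" by (rule approx_closed)
  then have "\<forall>n. \<exists>h. is_Lipschitz h \<and> h \<in> L \<and> nrm (\<lambda>x. h x - f x) \<le> 1 / Suc n \<and> N (slope h) \<le> c + 1 / Suc n"
    unfolding approx_def by simp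
  then obtain h where h: "\<And>n. is_Lipschitz (h n)" "\<And>n. h n \<in> L" "\<And>n. nrm (\<lambda>x. h n x - f x) \<le> 1 / Suc n"
    "\<And>n. N (slope (h n)) \<le> c + 1 / Suc n" by metis
  have small: "1 / Suc i < d" if "1 / Suc K < d" "i \<ge> K" for i K d
  proof -
    have "1 / Suc i \<le> 1 / Suc K" using that by (simp add: frac_le)
    then show ?thesis using that by linarith
  qed
  have "\<exists>G\<in>L. Lp_conv m p (\<lambda>n. slope (h n)) G sequentially \<and> N G = c"
  proof (rule midpoint_minimizing_convergent)
    fix d :: real assume d: "d > 0"
    \<comment> \<open>Optimality of c supplies a tolerance e such that every Lipschitz function
      e-close to f has slope energy above c - d; midpoints of late \<open>h i\<close> are such
      functions.\<close>
    have "\<not> approx f (c - d)" using c_le[of "c - d"] d by auto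
    then obtain e where e: "e > 0"
      and ne: "\<not> (\<exists>h. is_Lipschitz h \<and> h \<in> L \<and> nrm (\<lambda>x. h x - f x) \<le> e \<and> N (slope h) \<le> c - d + e)"
      unfolding approx_def by blast
    have e2: "c - d + e < N (slope k)" if "is_Lipschitz k" "k \<in> L" "nrm (\<lambda>x. k x - f x) \<le> e" for k
      using ne that by (meson not_le)
    obtain K where K: "1 / Suc K < min d e" using d e nat_approx_posE[of "min d e"] by auto
    have 1: "N (slope (h i)) \<le> c + d" if "i \<ge> K" for i
      using h(4)[of i] small[OF K that] by linarith
    have 2: "c - d \<le> N (\<lambda>x. (slope (h i) x + slope (h j) x) / 2)" if ij: "i \<ge> K" "j \<ge> K" for i j
    proof -
      define k where "k = (\<lambda>x. (1/2) * h i x + (1/2) * h j x)"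
      have k: "is_Lipschitz k" unfolding k_def by (rule is_Lipschitz_lincomb[OF h(1) h(1)])
      have kL: "k \<in> L" unfolding k_def by (intro L_add Lp_cmult h)
      have "nrm (\<lambda>x. k x - f x) = nrm (\<lambda>x. (1/2) * (h i x - f x) + (1/2) * (h j x - f x))"
        by (rule arg_cong[of _ _ nrm]) (auto simp: k_def algebra_simps)
      also have "\<dots> \<le> nrm (\<lambda>x. (1/2) * (h i x - f x)) + nrm (\<lambda>x. (1/2) * (h j x - f x))"
        by (intro nrm_triangle Lp_cmult L_diff h f)
      also have "\<dots> \<le> e"
        unfolding nrm_cmult using h(3)[of i] h(3)[of j] small[OF K ij(1)] small[OF K ij(2)] by simp
      finally have "c - d + e < N (slope k)" using e2 k kL by blast
      also have "N (slope k) \<le> N (\<lambda>x. (slope (h i) x + slope (h j) x) / 2)"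
      proof (rule Lp_pow_mono[OF _ Lp_measurable[OF slope_in_L[OF k]]])
        show "(\<lambda>x. (slope (h i) x + slope (h j) x) / 2) \<in> L"
          using Lp_cmult[OF L_add[OF slope_in_L[OF h(1)[of i]] slope_in_L[OF h(1)[of j]]], of "1/2"] by simp
        have "\<bar>slope k x\<bar> \<le> \<bar>(slope (h i) x + slope (h j) x) / 2\<bar>" for x
          using slope_lincomb_le[OF h(1)[of i] h(1)[of j], of "1/2" "1/2" x, folded k_def] slope_nonneg[OF k, of x]
          by simp
        then show "AE x in m. \<bar>slope k x\<bar> \<le> \<bar>(slope (h i) x + slope (h j) x) / 2\<bar>" by simp
      qed (use p_pos in simp)
      finally show ?thesis using e by simp
    qed
    show "\<exists>K. \<forall>i\<ge>K. \<forall>j\<ge>K. N (slope (h i)) \<le> c + d \<and> c - d \<le> N (\<lambda>x. (slope (h i) x + slope (h j) x) / 2)"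
      using 1 2 by blast
  qed (use slope_in_L h in blast)
  then obtain G where G: "G \<in> L" "Lp_conv m p (\<lambda>n. slope (h n)) G sequentially" "N G = c" by blast
  have "relaxed_slope m p f G"
    unfolding relaxed_slope_def
  proof (intro conjI bexI[of _ G] exI[of _ h])
    show "Lp_conv m p h f sequentially"
      unfolding Lp_conv_def
      by (rule Lim_null_comparison[OF always_eventually LIMSEQ_inverse_real_of_nat])
        (use h(3) in \<open>simp add: inverse_eq_divide\<close>)
    show "Lp_weak_conv m p (\<lambda>n. slope (h n)) G"
      unfolding Lp_weak_conv_def
    proof (intro conjI allI ballI)
      fix \<phi> assume phi: "\<phi> \<in> Lq"
      have lim: "(\<lambda>n. Lp_norm m q \<phi> * nrm (\<lambda>x. slope (h n) x - G x)) \<longlonglongrightarrow> 0"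
        using tendsto_mult_right_zero G(2) unfolding Lp_conv_def by blast
      have "(\<lambda>n. pairing m \<phi> (slope (h n)) - pairing m \<phi> G) \<longlonglongrightarrow> 0"
        by (rule Lim_null_comparison[OF always_eventually lim])
          (use pairing_bound[OF phi L_diff[OF slope_in_L[OF h(1)] G(1)]] pairing_diff[OF phi slope_in_L[OF h(1)] G(1)] in simp)
      then show "(\<lambda>n. pairing m \<phi> (slope (h n))) \<longlonglongrightarrow> pairing m \<phi> G" by (simp add: LIM_zero_iff)
    qed (use G slope_in_L h in auto)
  qed (use f G h in auto)
  moreover have "nrm G \<le> nrm G'" if "relaxed_slope m p f G'" for G'
    using c_le[OF relaxed_slope_approx[OF that]] G(3) p_pos
    unfolding Lp_norm_eq_pow by (intro powr_mono2) auto
  ultimately have "is_minimal_relaxed_slope m p f G" by (simp add: is_minimal_relaxed_slope_def)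
  then show ?thesis using G(3) c_le[OF assms(2)] by blast
qed

text \<open>The bridge between the definition by minimal slopes and the relaxation. Convexity,
  scaling and lower semicontinuity of the energy are afterwards proved through \<open>approx\<close>
  alone.\<close>

lemma Ch_le_iff:
  assumes f: "f \<in> L"
  shows "Ch m p f \<le> ereal (C / p) \<longleftrightarrow> approx f C"
proof
  assume *: "Ch m p f \<le> ereal (C / p)"
  then have ex: "\<exists>G. is_minimal_relaxed_slope m p f G" by (auto simp: Ch_def split: if_splits)
  then have "is_minimal_relaxed_slope m p f (minimal_relaxed_slope m p f)"
    unfolding minimal_relaxed_slope_def by (rule someI_ex)
  then have "approx f (N (minimal_relaxed_slope m p f))"
    by (intro relaxed_slope_approx) (simp add: is_minimal_relaxed_slope_def)
  moreover have "N (minimal_relaxed_slope m p f) / p \<le> C / p"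
    using * ex by (simp add: Ch_def Lp_pow_def)
  ultimately show "approx f C" using p_pos by (auto intro: approx_mono simp: divide_le_cancel)
next
  assume "approx f C"
  then obtain G where G: "is_minimal_relaxed_slope m p f G" "N G \<le> C" using approx_imp_minimal_slope[OF f] by blast
  then have ex: "\<exists>G. is_minimal_relaxed_slope m p f G" by blast
  then have "is_minimal_relaxed_slope m p f (minimal_relaxed_slope m p f)"
    unfolding minimal_relaxed_slope_def by (rule someI_ex)
  then have "nrm (minimal_relaxed_slope m p f) \<le> nrm G" using G by (simp add: is_minimal_relaxed_slope_def)
  then have "nrm (minimal_relaxed_slope m p f) powr p \<le> nrm G powr p" using p_pos by (intro powr_mono2) auto
  then have "N (minimal_relaxed_slope m p f) \<le> C" using G(2) by (simp add: nrm_powr)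
  then show "Ch m p f \<le> ereal (C / p)" using ex p_pos by (simp add: Ch_def Lp_pow_def divide_right_mono)
qed

lemma Ch_finite_imp_L: "Ch m p f < \<infinity> \<Longrightarrow> f \<in> L"
  by (auto simp: Ch_def is_minimal_relaxed_slope_def relaxed_slope_def split: if_splits)

section \<open>The energy as a real-valued functional\<close>

abbreviation "H \<equiv> H1p m p"

text \<open>The p-th power of the norm of the minimal relaxed slope; without the factor 1/p it
  equals the eigenvalue on eigenfunctions of unit norm. Outside \<open>H\<close> the conversion from
  infinity returns 0, so membership in \<open>H\<close> is always recorded separately.\<close>

definition E :: "('a \<Rightarrow> real) \<Rightarrow> real" where
  "E f = p * real_of_ereal (Ch m p f)"

lemma H_L: "f \<in> H \<Longrightarrow> f \<in> L"
  by (simp add: H1p_def)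

lemma Ch_nonneg: "0 \<le> Ch m p f"
  using p_pos by (auto simp: Ch_def)

lemma E_nonneg: "0 \<le> E f"
  using p_pos Ch_nonneg[of f] by (simp add: E_def real_of_ereal_pos)

lemma Ch_eq_E: "f \<in> H \<Longrightarrow> Ch m p f = ereal (E f / p)"
  using p_pos Ch_nonneg[of f] by (cases "Ch m p f") (auto simp: H1p_def E_def)

lemma H_iff_Ch: "f \<in> H \<longleftrightarrow> Ch m p f < \<infinity>"
  using Ch_finite_imp_L by (auto simp: H1p_def)

lemma approx_iff:
  assumes "f \<in> L"
  shows "approx f C \<longleftrightarrow> f \<in> H \<and> E f \<le> C"
proof -
  have "approx f C \<longleftrightarrow> Ch m p f \<le> ereal (C / p)" by (rule Ch_le_iff[OF assms, symmetric])
  also have "\<dots> \<longleftrightarrow> f \<in> H \<and> E f \<le> C"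
  proof
    assume *: "Ch m p f \<le> ereal (C / p)"
    then have "f \<in> H" unfolding H_iff_Ch by (auto intro: order_le_less_trans)
    with * show "f \<in> H \<and> E f \<le> C" using p_pos by (simp add: Ch_eq_E divide_le_cancel)
  next
    assume "f \<in> H \<and> E f \<le> C"
    then show "Ch m p f \<le> ereal (C / p)" using p_pos by (simp add: Ch_eq_E divide_right_mono)
  qed
  finally show ?thesis .
qed

lemma approxE:
  assumes "approx f C" "e > 0"
  obtains h where "is_Lipschitz h" "h \<in> L" "nrm (\<lambda>x. h x - f x) \<le> e" "N (slope h) \<le> C + e"
proof -
  have "\<exists>h. is_Lipschitz h \<and> h \<in> L \<and> nrm (\<lambda>x. h x - f x) \<le> e \<and> N (slope h) \<le> C + e"
    using assms by (simp add: approx_def)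
  then show ?thesis using that by (elim exE conjE) (rule that, blast+)
qed

lemma approx_E: "f \<in> H \<Longrightarrow> approx f (E f)"
  using approx_iff H_L by blast

lemma E_convex:
  assumes f: "f \<in> H" and g: "g \<in> H" and s: "0 \<le> s" "s \<le> 1"
  shows "(\<lambda>x. (1 - s) * f x + s * g x) \<in> H \<and> E (\<lambda>x. (1 - s) * f x + s * g x) \<le> (1 - s) * E f + s * E g"
proof -
  define w where "w = (\<lambda>x. (1 - s) * f x + s * g x)"
  have w: "w \<in> L" unfolding w_def by (intro L_add Lp_cmult H_L f g)
  have "approx w ((1 - s) * E f + s * E g)"
    unfolding approx_def
  proof (intro allI impI)
    fix e :: real assume e: "e > 0"
    obtain h where h: "is_Lipschitz h" "h \<in> L" "nrm (\<lambda>x. h x - f x) \<le> e" "N (slope h) \<le> E f + e"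
      by (rule approxE[OF approx_E[OF f] e])
    obtain k where k: "is_Lipschitz k" "k \<in> L" "nrm (\<lambda>x. k x - g x) \<le> e" "N (slope k) \<le> E g + e"
      by (rule approxE[OF approx_E[OF g] e])
    define z where "z = (\<lambda>x. (1 - s) * h x + s * k x)"
    have z: "is_Lipschitz z" unfolding z_def by (rule is_Lipschitz_lincomb[OF h(1) k(1)])
    have zL: "z \<in> L" unfolding z_def by (intro L_add Lp_cmult h k)
    have 1: "nrm (\<lambda>x. z x - w x) \<le> e"
    proof -
      have "nrm (\<lambda>x. z x - w x) = nrm (\<lambda>x. (1 - s) * (h x - f x) + s * (k x - g x))"
        by (rule arg_cong[of _ _ nrm]) (auto simp: z_def w_def algebra_simps)
      also have "\<dots> \<le> nrm (\<lambda>x. (1 - s) * (h x - f x)) + nrm (\<lambda>x. s * (k x - g x))"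
        by (intro nrm_triangle Lp_cmult L_diff h k H_L f g)
      also have "\<dots> \<le> (1 - s) * e + s * e"
        unfolding nrm_cmult using s h k by (intro add_mono mult_mono) auto
      finally show ?thesis by (simp add: algebra_simps)
    qed
    have "N (slope z) \<le> N (\<lambda>x. (1 - s) * slope h x + s * slope k x)"
    proof (rule Lp_pow_mono[OF _ Lp_measurable[OF slope_in_L[OF z]]])
      show "(\<lambda>x. (1 - s) * slope h x + s * slope k x) \<in> L" by (intro L_add Lp_cmult slope_in_L h k)
      have "\<bar>slope z x\<bar> \<le> \<bar>(1 - s) * slope h x + s * slope k x\<bar>" for x
        using slope_lincomb_le[OF h(1) k(1), of "1 - s" s x, folded z_def] slope_nonneg[OF z, of x] s by simp
      then show "AE x in m. \<bar>slope z x\<bar> \<le> \<bar>(1 - s) * slope h x + s * slope k x\<bar>" by simp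
    qed (use p_pos in simp)
    also have "\<dots> \<le> (1 - s) * N (slope h) + s * N (slope k)"
      by (rule Lp_pow_convex[OF p_ge_1 slope_in_L[OF h(1)] slope_in_L[OF k(1)] s])
    also have "\<dots> \<le> (1 - s) * (E f + e) + s * (E g + e)"
      using s h k by (intro add_mono mult_left_mono) auto
    finally have "N (slope z) \<le> (1 - s) * E f + s * E g + e" by (simp add: algebra_simps)
    with z zL 1 show "\<exists>h. is_Lipschitz h \<and> h \<in> L \<and> nrm (\<lambda>x. h x - w x) \<le> e \<and> N (slope h) \<le> (1 - s) * E f + s * E g + e"
      by (intro exI[of _ z]) simp
  qed
  then show ?thesis using approx_iff[OF w] by (simp add: w_def)
qed

text \<open>Built into the relaxation: a Lipschitz function near some \<open>u n\<close>, itself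
  near f, is near f. One suitable index per tolerance is enough, whatever the filter.\<close>

lemma E_lsc:
  assumes "F \<noteq> bot" and f: "f \<in> L" and conv: "Lp_conv m p u f F"
    and u: "eventually (\<lambda>n. u n \<in> H \<and> E (u n) \<le> C) F"
  shows "f \<in> H" "E f \<le> C"
proof -
  have "approx f C"
    unfolding approx_def
  proof (intro allI impI)
    fix e :: real assume e: "e > 0"
    have "eventually (\<lambda>n. nrm (\<lambda>x. u n x - f x) < e / 2) F"
      using conv half_gt_zero[OF e] unfolding Lp_conv_def by (rule order_tendstoD(2))
    then have "eventually (\<lambda>n. nrm (\<lambda>x. u n x - f x) < e / 2 \<and> u n \<in> H \<and> E (u n) \<le> C) F"
      using u by eventually_elim blast
    then obtain n where n: "nrm (\<lambda>x. u n x - f x) < e / 2" "u n \<in> H" "E (u n) \<le> C"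
      using eventually_happens assms(1) by blast
    obtain h where h: "is_Lipschitz h" "h \<in> L" "nrm (\<lambda>x. h x - u n x) \<le> e / 2" "N (slope h) \<le> E (u n) + e / 2"
      by (rule approxE[OF approx_E[OF n(2)] half_gt_zero[OF e]])
    have "nrm (\<lambda>x. h x - f x) \<le> e" using nrm_triangle_diff[OF h(2) H_L[OF n(2)] f] h n by linarith
    moreover have "N (slope h) \<le> C + e" using h n e by linarith
    ultimately show "\<exists>h. is_Lipschitz h \<and> h \<in> L \<and> nrm (\<lambda>x. h x - f x) \<le> e \<and> N (slope h) \<le> C + e"
      using h by (intro exI[of _ h]) simp
  qed
  then show "f \<in> H" "E f \<le> C" using approx_iff[OF f] by auto
qed

text \<open>Constants have slope 0 and belong to L^p, so shifts cost no energy. Equality for shifts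
  and for nonzero factors follows by applying the bound to the inverse map.\<close>

lemma E_affine_le:
  assumes f: "f \<in> H"
  shows "(\<lambda>x. a * f x + b) \<in> H \<and> E (\<lambda>x. a * f x + b) \<le> \<bar>a\<bar> powr p * E f"
proof -
  define w where "w = (\<lambda>x. a * f x + b)"
  have w: "w \<in> L" unfolding w_def by (intro L_add Lp_cmult Lp_const H_L f)
  have "approx w (\<bar>a\<bar> powr p * E f)"
    unfolding approx_def
  proof (intro allI impI)
    fix e :: real assume e: "e > 0"
    \<comment> \<open>Small enough to absorb both errors, |a| d in the distance and |a|^p d in the
      energy.\<close>
    define d where "d = e / (1 + \<bar>a\<bar> + \<bar>a\<bar> powr p)"
    have pos: "1 + \<bar>a\<bar> + \<bar>a\<bar> powr p > 0" by (simp add: add_pos_nonneg)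
    have d: "d > 0" using e pos by (simp add: d_def)
    have "d * (1 + \<bar>a\<bar> + \<bar>a\<bar> powr p) = e" using pos by (simp add: d_def)
    then have "d + \<bar>a\<bar> * d + \<bar>a\<bar> powr p * d = e" by (simp add: algebra_simps)
    moreover have "0 \<le> \<bar>a\<bar> * d" "0 \<le> \<bar>a\<bar> powr p * d" using d by simp_all
    ultimately have de: "\<bar>a\<bar> * d \<le> e" "\<bar>a\<bar> powr p * d \<le> e" using d by linarith+
    obtain h where h: "is_Lipschitz h" "h \<in> L" "nrm (\<lambda>x. h x - f x) \<le> d" "N (slope h) \<le> E f + d"
      by (rule approxE[OF approx_E[OF f] d])
    define z where "z = (\<lambda>x. a * h x + 1 * b)"
    have z: "is_Lipschitz z" unfolding z_def by (rule is_Lipschitz_lincomb[OF h(1) is_Lipschitz_const])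
    have zL: "z \<in> L" unfolding z_def by (intro L_add Lp_cmult h Lp_const)
    have "nrm (\<lambda>x. z x - w x) = nrm (\<lambda>x. a * (h x - f x))"
      by (rule arg_cong[of _ _ nrm]) (auto simp: z_def w_def algebra_simps)
    also have "\<dots> \<le> \<bar>a\<bar> * d" unfolding nrm_cmult using h by (intro mult_left_mono) auto
    finally have 1: "nrm (\<lambda>x. z x - w x) \<le> e" using de by simp
    have "N (slope z) \<le> N (\<lambda>x. \<bar>a\<bar> * slope h x)"
    proof (rule Lp_pow_mono[OF Lp_cmult[OF slope_in_L[OF h(1)]] Lp_measurable[OF slope_in_L[OF z]]])
      have "\<bar>slope z x\<bar> \<le> \<bar>\<bar>a\<bar> * slope h x\<bar>" for x
        using slope_lincomb_le[OF h(1) is_Lipschitz_const, of a 1 b x, folded z_def] slope_nonneg[OF z, of x]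
          slope_nonneg[OF h(1), of x] by (simp add: slope_const)
      then show "AE x in m. \<bar>slope z x\<bar> \<le> \<bar>\<bar>a\<bar> * slope h x\<bar>" by simp
    qed (use p_pos in simp)
    also have "\<dots> = \<bar>a\<bar> powr p * N (slope h)" by (simp add: Lp_pow_cmult)
    also have "\<dots> \<le> \<bar>a\<bar> powr p * (E f + d)" using h by (intro mult_left_mono) auto
    finally have "N (slope z) \<le> \<bar>a\<bar> powr p * E f + e" using de by (simp add: distrib_left)
    with z zL 1 show "\<exists>h. is_Lipschitz h \<and> h \<in> L \<and> nrm (\<lambda>x. h x - w x) \<le> e \<and> N (slope h) \<le> \<bar>a\<bar> powr p * E f + e"
      by (intro exI[of _ z]) simp
  qed
  then show ?thesis using approx_iff[OF w] by (simp add: w_def)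
qed

lemma E_add_const:
  assumes f: "f \<in> H"
  shows "(\<lambda>x. f x + c) \<in> H" "E (\<lambda>x. f x + c) = E f"
proof -
  have 1: "(\<lambda>x. f x + c) \<in> H" "E (\<lambda>x. f x + c) \<le> E f" using E_affine_le[OF f, of 1 c] by simp_all
  moreover have "E f \<le> E (\<lambda>x. f x + c)" using E_affine_le[OF 1(1), of 1 "- c"] by simp
  ultimately show "(\<lambda>x. f x + c) \<in> H" "E (\<lambda>x. f x + c) = E f" by auto
qed

lemma E_cmult:
  assumes f: "f \<in> H"
  shows "(\<lambda>x. c * f x) \<in> H" "E (\<lambda>x. c * f x) = \<bar>c\<bar> powr p * E f"
proof -
  have 1: "(\<lambda>x. c * f x) \<in> H" "E (\<lambda>x. c * f x) \<le> \<bar>c\<bar> powr p * E f"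
    using E_affine_le[OF f, of c 0] by simp_all
  moreover have "\<bar>c\<bar> powr p * E f \<le> E (\<lambda>x. c * f x)"
  proof (cases "c = 0")
    case True
    then show ?thesis using E_nonneg by simp
  next
    case False
    have "E f \<le> \<bar>inverse c\<bar> powr p * E (\<lambda>x. c * f x)"
      using E_affine_le[OF 1(1), of "inverse c" 0] False by (simp add: field_simps)
    then have "\<bar>c\<bar> powr p * E f \<le> \<bar>c\<bar> powr p * (\<bar>inverse c\<bar> powr p * E (\<lambda>x. c * f x))"
      by (intro mult_left_mono) auto
    also have "\<dots> = (\<bar>c\<bar> * \<bar>inverse c\<bar>) powr p * E (\<lambda>x. c * f x)" by (simp add: powr_mult)
    also have "\<bar>c\<bar> * \<bar>inverse c\<bar> = 1" using False by (simp flip: abs_mult)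
    finally show ?thesis by simp
  qed
  ultimately show "(\<lambda>x. c * f x) \<in> H" "E (\<lambda>x. c * f x) = \<bar>c\<bar> powr p * E f" by auto
qed

text \<open>A constant sequence converges in L^p to each of its modifications on null sets, so lower
  semicontinuity applies in both directions.\<close>

lemma E_cong_AE:
  assumes f: "f \<in> H" and g: "g \<in> L" and eq: "AE x in m. f x = g x"
  shows "g \<in> H" "E g = E f"
proof -
  have conv: "Lp_conv m p (\<lambda>n::nat. a) b sequentially" if "a \<in> L" "b \<in> L" "AE x in m. a x = b x" for a b
    using that Lp_norm_eq_0_iff[OF L_diff[OF that(1,2)] p_pos] by (simp add: Lp_conv_def)
  have 1: "g \<in> H" "E g \<le> E f"
    using E_lsc[OF _ g conv[OF H_L[OF f] g eq], of "E f"] f by auto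
  have "AE x in m. g x = f x" using eq by eventually_elim simp
  then have "E f \<le> E g"
    using E_lsc(2)[OF _ H_L[OF f] conv[OF g H_L[OF f]], of "E g"] 1 by auto
  with 1 show "g \<in> H" "E g = E f" by auto
qed

section \<open>Subdifferential and eigenfunctions\<close>

lemma Ch_subdiff_iff:
  "\<xi> \<in> Ch_subdiff m p f \<longleftrightarrow>
    \<xi> \<in> Lq \<and> f \<in> H \<and> (\<forall>g\<in>H. E f / p + pairing m \<xi> (\<lambda>x. g x - f x) \<le> E g / p)"
proof (cases "f \<in> H")
  case True
  have "(\<forall>g\<in>L. Ch m p f + ereal (pairing m \<xi> (\<lambda>x. g x - f x)) \<le> Ch m p g) \<longleftrightarrow>
      (\<forall>g\<in>H. E f / p + pairing m \<xi> (\<lambda>x. g x - f x) \<le> E g / p)"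
  proof (intro iffI ballI)
    fix g assume "\<forall>g\<in>L. Ch m p f + ereal (pairing m \<xi> (\<lambda>x. g x - f x)) \<le> Ch m p g" and g: "g \<in> H"
    then have "Ch m p f + ereal (pairing m \<xi> (\<lambda>x. g x - f x)) \<le> Ch m p g" using H_L by blast
    then show "E f / p + pairing m \<xi> (\<lambda>x. g x - f x) \<le> E g / p" using True g by (simp add: Ch_eq_E)
  next
    fix g assume *: "\<forall>g\<in>H. E f / p + pairing m \<xi> (\<lambda>x. g x - f x) \<le> E g / p" and g: "g \<in> L"
    show "Ch m p f + ereal (pairing m \<xi> (\<lambda>x. g x - f x)) \<le> Ch m p g"
    proof (cases "g \<in> H")
      case gH: True
      then have "E f / p + pairing m \<xi> (\<lambda>x. g x - f x) \<le> E g / p" using * by blast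
      then show ?thesis using True gH by (simp add: Ch_eq_E)
    next
      case False
      then show ?thesis by (simp add: H_iff_Ch)
    qed
  qed
  then show ?thesis using True H_L by (auto simp: Ch_subdiff_def H_iff_Ch)
next
  case False
  then show ?thesis by (auto simp: Ch_subdiff_def H_iff_Ch)
qed

text \<open>Euler's identity for a p-homogeneous functional: the dilations (1 + s) f are competitors
  for both signs of s, so the first derivative at 0 vanishes.\<close>

lemma subdiff_euler:
  assumes "\<xi> \<in> Ch_subdiff m p f"
  shows "pairing m \<xi> f = E f"
proof -
  from assms have xi: "\<xi> \<in> Lq" and f: "f \<in> H"
    and sub: "\<And>g. g \<in> H \<Longrightarrow> E f / p + pairing m \<xi> (\<lambda>x. g x - f x) \<le> E g / p"
    by (auto simp: Ch_subdiff_iff)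
  define \<phi> where "\<phi> s = (1 + s) powr p * E f / p - s * pairing m \<xi> f" for s
  have d: "(\<phi> has_real_derivative (p * (1 + 0) powr (p - 1) * E f / p - pairing m \<xi> f)) (at 0)"
    unfolding \<phi>_def by (auto intro!: derivative_eq_intros)
  have "\<phi> 0 \<le> \<phi> s" if "\<bar>0 - s\<bar> < 1" for s
  proof -
    have "E f / p + pairing m \<xi> (\<lambda>x. (1 + s) * f x - f x) \<le> E (\<lambda>x. (1 + s) * f x) / p"
      by (rule sub[OF E_cmult(1)[OF f]])
    moreover have "(\<lambda>x. (1 + s) * f x - f x) = (\<lambda>x. s * f x)" by (simp add: algebra_simps)
    ultimately show ?thesis using that by (simp add: pairing_cmult E_cmult(2)[OF f] \<phi>_def)
  qed
  then have "p * (1 + 0) powr (p - 1) * E f / p - pairing m \<xi> f = 0"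
    by (intro DERIV_local_min[OF d, of 1]) auto
  then show ?thesis using p_pos by simp
qed

text \<open>The energy ignores constants, so f + 1 and f - 1 are competitors of the same
  energy.\<close>

lemma subdiff_const:
  assumes "\<xi> \<in> Ch_subdiff m p f"
  shows "pairing m \<xi> (\<lambda>x. 1) = 0"
proof -
  from assms have f: "f \<in> H"
    and sub: "\<And>g. g \<in> H \<Longrightarrow> E f / p + pairing m \<xi> (\<lambda>x. g x - f x) \<le> E g / p"
    by (auto simp: Ch_subdiff_iff)
  have "c * pairing m \<xi> (\<lambda>x. 1) \<le> 0" for c
    using sub[OF E_add_const(1)[OF f, of c]] pairing_cmult[of \<xi> c "\<lambda>x. 1"] by (simp add: E_add_const(2)[OF f])
  from this[of 1] this[of "-1"] show ?thesis by simp
qed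

text \<open>The minimal norm is automatic. Euler's identity prescribes the pairing of every
  subgradient with f, Hoelder turns this into a lower bound for its norm, and multiples of
  \<open>J p f\<close> attain equality in Hoelder.\<close>

lemma eigenfunctionI:
  assumes sub: "(\<lambda>x. l * J p f x) \<in> Ch_subdiff m p f" and nz: "N f \<noteq> 0"
  shows "eigenfunction m p l f"
proof -
  from sub have f: "f \<in> H" by (auto simp: Ch_subdiff_iff)
  have pos: "nrm f > 0" using nz Lp_norm_nonneg[of m p f] by (auto simp: Lp_norm_eq_pow less_le)
  have lN: "l * N f = E f" using subdiff_euler[OF sub] by (simp add: pairing_cmult_left pairing_J_self)
  have N: "N f = nrm f powr (p - 1) * nrm f"
    using pos powr_mult_base[of "nrm f" "p - 1"] by (simp add: nrm_powr mult.commute)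
  have "Lp_norm m q (\<lambda>x. - l * J p f x) \<le> Lp_norm m q \<eta>" if eta: "(\<lambda>x. - \<eta> x) \<in> Ch_subdiff m p f" for \<eta>
  proof -
    have "l * N f = pairing m (\<lambda>x. - \<eta> x) f" using subdiff_euler[OF eta] lN by simp
    moreover have "\<bar>pairing m (\<lambda>x. - \<eta> x) f\<bar> \<le> Lp_norm m q (\<lambda>x. - \<eta> x) * nrm f"
      using eta by (intro pairing_bound H_L f) (simp add: Ch_subdiff_iff)
    moreover have "Lp_norm m q (\<lambda>x. - \<eta> x) = Lp_norm m q \<eta>" by (simp add: Lp_norm_def)
    ultimately have "\<bar>l * N f\<bar> \<le> Lp_norm m q \<eta> * nrm f" by simp
    then have "\<bar>l\<bar> * nrm f powr (p - 1) * nrm f \<le> Lp_norm m q \<eta> * nrm f"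
      unfolding N abs_mult using pos by (simp add: mult.assoc)
    then have "\<bar>l\<bar> * nrm f powr (p - 1) \<le> Lp_norm m q \<eta>" using pos by (rule mult_right_le_imp_le)
    then show ?thesis using Lp_norm_cmult[OF q_pos, of m "-l" "J p f"] by (simp add: Lp_norm_J)
  qed
  then have "is_p_Laplacian m p f (\<lambda>x. - l * J p f x)" using sub by (simp add: is_p_Laplacian_def)
  then show ?thesis using f nz Lp_pow_eq_0_iff[OF H_L[OF f] p_pos] by (simp add: eigenfunction_def)
qed

text \<open>
  Testing with the normalised perturbations \<open>(f + s v) / \<parallel>f + s v\<parallel>\<close>, which stay in the
  constraint set, identifies the normal cone of the unit ball at \<open>f\<close> without a sum rule for
  subdifferentials.
\<close>

lemma constrained_subgradient:
  assumes f: "f \<in> H" "N f = 1" "E f < B" and eta: "\<eta> \<in> Lq"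
    and sub: "\<And>g. g \<in> H \<Longrightarrow> N g \<le> 1 \<Longrightarrow> E g \<le> B \<Longrightarrow> E f / p + pairing m \<eta> (\<lambda>x. g x - f x) \<le> E g / p"
  shows "(\<lambda>x. \<eta> x - (pairing m \<eta> f - E f) * J p f x) \<in> Ch_subdiff m p f"
  unfolding Ch_subdiff_iff
proof (intro conjI ballI)
  note fL = H_L[OF f(1)]
  have JL: "(\<lambda>x. (pairing m \<eta> f - E f) * J p f x) \<in> Lq" by (intro Lp_cmult J_in_Lq fL)
  show "(\<lambda>x. \<eta> x - (pairing m \<eta> f - E f) * J p f x) \<in> Lq" by (intro Lq_diff eta JL)
  fix g assume g: "g \<in> H"
  define v where "v = (\<lambda>x. g x - f x)"
  have v: "v \<in> L" unfolding v_def by (intro L_diff H_L f g)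
  define n where "n s = N (\<lambda>x. f x + s * v x)" for s
  define \<beta> where "\<beta> = pairing m (J p f) v"
  define a where "a = pairing m \<eta> f"
  define b where "b = pairing m \<eta> v"
  have n0: "n 0 = 1" using f by (simp add: n_def)
  have dn: "(n has_real_derivative p * \<beta>) (at 0)" unfolding n_def \<beta>_def by (rule N_has_derivative[OF fL v])
  \<comment> \<open>An upper bound for the gap in the constrained inequality at the normalised
    perturbation. It vanishes at 0 and is nonnegative for small s > 0; its derivative at 0 is the
    gap in the claimed inequality.\<close>
  define \<phi> where "\<phi> s = (E f + s * (E g - E f)) / n s / p - E f / p - ((a + s * b) * n s powr (- 1 / p) - a)" for s
  have d\<phi>: "(\<phi> has_real_derivative ((E g - E f) - E f * (p * \<beta>)) / p - (b - a * \<beta>)) (at 0)"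
    unfolding \<phi>_def using n0 p_pos
    by (auto intro!: derivative_eq_intros dn simp: field_simps)
  have \<phi>0: "\<phi> 0 = 0" by (simp add: \<phi>_def n0)
  \<comment> \<open>The strict bound E f < B leaves room: by continuity the normalised perturbations
    obey the energy constraint for small s.\<close>
  have "isCont (\<lambda>s. (E f + s * (E g - E f)) / n s) 0"
    using DERIV_isCont[OF dn] n0 by (intro continuous_intros) auto
  then have "((\<lambda>s. (E f + s * (E g - E f)) / n s) \<longlongrightarrow> E f) (at 0)"
    by (simp add: isCont_def n0)
  then have "\<forall>\<^sub>F s in at 0. (E f + s * (E g - E f)) / n s < B" using f(3) by (rule order_tendstoD)
  moreover have "(n \<longlongrightarrow> 1) (at 0)" using DERIV_isCont[OF dn] n0 by (simp add: isCont_def)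
  then have "\<forall>\<^sub>F s in at 0. 0 < n s" by (rule order_tendstoD) simp
  ultimately have "\<forall>\<^sub>F s in at 0. (E f + s * (E g - E f)) / n s < B \<and> 0 < n s" by eventually_elim blast
  then obtain d where d: "d > 0" "\<And>s. s \<noteq> 0 \<Longrightarrow> \<bar>s\<bar> < d \<Longrightarrow> (E f + s * (E g - E f)) / n s < B \<and> 0 < n s"
    by (auto simp: eventually_at dist_real_def)
  have \<phi>pos: "0 \<le> \<phi> s" if s: "0 < s" "s < d" "s \<le> 1" for s
  proof -
    have B: "(E f + s * (E g - E f)) / n s < B" and npos: "0 < n s" using d(2)[of s] s by auto
    define c where "c = n s powr (- 1 / p)"
    define w where "w = (\<lambda>x. f x + s * v x)"
    have w_eq: "w = (\<lambda>x. (1 - s) * f x + s * g x)" by (auto simp: w_def v_def algebra_simps)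
    have w: "w \<in> H" "E w \<le> E f + s * (E g - E f)"
      using E_convex[OF f(1) g, of s] s unfolding w_eq by (auto simp: algebra_simps)
    have cp: "c powr p = 1 / n s" using npos p_pos unfolding c_def powr_powr by (simp add: powr_minus_divide)
    have c0: "c \<ge> 0" by (simp add: c_def)
    have Nw: "N (\<lambda>x. c * w x) = 1" using npos c0 by (simp add: Lp_pow_cmult cp n_def w_def)
    have Ew: "E (\<lambda>x. c * w x) \<le> (E f + s * (E g - E f)) / n s"
      using w npos c0 by (simp add: E_cmult(2) cp divide_right_mono)
    have "E f / p + pairing m \<eta> (\<lambda>x. c * w x - f x) \<le> E (\<lambda>x. c * w x) / p"
      using Nw Ew B by (intro sub E_cmult w) auto
    also have "\<dots> \<le> (E f + s * (E g - E f)) / n s / p" using Ew p_pos by (intro divide_right_mono) auto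
    also have "pairing m \<eta> (\<lambda>x. c * w x - f x) = c * (a + s * b) - a"
      using pairing_diff[OF eta Lp_cmult[OF H_L[OF w(1)]] fL, of c] pairing_scale_add[OF eta fL v, of s]
      by (simp add: pairing_cmult a_def b_def w_def)
    finally show ?thesis unfolding \<phi>_def c_def by (simp add: mult.commute)
  qed
  have "0 \<le> ((E g - E f) - E f * (p * \<beta>)) / p - (b - a * \<beta>)"
    by (rule right_minimum_derivative_nonneg[OF d\<phi>, of "min d 1"]) (use d(1) \<phi>pos \<phi>0 in auto)
  moreover have "((E g - E f) - E f * (p * \<beta>)) / p = E g / p - E f / p - E f * \<beta>"
    using p_pos by (simp add: diff_divide_distrib)
  ultimately have "E f / p + (b - (a - E f) * \<beta>) \<le> E g / p" by (simp add: algebra_simps)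
  moreover have "pairing m (\<lambda>x. \<eta> x - (a - E f) * J p f x) v = b - (a - E f) * \<beta>"
    using pairing_diff_left[OF eta JL v] by (simp add: pairing_cmult_left a_def b_def \<beta>_def)
  ultimately show "E f / p + pairing m (\<lambda>x. \<eta> x - (pairing m \<eta> f - E f) * J p f x) (\<lambda>x. g x - f x) \<le> E g / p"
    by (simp add: v_def a_def)
qed (rule f(1))

section \<open>The first eigenvalue\<close>

lemma compact_sequence:
  assumes cpt: "compact_embedding m p"
    and u: "\<And>n. u n \<in> H" "\<And>n. N (u n) \<le> 1" "\<And>n. E (u n) \<le> C"
  shows "\<exists>r f. strict_mono (r :: nat \<Rightarrow> nat) \<and> f \<in> L \<and> Lp_conv m p (\<lambda>n. u (r n)) f sequentially"
proof -
  have "(SUP n. ereal (nrm (u n)) + Ch m p (u n)) \<le> ereal (1 + C / p)"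
  proof (rule SUP_least)
    fix n
    have "E (u n) / p \<le> C / p" using u(3) p_pos by (intro divide_right_mono) auto
    moreover have "nrm (u n) \<le> 1" using u(2) by (simp add: nrm_le_1_iff)
    ultimately show "ereal (nrm (u n)) + Ch m p (u n) \<le> ereal (1 + C / p)" by (simp add: Ch_eq_E[OF u(1)])
  qed
  then have "(SUP n. ereal (nrm (u n)) + Ch m p (u n)) < \<infinity>" by (rule order_le_less_trans) simp
  then show ?thesis using cpt u(1) H_L unfolding compact_embedding_def by meson
qed

text \<open>The integral is, up to the factor p, the derivative of N (g + c) in c, so a minimising
  constant does it. If the constant 1 has norm 0, Hoelder makes every such integral vanish.\<close>

lemma ex_centering:
  assumes g: "g \<in> L"
  shows "\<exists>c. pairing m (J p (\<lambda>x. g x + c)) (\<lambda>x. 1) = 0"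
proof (cases "nrm (\<lambda>x. 1) = 0")
  case True
  then have "\<bar>pairing m (J p g) (\<lambda>x. 1)\<bar> \<le> 0"
    using pairing_bound[OF J_in_Lq[OF g] Lp_const[of 1]] by simp
  then show ?thesis by (intro exI[of _ 0]) simp
next
  case False
  then have n1: "nrm (\<lambda>x. 1) > 0" using Lp_norm_nonneg[of m p "\<lambda>x. 1"] by linarith
  define \<phi> where "\<phi> c = N (\<lambda>x. g x + c)" for c
  have gc: "(\<lambda>x. g x + c) \<in> L" for c by (intro L_add g Lp_const)
  have d: "(\<phi> has_real_derivative p * pairing m (J p (\<lambda>x. g x + c)) (\<lambda>x. 1)) (at c)" for c
  proof -
    have "((\<lambda>s. N (\<lambda>x. (g x + c) + s * 1)) has_real_derivative p * pairing m (J p (\<lambda>x. g x + c)) (\<lambda>x. 1)) (at 0)"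
      by (rule N_has_derivative[OF gc Lp_const])
    then have "((\<lambda>s. \<phi> (s + c)) has_real_derivative p * pairing m (J p (\<lambda>x. g x + c)) (\<lambda>x. 1)) (at 0)"
      by (simp add: \<phi>_def add_ac)
    then show ?thesis using DERIV_shift[of \<phi> _ 0 c] by simp
  qed
  \<comment> \<open>Beyond R the triangle inequality gives a norm of g + c at least that of g, so a
    minimum over \<open>{-R..R}\<close> is global.\<close>
  define R where "R = 2 * nrm g / nrm (\<lambda>x. 1) + 1"
  have R: "R > 0" using n1 by (simp add: R_def add_nonneg_pos)
  have "continuous_on {-R..R} \<phi>" using d by (meson DERIV_isCont continuous_at_imp_continuous_on)
  then obtain c where c: "c \<in> {-R..R}" "\<And>c'. c' \<in> {-R..R} \<Longrightarrow> \<phi> c \<le> \<phi> c'"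
    using continuous_attains_inf[of "{-R..R}" \<phi>] R by auto
  have "\<phi> c \<le> \<phi> c'" for c'
  proof (cases "c' \<in> {-R..R}")
    case False
    then have "\<bar>c'\<bar> > R" by auto
    then have "R * nrm (\<lambda>x. 1) \<le> \<bar>c'\<bar> * nrm (\<lambda>x. 1)" using n1 by (intro mult_right_mono) auto
    moreover have "R * nrm (\<lambda>x. 1) = 2 * nrm g + nrm (\<lambda>x. 1)" using n1 by (simp add: R_def field_simps)
    moreover have "\<bar>c'\<bar> * nrm (\<lambda>x. 1) = nrm (\<lambda>x. c')" using nrm_cmult[of m c' "\<lambda>x. 1"] by simp
    moreover have "nrm (\<lambda>x. c') \<le> nrm (\<lambda>x. g x + c') + nrm g"
      using nrm_triangle_diff[OF gc[of c'] Lp_const[of 0] g] nrm_triangle[OF gc[of c'] Lp_uminus[OF g]]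
      by (simp add: Lp_norm_def)
    ultimately have "nrm g \<le> nrm (\<lambda>x. g x + c')" using n1 by linarith
    then have "nrm g powr p \<le> nrm (\<lambda>x. g x + c') powr p" using p_pos by (intro powr_mono2) auto
    then have "\<phi> 0 \<le> \<phi> c'" by (simp add: nrm_powr \<phi>_def)
    then show ?thesis using c(2)[of 0] R by simp
  qed (rule c(2))
  then have "p * pairing m (J p (\<lambda>x. g x + c)) (\<lambda>x. 1) = 0"
    by (intro DERIV_local_min[OF d, of 1]) auto
  then show ?thesis using p_pos by auto
qed

text \<open>The competitors of \<open>lambda1\<close> with finite energy. The integral of
  \<open>J p f\<close> is written as a pairing with the constant 1 so that the duality estimates
  apply to it.\<close>

definition centered :: "('a \<Rightarrow> real) set" where
  "centered = {f \<in> H. N f = 1 \<and> pairing m (J p f) (\<lambda>x. 1) = 0}"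

text \<open>Both constraints are continuous for strong convergence, which the compact embedding
  supplies; for the energy itself lower semicontinuity is enough.\<close>

lemma ex_minimizer:
  assumes cpt: "compact_embedding m p" and ne: "centered \<noteq> {}"
  shows "\<exists>f\<in>centered. \<forall>g\<in>centered. E f \<le> E g"
proof -
  define I where "I = Inf (E ` centered)"
  have bdd: "bdd_below (E ` centered)" by (rule bdd_belowI2[of _ 0]) (rule E_nonneg)
  have I_le: "I \<le> E g" if "g \<in> centered" for g unfolding I_def using bdd that by (intro cInf_lower) auto
  have "\<exists>f\<in>centered. E f \<le> I + 1 / Suc n" for n
  proof -
    have "Inf (E ` centered) < I + 1 / Suc n" by (simp add: I_def)
    then show ?thesis using cInf_lessD[of "E ` centered" "I + 1 / Suc n"] ne by force
  qed
  then obtain u where u: "\<And>n. u n \<in> centered" "\<And>n. E (u n) \<le> I + 1 / Suc n" by metis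
  have u': "u n \<in> H" "N (u n) = 1" "pairing m (J p (u n)) (\<lambda>x. 1) = 0" for n using u(1)[of n] by (auto simp: centered_def)
  have "E (u n) \<le> I + 1" for n using u(2)[of n] by (rule order_trans) simp
  then obtain r f where r: "strict_mono (r :: nat \<Rightarrow> nat)" and f: "f \<in> L" and conv: "Lp_conv m p (\<lambda>n. u (r n)) f sequentially"
    using compact_sequence[OF cpt, of u "I + 1"] u' by auto
  have uL: "\<forall>\<^sub>F n in sequentially. u (r n) \<in> L" using u' H_L by simp
  have "(\<lambda>n. N (u (r n))) \<longlonglongrightarrow> N f" by (rule N_tendsto[OF uL f conv])
  then have N1: "N f = 1" by (simp add: u' LIMSEQ_const_iff)
  have "(\<lambda>n. pairing m (J p (u (r n))) (\<lambda>x. 1)) \<longlonglongrightarrow> pairing m (J p f) (\<lambda>x. 1)"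
    by (rule J_pairing_tendsto[OF uL f Lp_const conv])
  then have P0: "pairing m (J p f) (\<lambda>x. 1) = 0" by (simp add: u' LIMSEQ_const_iff)
  have *: "f \<in> H \<and> E f \<le> I + e" if e: "e > 0" for e
  proof -
    obtain K where K: "1 / Suc K < e" using e nat_approx_posE by blast
    have "\<forall>\<^sub>F n in sequentially. u (r n) \<in> H \<and> E (u (r n)) \<le> I + e"
    proof (rule eventually_sequentiallyI[of K])
      fix n assume "K \<le> n"
      then have "K \<le> r n" using seq_suble[OF r, of n] by simp
      then have "1 / Suc (r n) \<le> 1 / Suc K" by (simp add: frac_le)
      then show "u (r n) \<in> H \<and> E (u (r n)) \<le> I + e" using u(2)[of "r n"] K u' by simp
    qed
    then show ?thesis using E_lsc[OF trivial_limit_sequentially f conv] by blast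
  qed
  have "E f \<le> I" by (rule field_le_epsilon) (simp add: *)
  moreover have "f \<in> H" using *[of 1] by simp
  ultimately show ?thesis using N1 P0 I_le by (intro bexI[of _ f]) (auto simp: centered_def intro: order_trans)
qed

text \<open>Both sides are p-homogeneous, and J is (p - 1)-homogeneous, so centring survives the
  normalisation of \<open>w\<close>.\<close>

lemma minimizer_poincare:
  assumes f: "f \<in> centered" and min: "\<And>g. g \<in> centered \<Longrightarrow> E f \<le> E g"
    and w: "w \<in> H" "pairing m (J p w) (\<lambda>x. 1) = 0"
  shows "E f * N w \<le> E w"
proof (cases "N w = 0")
  case True
  then show ?thesis using E_nonneg by simp
next
  case False
  then have pos: "N w > 0" using Lp_pow_nonneg[of m p w] by linarith
  define c where "c = N w powr (- 1 / p)"
  have cp: "c powr p = 1 / N w" using pos p_pos unfolding c_def powr_powr by (simp add: powr_minus_divide)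
  have c0: "c \<ge> 0" by (simp add: c_def)
  have "J p (\<lambda>x. c * w x) = (\<lambda>x. spow p c * J p w x)" by (simp add: J_eq_spow spow_mult)
  then have "(\<lambda>x. c * w x) \<in> centered"
    unfolding centered_def using w pos c0 by (simp add: E_cmult(1) Lp_pow_cmult cp pairing_cmult_left)
  then have "E f \<le> E w / N w" using min[of "\<lambda>x. c * w x"] c0 by (simp add: E_cmult(2)[OF w(1)] cp)
  then show ?thesis using pos by (simp add: pos_le_divide_eq)
qed

lemma minimizer_eigenfunction:
  assumes f: "f \<in> centered" and min: "\<And>g. g \<in> centered \<Longrightarrow> E f \<le> E g"
  shows "eigenfunction m p (E f) f"
proof (rule eigenfunctionI)
  have f': "f \<in> H" "N f = 1" "pairing m (J p f) (\<lambda>x. 1) = 0" using f by (auto simp: centered_def)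
  note fL = H_L[OF f'(1)]
  show "(\<lambda>x. E f * J p f x) \<in> Ch_subdiff m p f"
    unfolding Ch_subdiff_iff
  proof (intro conjI ballI)
    fix g assume g: "g \<in> H"
    obtain c where c: "pairing m (J p (\<lambda>x. g x + c)) (\<lambda>x. 1) = 0" using ex_centering[OF H_L[OF g]] by blast
    define w where "w = (\<lambda>x. g x + c)"
    have w: "w \<in> H" "E w = E g" "pairing m (J p w) (\<lambda>x. 1) = 0" using E_add_const[OF g, of c] c by (auto simp: w_def)
    \<comment> \<open>The centring constant is invisible here because f itself is centred.\<close>
    have "pairing m (J p f) (\<lambda>x. w x - f x) = pairing m (J p f) (\<lambda>x. g x - f x)"
    proof -
      have "pairing m (J p f) (\<lambda>x. w x - f x) = pairing m (J p f) (\<lambda>x. (g x - f x) + c * 1)"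
        by (simp add: w_def algebra_simps)
      also have "\<dots> = pairing m (J p f) (\<lambda>x. g x - f x)"
        using pairing_scale_add[OF J_in_Lq[OF fL] L_diff[OF H_L[OF g] fL] Lp_const[of 1], of c] f'(3) by simp
      finally show ?thesis .
    qed
    then have "1 + p * pairing m (J p f) (\<lambda>x. g x - f x) \<le> N w"
      using N_above_tangent'[OF fL H_L[OF w(1)]] f'(2) by simp
    then have "E f * (1 + p * pairing m (J p f) (\<lambda>x. g x - f x)) \<le> E f * N w"
      by (intro mult_left_mono E_nonneg)
    also have "\<dots> \<le> E g" using minimizer_poincare[OF f min w(1,3)] w(2) by simp
    finally have "E f * (1 + p * pairing m (J p f) (\<lambda>x. g x - f x)) / p \<le> E g / p"
      using p_pos by (intro divide_right_mono) auto
    then show "E f / p + pairing m (\<lambda>x. E f * J p f x) (\<lambda>x. g x - f x) \<le> E g / p"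
      using p_pos by (simp add: pairing_cmult_left distrib_left add_divide_distrib)
  qed (intro Lp_cmult J_in_Lq fL f'(1))+
  show "N f \<noteq> 0" using f' by simp
qed

lemma lambda1_eq:
  assumes f: "f \<in> centered" and min: "\<And>g. g \<in> centered \<Longrightarrow> E f \<le> E g"
  shows "lambda1 m p = ereal (E f)"
proof (rule antisym)
  have f': "f \<in> H" "N f = 1" "pairing m (J p f) (\<lambda>x. 1) = 0" using f by (auto simp: centered_def)
  have "lambda1 m p \<le> ereal p * Ch m p f"
    unfolding lambda1_def using f' H_L
    by (intro Inf_lower) (auto simp: Lp_sphere_def nrm_eq_1_iff pairing_def)
  then show "lambda1 m p \<le> ereal (E f)" using p_pos by (simp add: Ch_eq_E[OF f'(1)])
  show "ereal (E f) \<le> lambda1 m p"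
    unfolding lambda1_def
  proof (rule Inf_greatest, clarify)
    fix g assume g: "g \<in> Lp_sphere m p" "(\<integral>x. J p g x \<partial>m) = 0"
    show "ereal (E f) \<le> ereal p * Ch m p g"
    proof (cases "g \<in> H")
      case True
      then have "g \<in> centered" using g by (auto simp: centered_def Lp_sphere_def nrm_eq_1_iff pairing_def)
      then show ?thesis using min p_pos by (simp add: Ch_eq_E[OF True])
    next
      case False
      then show ?thesis using p_pos by (simp add: H_iff_Ch)
    qed
  qed
qed

end

section \<open>Absolutely continuous functions on the line\<close>

definition small_family :: "real \<Rightarrow> real \<Rightarrow> real \<Rightarrow> nat \<Rightarrow> (nat \<Rightarrow> real) \<Rightarrow> (nat \<Rightarrow> real) \<Rightarrow> bool" where
  "small_family a b \<delta> n s t \<longleftrightarrow>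
     (\<forall>i<n. a \<le> s i \<and> s i \<le> t i \<and> t i \<le> b) \<and>
     disjoint_family_on (\<lambda>i. {s i<..<t i}) {..<n} \<and>
     (\<Sum>i<n. t i - s i) < \<delta>"

text \<open>Stated for a function of two times and not for a curve: this covers the L^q-valued curve
  J f and the real functions derived from it, and it passes on by domination.\<close>

definition ac_dist :: "real \<Rightarrow> real \<Rightarrow> (real \<Rightarrow> real \<Rightarrow> real) \<Rightarrow> bool" where
  "ac_dist a b d \<longleftrightarrow>
     (\<forall>\<epsilon>>0. \<exists>\<delta>>0. \<forall>n s t. small_family a b \<delta> n s t \<longrightarrow> (\<Sum>i<n. d (s i) (t i)) < \<epsilon>)"

lemma ac_distD:
  assumes "ac_dist a b d" "\<epsilon> > 0"
  obtains \<delta> where "\<delta> > 0" "\<And>n s t. small_family a b \<delta> n s t \<Longrightarrow> (\<Sum>i<n. d (s i) (t i)) < \<epsilon>"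
  using assms unfolding ac_dist_def by meson

lemma Lp_abs_cont_ac_dist:
  "Lp_abs_cont m q a b g \<Longrightarrow> ac_dist a b (\<lambda>s t. Lp_norm m q (\<lambda>x. g t x - g s x))"
  unfolding Lp_abs_cont_def ac_dist_def small_family_def by blast

lemma small_family_mono:
  "small_family a' b' \<delta>' n s t \<Longrightarrow> a \<le> a' \<Longrightarrow> b' \<le> b \<Longrightarrow> \<delta>' \<le> \<delta> \<Longrightarrow> small_family a b \<delta> n s t"
  unfolding small_family_def by force

lemma ac_dist_subinterval:
  assumes "ac_dist a b d" "a \<le> a'" "b' \<le> b"
  shows "ac_dist a' b' d"
  using assms small_family_mono[of a' b' _ _ _ _ a b, OF _ assms(2,3) order_refl] unfolding ac_dist_def by meson

text \<open>Serves for transferring absolute continuity from J f to derived quantities; the term in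
  t - s absorbs smooth weights and linear corrections.\<close>

lemma ac_dist_dominated:
  assumes d: "ac_dist a b d" and C: "C \<ge> 0"
    and le: "\<And>s t. a \<le> s \<Longrightarrow> s \<le> t \<Longrightarrow> t \<le> b \<Longrightarrow> d' s t \<le> C * d s t + C * (t - s)"
  shows "ac_dist a b d'"
  unfolding ac_dist_def
proof (intro allI impI)
  fix \<epsilon> :: real assume \<epsilon>: "\<epsilon> > 0"
  define \<eta> where "\<eta> = \<epsilon> / (2 * (C + 1))"
  have \<eta>: "\<eta> > 0" using \<epsilon> C by (simp add: \<eta>_def)
  have "C * \<eta> + C * \<eta> < 2 * (C + 1) * \<eta>" using \<eta> by (simp add: algebra_simps)
  also have "\<dots> = \<epsilon>" using C by (simp add: \<eta>_def)
  finally have \<eta>\<epsilon>: "C * \<eta> + C * \<eta> < \<epsilon>" .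
  obtain \<delta> where \<delta>: "\<delta> > 0" "\<And>n s t. small_family a b \<delta> n s t \<Longrightarrow> (\<Sum>i<n. d (s i) (t i)) < \<eta>"
    using ac_distD[OF d \<eta>] by blast
  have "(\<Sum>i<n. d' (s i) (t i)) < \<epsilon>" if st: "small_family a b (min \<delta> \<eta>) n s t" for n s t
  proof -
    have 1: "(\<Sum>i<n. d (s i) (t i)) < \<eta>" by (rule \<delta>(2)[OF small_family_mono[OF st]]) auto
    have 2: "(\<Sum>i<n. t i - s i) \<le> \<eta>" using st by (simp add: small_family_def)
    have "(\<Sum>i<n. d' (s i) (t i)) \<le> (\<Sum>i<n. C * d (s i) (t i) + C * (t i - s i))"
      using st by (intro sum_mono le) (auto simp: small_family_def)
    also have "\<dots> = C * (\<Sum>i<n. d (s i) (t i)) + C * (\<Sum>i<n. t i - s i)"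
      by (simp add: sum.distrib sum_distrib_left)
    also have "\<dots> \<le> C * \<eta> + C * \<eta>" using 1 2 C by (intro add_mono mult_left_mono) auto
    finally show ?thesis using \<eta>\<epsilon> by simp
  qed
  then show "\<exists>\<delta>>0. \<forall>n s t. small_family a b \<delta> n s t \<longrightarrow> (\<Sum>i<n. d' (s i) (t i)) < \<epsilon>"
    using \<delta>(1) \<eta> by (intro exI[of _ "min \<delta> \<eta>"]) auto
qed

text \<open>
  By Cousin's lemma \<open>[a, b]\<close> has a tagged division fine enough for the increments at good tags to
  be controlled by the derivative, while the intervals with a tag in the exceptional null set have
  small total length and are handled by absolute continuity.
\<close>

lemma ac_nonincreasing:
  fixes F :: "real \<Rightarrow> real"
  assumes ab: "a \<le> b" and ac: "ac_dist a b (\<lambda>s t. \<bar>F t - F s\<bar>)"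
    and der: "AE t in lborel. a < t \<and> t < b \<longrightarrow> (\<exists>D. (F has_real_derivative D) (at t) \<and> D \<le> 0)"
  shows "F b \<le> F a"
proof (rule field_le_epsilon)
  fix e0 :: real assume e0: "e0 > 0"
  \<comment> \<open>The good tags contribute e per unit length and the bad ones e in total.\<close>
  define e where "e = e0 / (b - a + 1)"
  have e: "e > 0" using e0 ab by (simp add: e_def)
  have ee0: "e * (b - a) + e = e0"
  proof -
    have "e * (b - a + 1) = e0" using ab by (simp add: e_def)
    then show ?thesis by (simp add: algebra_simps)
  qed
  obtain \<delta> where \<delta>: "\<delta> > 0" "\<And>n s t. small_family a b \<delta> n s t \<Longrightarrow> (\<Sum>i<n. \<bar>F (t i) - F (s i)\<bar>) < e"
    using ac_distD[OF ac e] by blast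
  obtain Z0 where Z0: "{t \<in> space lborel. \<not> (a < t \<and> t < b \<longrightarrow> (\<exists>D. (F has_real_derivative D) (at t) \<and> D \<le> 0))} \<subseteq> Z0"
    "emeasure lborel Z0 = 0" "Z0 \<in> sets lborel"
    by (rule AE_E[OF der])
  \<comment> \<open>The hypothesis gives no derivative at the end points, so they join the
    exceptional set.\<close>
  define Z where "Z = Z0 \<union> {a, b}"
  have Z: "Z \<in> sets borel" using Z0 by (simp add: Z_def)
  have Znull: "Z \<in> null_sets lborel"
    unfolding Z_def
  proof (rule null_sets.Un)
    show "Z0 \<in> null_sets lborel" using Z0 by (intro null_setsI) auto
    show "{a, b} \<in> null_sets lborel" by (intro finite_imp_null_set_lborel) simp
  qed
  \<comment> \<open>The gauge will confine every interval tagged in \<open>Z\<close> to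
    \<open>U\<close>, whose measure is below the threshold of absolute continuity.\<close>
  obtain U where U: "open U" "Z \<subseteq> U" "emeasure lborel (U - Z) < ennreal \<delta>"
    by (rule outer_regular_lborel[OF Z \<delta>(1)])
  have Umeas: "emeasure lborel U < ennreal \<delta>"
  proof -
    have "emeasure lborel U = emeasure lborel (U - Z)"
      using emeasure_Diff_null_set[OF Znull, of U] U(1) by simp
    then show ?thesis using U(3) by simp
  qed
  have good: "\<exists>r>0. \<forall>u v. u \<le> x \<and> x \<le> v \<and> {u..v} \<subseteq> ball x r \<longrightarrow> F v - F u \<le> e * (v - u)"
    if x: "x \<in> {a..b}" "x \<notin> Z" for x
  proof -
    have "a < x \<and> x < b" "x \<notin> Z0" using x by (auto simp: Z_def)
    moreover have "x \<in> space lborel" by simp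
    ultimately obtain D where D: "(F has_real_derivative D) (at x)" "D \<le> 0" using Z0(1) by blast
    then obtain r where r: "r > 0" "\<And>y. norm (y - x) < r \<Longrightarrow> norm (F y - F x - D * (y - x)) \<le> e * norm (y - x)"
      using e unfolding has_field_derivative_def has_derivative_at_alt by meson
    have "F v - F u \<le> e * (v - u)" if uv: "u \<le> x" "x \<le> v" "{u..v} \<subseteq> ball x r" for u v
    proof -
      have "u \<in> {u..v}" "v \<in> {u..v}" using uv by auto
      then have uin: "u \<in> ball x r" and vin: "v \<in> ball x r" using uv by blast+
      have "\<bar>F u - F x - D * (u - x)\<bar> \<le> e * \<bar>u - x\<bar>" using r(2)[of u] uin by (simp add: dist_real_def abs_minus_commute)
      moreover have "\<bar>F v - F x - D * (v - x)\<bar> \<le> e * \<bar>v - x\<bar>" using r(2)[of v] vin by (simp add: dist_real_def abs_minus_commute)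
      ultimately have "F v - F u \<le> e * \<bar>u - x\<bar> + e * \<bar>v - x\<bar> + (D * (v - x) - D * (u - x))" by linarith
      also have "D * (v - x) - D * (u - x) = D * (v - u)" by (simp add: algebra_simps)
      also have "D * (v - u) \<le> 0" using D uv by (intro mult_nonpos_nonneg) auto
      finally show ?thesis using uv by (simp add: algebra_simps)
    qed
    then show ?thesis using r(1) by blast
  qed
  then obtain R where R: "\<And>x. x \<in> {a..b} \<Longrightarrow> x \<notin> Z \<Longrightarrow> R x > 0"
    "\<And>x u v. x \<in> {a..b} \<Longrightarrow> x \<notin> Z \<Longrightarrow> u \<le> x \<Longrightarrow> x \<le> v \<Longrightarrow> {u..v} \<subseteq> ball x (R x) \<Longrightarrow> F v - F u \<le> e * (v - u)"
    by metis
  define g where "g x = (if x \<in> Z then U else if x \<in> {a..b} then ball x (R x) else ball x 1)" for x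
  have "gauge g"
    unfolding gauge_def g_def using U R(1) by auto
  then obtain P where P: "P tagged_division_of {a..b}" "g fine P"
    using fine_division_exists_real by blast
  have fin: "finite P" using P(1) by blast
  have K: "\<exists>u v. k = {u..v} \<and> u \<le> x \<and> x \<le> v \<and> a \<le> u \<and> v \<le> b \<and> x \<in> {a..b} \<and> {u..v} \<subseteq> g x" if xk: "(x, k) \<in> P" for x k
  proof -
    obtain u v where k: "k = {u..v}" using tagged_division_ofD(4)[OF P(1) xk] by auto
    have "x \<in> k" "k \<subseteq> {a..b}" using tagged_division_ofD(2,3)[OF P(1) xk] by auto
    moreover have "k \<subseteq> g x" using P(2) xk by (auto simp: fine_def)
    ultimately show ?thesis using k by (intro exI[of _ u] exI[of _ v]) auto
  qed
  have K': "a \<le> Inf k \<and> Inf k \<le> x \<and> x \<le> Sup k \<and> Sup k \<le> b \<and> x \<in> {a..b} \<and> k = {Inf k..Sup k} \<and> k \<subseteq> g x"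
    if xk: "(x, k) \<in> P" for x k
  proof -
    obtain u v where *: "k = {u..v}" "u \<le> x" "x \<le> v" "a \<le> u" "v \<le> b" "x \<in> {a..b}" "{u..v} \<subseteq> g x"
      using K[OF xk] by blast
    then have "Inf k = u" "Sup k = v" by auto
    then show ?thesis using * by simp
  qed
  define P1 where "P1 = {z \<in> P. fst z \<in> Z}"
  have fin1: "finite P1" using fin by (simp add: P1_def)
  have P1_small: "(\<Sum>(x,k)\<in>P1. \<bar>F (Sup k) - F (Inf k)\<bar>) < e"
  proof -
    \<comment> \<open>Absolute continuity speaks of families indexed by natural numbers, so the
      badly tagged intervals are enumerated.\<close>
    obtain h where h: "bij_betw h {0..<card P1} P1" using ex_bij_betw_nat_finite[OF fin1] by blast
    define n where "n = card P1"
    have h': "bij_betw h {..<n} P1" using h by (simp add: n_def lessThan_atLeast0)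
    define s t where "s i = Inf (snd (h i))" and "t i = Sup (snd (h i))" for i
    have hi: "(fst (h i), snd (h i)) \<in> P" "fst (h i) \<in> Z" if "i < n" for i
      using bij_betwE[OF h'] that by (auto simp: P1_def)
    have st: "a \<le> s i \<and> s i \<le> t i \<and> t i \<le> b" if "i < n" for i
      using K'[OF hi(1)[OF that]] by (auto simp: s_def t_def)
    have intr: "interior (snd (h i)) = {s i<..<t i}" if "i < n" for i
      using K'[OF hi(1)[OF that]] unfolding s_def t_def by (metis interior_atLeastAtMost_real)
    have disj: "disjoint_family_on (\<lambda>i. {s i<..<t i}) {..<n}"
      unfolding disjoint_family_on_def
    proof (intro ballI impI)
      fix i j assume ij: "i \<in> {..<n}" "j \<in> {..<n}" "i \<noteq> j"
      then have "h i \<noteq> h j" using h' by (auto simp: bij_betw_def inj_on_def)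
      then have "interior (snd (h i)) \<inter> interior (snd (h j)) = {}"
        using tagged_division_ofD(5)[OF P(1) hi(1) hi(1), of i j] ij by (auto simp: prod_eq_iff)
      then show "{s i<..<t i} \<inter> {s j<..<t j} = {}" using intr ij by simp
    qed
    have "ennreal (\<Sum>i<n. t i - s i) = (\<Sum>i<n. ennreal (t i - s i))"
      using st by (intro sum_ennreal[symmetric]) auto
    also have "\<dots> = (\<Sum>i<n. emeasure lborel {s i<..<t i})" using st by (intro sum.cong) auto
    also have "\<dots> = emeasure lborel (\<Union>i<n. {s i<..<t i})"
      using disj by (intro sum_emeasure) auto
    also have "\<dots> \<le> emeasure lborel U"
    proof (rule emeasure_mono)
      show "(\<Union>i<n. {s i<..<t i}) \<subseteq> U"
      proof
        fix y assume "y \<in> (\<Union>i<n. {s i<..<t i})"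
        then obtain i where i: "i < n" "y \<in> {s i<..<t i}" by auto
        then have "y \<in> snd (h i)" using intr interior_subset by blast
        then show "y \<in> U" using K'[OF hi(1)[OF i(1)]] hi(2)[OF i(1)] by (auto simp: g_def)
      qed
    qed (use U in simp)
    also have "\<dots> < ennreal \<delta>" by (rule Umeas)
    finally have "ennreal (\<Sum>i<n. t i - s i) < ennreal \<delta>" .
    moreover have "0 \<le> (\<Sum>i<n. t i - s i)" using st by (intro sum_nonneg) auto
    ultimately have "(\<Sum>i<n. t i - s i) < \<delta>" by (simp add: ennreal_less_iff)
    then have "(\<Sum>i<n. \<bar>F (t i) - F (s i)\<bar>) < e" using st disj by (intro \<delta>(2)) (simp add: small_family_def)
    moreover have "(\<Sum>(x,k)\<in>P1. \<bar>F (Sup k) - F (Inf k)\<bar>) = (\<Sum>i<n. \<bar>F (t i) - F (s i)\<bar>)"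
      unfolding s_def t_def by (subst sum.reindex_bij_betw[OF h', symmetric]) (simp add: case_prod_beta)
    ultimately show ?thesis by simp
  qed
  have "F b - F a = (\<Sum>(x,k)\<in>P. F (Sup k) - F (Inf k))"
    using additive_tagged_division_1[OF ab P(1), of F] by simp
  also have "\<dots> \<le> (\<Sum>(x,k)\<in>P. (if x \<in> Z then \<bar>F (Sup k) - F (Inf k)\<bar> else 0) + e * (Sup k - Inf k))"
  proof (rule sum_mono, clarify)
    fix x k assume xk: "(x, k) \<in> P"
    note k = K'[OF xk]
    have 0: "0 \<le> e * (Sup k - Inf k)" using k e by (intro mult_nonneg_nonneg) linarith+
    show "F (Sup k) - F (Inf k) \<le> (if x \<in> Z then \<bar>F (Sup k) - F (Inf k)\<bar> else 0) + e * (Sup k - Inf k)"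
    proof (cases "x \<in> Z")
      case True then show ?thesis using 0 by simp
    next
      case False
      then have "F (Sup k) - F (Inf k) \<le> e * (Sup k - Inf k)"
        using k by (intro R(2)[of x]) (auto simp: g_def)
      then show ?thesis using False by simp
    qed
  qed
  also have "\<dots> = (\<Sum>(x,k)\<in>P. if x \<in> Z then \<bar>F (Sup k) - F (Inf k)\<bar> else 0) + e * (\<Sum>(x,k)\<in>P. Sup k - Inf k)"
    by (simp add: sum.distrib sum_distrib_left case_prod_beta)
  also have "(\<Sum>(x,k)\<in>P. Sup k - Inf k) = b - a"
    using additive_tagged_division_1[OF ab P(1), of "\<lambda>x. x"] by simp
  also have "(\<Sum>(x,k)\<in>P. if x \<in> Z then \<bar>F (Sup k) - F (Inf k)\<bar> else 0) = (\<Sum>(x,k)\<in>P1. \<bar>F (Sup k) - F (Inf k)\<bar>)"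
    unfolding P1_def using fin by (simp add: sum.inter_filter case_prod_beta)
  finally have "F b - F a \<le> e + e * (b - a)" using P1_small by linarith
  then show "F b \<le> F a + e0" using ee0 by linarith
qed

text \<open>\<open>G\<close> carries the usual integrating factor. That factor is at most 1 on the
  interval, so subtracting e (t - a) compensates the inhomogeneous term; the bound B makes the
  product with the factor absolutely continuous.\<close>

lemma ac_gronwall:
  fixes F :: "real \<Rightarrow> real"
  assumes ab: "a \<le> b" and ac: "ac_dist a b (\<lambda>s t. \<bar>F t - F s\<bar>)"
    and bd: "\<And>t. t \<in> {a..b} \<Longrightarrow> \<bar>F t\<bar> \<le> B" and K: "0 \<le> K" and e: "0 \<le> e"
    and der: "AE t in lborel. a < t \<and> t < b \<longrightarrow> (\<exists>D. (F has_real_derivative D) (at t) \<and> D \<le> K * F t + e)"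
  shows "F b \<le> exp (K * (b - a)) * (F a + e * (b - a))"
proof -
  define G where "G t = exp (- (K * (t - a))) * F t - e * (t - a)" for t
  have B: "B \<ge> 0" using bd[of a] ab by (auto intro: order_trans[OF abs_ge_zero])
  have "G b \<le> G a"
  proof (rule ac_nonincreasing[OF ab])
    show "ac_dist a b (\<lambda>s t. \<bar>G t - G s\<bar>)"
    proof (rule ac_dist_dominated[OF ac])
      fix s t assume st: "a \<le> s" "s \<le> t" "t \<le> b"
      have "exp (- (K * (t - a))) = exp (- (K * (s - a))) * exp (- (K * (t - s)))"
        by (simp add: algebra_simps flip: exp_add)
      then have "exp (- (K * (s - a))) - exp (- (K * (t - a))) = exp (- (K * (s - a))) * (1 - exp (- (K * (t - s))))"
        by (simp add: algebra_simps)
      also have "\<dots> \<le> 1 * (K * (t - s))"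
      proof (rule mult_mono)
        show "exp (- (K * (s - a))) \<le> 1" using K st by simp
        show "1 - exp (- (K * (t - s))) \<le> K * (t - s)" using exp_ge_add_one_self[of "- (K * (t - s))"] by simp
        show "0 \<le> 1 - exp (- (K * (t - s)))" using K st by simp
      qed simp
      finally have x1: "exp (- (K * (s - a))) - exp (- (K * (t - a))) \<le> K * (t - s)" by simp
      have x2: "exp (- (K * (t - a))) \<le> exp (- (K * (s - a)))" using K st by (simp add: mult_left_mono)
      have "G t - G s = exp (- (K * (t - a))) * (F t - F s) + (exp (- (K * (t - a))) - exp (- (K * (s - a)))) * F s - e * (t - s)"
        by (simp add: G_def algebra_simps)
      also have "\<bar>\<dots>\<bar> \<le> \<bar>exp (- (K * (t - a))) * (F t - F s)\<bar> + \<bar>(exp (- (K * (t - a))) - exp (- (K * (s - a)))) * F s\<bar> + \<bar>e * (t - s)\<bar>"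
        by linarith
      also have "\<dots> \<le> 1 * \<bar>F t - F s\<bar> + K * (t - s) * B + e * (t - s)"
      proof (intro add_mono)
        show "\<bar>exp (- (K * (t - a))) * (F t - F s)\<bar> \<le> 1 * \<bar>F t - F s\<bar>"
          unfolding abs_mult using K st ab by (intro mult_right_mono) auto
        show "\<bar>(exp (- (K * (t - a))) - exp (- (K * (s - a)))) * F s\<bar> \<le> K * (t - s) * B"
          unfolding abs_mult using x1 x2 bd[of s] st K by (intro mult_mono) auto
      qed (use e st in simp)
      also have "\<dots> \<le> (1 + K * B + e) * \<bar>F t - F s\<bar> + (1 + K * B + e) * (t - s)"
      proof -
        have "0 \<le> (K * B + e) * \<bar>F t - F s\<bar>" "0 \<le> t - s" using K B e st by auto
        then show ?thesis by (simp add: algebra_simps)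
      qed
      finally show "\<bar>G t - G s\<bar> \<le> (1 + K * B + e) * \<bar>F t - F s\<bar> + (1 + K * B + e) * (t - s)" .
    qed (use K B e in simp)
    show "AE t in lborel. a < t \<and> t < b \<longrightarrow> (\<exists>D. (G has_real_derivative D) (at t) \<and> D \<le> 0)"
      using der
    proof eventually_elim
      case (elim t)
      show ?case
      proof
        assume t: "a < t \<and> t < b"
        then obtain D where D: "(F has_real_derivative D) (at t)" "D \<le> K * F t + e" using elim by blast
        have der: "(G has_real_derivative (exp (- (K * (t - a))) * (D - K * F t) - e)) (at t)"
          unfolding G_def by (auto intro!: derivative_eq_intros D(1) simp: algebra_simps)
        have "exp (- (K * (t - a))) * (D - K * F t) \<le> exp (- (K * (t - a))) * e"
          using D(2) by (intro mult_left_mono) auto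
        moreover have "exp (- (K * (t - a))) * e \<le> 1 * e" using K t e by (intro mult_right_mono) auto
        ultimately have "exp (- (K * (t - a))) * (D - K * F t) - e \<le> 0" by linarith
        with der show "\<exists>D. (G has_real_derivative D) (at t) \<and> D \<le> 0" by blast
      qed
    qed
  qed
  then have "exp (- (K * (b - a))) * F b \<le> F a + e * (b - a)" by (simp add: G_def)
  then have "exp (K * (b - a)) * (exp (- (K * (b - a))) * F b) \<le> exp (K * (b - a)) * (F a + e * (b - a))"
    by (intro mult_left_mono) auto
  moreover have "exp (K * (b - a)) * (exp (- (K * (b - a))) * F b) = F b"
    by (simp add: exp_minus flip: mult.assoc)
  ultimately show ?thesis by simp
qed

lemma ac_mean_value:
  fixes F :: "real \<Rightarrow> real"
  assumes ab: "a \<le> b" and ac: "ac_dist a b (\<lambda>s t. \<bar>F t - F s\<bar>)"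
    and der: "AE t in lborel. a < t \<and> t < b \<longrightarrow> (\<exists>D. (F has_real_derivative D) (at t) \<and> D \<le> c)"
  shows "F b - F a \<le> c * (b - a)"
proof -
  have "F b - c * b \<le> F a - c * a"
  proof (rule ac_nonincreasing[OF ab, where F = "\<lambda>t. F t - c * t"])
    show "ac_dist a b (\<lambda>s t. \<bar>(F t - c * t) - (F s - c * s)\<bar>)"
    proof (rule ac_dist_dominated[OF ac, of "1 + \<bar>c\<bar>"])
      fix s t assume st: "a \<le> s" "s \<le> t" "t \<le> b"
      have "(F t - c * t) - (F s - c * s) = (F t - F s) - c * (t - s)" by (simp add: algebra_simps)
      also have "\<bar>\<dots>\<bar> \<le> \<bar>F t - F s\<bar> + \<bar>c\<bar> * (t - s)"
        using st abs_triangle_ineq4[of "F t - F s" "c * (t - s)"] by (simp add: abs_mult)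
      also have "\<dots> \<le> (1 + \<bar>c\<bar>) * \<bar>F t - F s\<bar> + (1 + \<bar>c\<bar>) * (t - s)"
      proof -
        have "0 \<le> \<bar>c\<bar> * \<bar>F t - F s\<bar>" by simp
        with st show ?thesis by (simp add: distrib_right)
      qed
      finally show "\<bar>(F t - c * t) - (F s - c * s)\<bar> \<le> (1 + \<bar>c\<bar>) * \<bar>F t - F s\<bar> + (1 + \<bar>c\<bar>) * (t - s)" .
    qed simp
    show "AE t in lborel. a < t \<and> t < b \<longrightarrow> (\<exists>D. ((\<lambda>t. F t - c * t) has_real_derivative D) (at t) \<and> D \<le> 0)"
      using der
    proof eventually_elim
      case (elim t)
      show ?case
      proof
        assume "a < t \<and> t < b"
        then obtain D where "(F has_real_derivative D) (at t)" "D \<le> c" using elim by blast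
        then show "\<exists>D. ((\<lambda>t. F t - c * t) has_real_derivative D) (at t) \<and> D \<le> 0"
          by (intro exI[of _ "D - c"]) (auto intro!: derivative_eq_intros)
      qed
    qed
  qed
  then show ?thesis by (simp add: algebra_simps)
qed

section \<open>Mirror flows\<close>

lemma AE_lborel_ex_between:
  fixes a b :: real
  assumes "AE s in lborel. P s" "a < b"
  shows "\<exists>s. a < s \<and> s < b \<and> P s"
proof (rule ccontr)
  assume no: "\<not> ?thesis"
  obtain Z where Z: "{s \<in> space lborel. \<not> P s} \<subseteq> Z" "emeasure lborel Z = 0" "Z \<in> sets lborel"
    by (rule AE_E[OF assms(1)])
  have "{a<..<b} \<subseteq> {s \<in> space lborel. \<not> P s}" using no by auto
  then have "emeasure lborel {a<..<b} \<le> emeasure lborel Z" using Z by (intro emeasure_mono) auto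
  then show False using Z(2) assms(2) by simp
qed

locale mirror_setting = cheeger m p for m :: "('a::metric_space) measure" and p +
  fixes f0 :: "'a \<Rightarrow> real" and f :: "real \<Rightarrow> 'a \<Rightarrow> real" and M :: real
  assumes f0_centered: "f0 \<in> centered"
    and M_eq: "M = E f0 + p"
    and flow: "mirror_flow m p (Phi m p M) f0 f"
begin

section \<open>Admissible functions and subgradients of the functional\<close>

abbreviation "K \<equiv> M + 1"

definition adm :: "('a \<Rightarrow> real) set" where
  "adm = {g \<in> H. N g \<le> 1 \<and> E g \<le> M}"

definition \<phi> :: "('a \<Rightarrow> real) \<Rightarrow> real" where
  "\<phi> g = E g / p - K * N g / p"

lemma M_pos: "M > 0" and E_f0_less_M: "E f0 < M"
  using M_eq p_pos E_nonneg[of f0] by auto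

lemma adm_H: "g \<in> adm \<Longrightarrow> g \<in> H" and adm_L: "g \<in> adm \<Longrightarrow> g \<in> L"
  using H_L by (auto simp: adm_def)

lemma adm_nrm: "g \<in> adm \<Longrightarrow> nrm g \<le> 1"
  by (simp add: adm_def nrm_le_1_iff)

lemma Phi_eq: "Phi m p M g = (if g \<in> adm then ereal (\<phi> g) else \<infinity>)"
proof (cases "g \<in> H")
  case True
  have "E g / p \<le> M / p \<longleftrightarrow> E g \<le> M" using p_pos by (simp add: divide_le_cancel)
  then show ?thesis
    using True by (simp add: Phi_def adm_def \<phi>_def Ch_eq_E nrm_le_1_iff Psi_def nrm_powr)
next
  case False
  then show ?thesis by (simp add: Phi_def adm_def H_iff_Ch)
qed

lemma adm_convex:
  assumes "g \<in> adm" "h \<in> adm" "0 \<le> s" "s \<le> 1"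
  shows "(\<lambda>x. (1 - s) * g x + s * h x) \<in> adm"
proof -
  have "N (\<lambda>x. (1 - s) * g x + s * h x) \<le> (1 - s) * N g + s * N h"
    using assms adm_L by (intro Lp_pow_convex p_ge_1) auto
  also have "\<dots> \<le> (1 - s) * 1 + s * 1" using assms by (intro add_mono mult_left_mono) (auto simp: adm_def)
  finally have 1: "N (\<lambda>x. (1 - s) * g x + s * h x) \<le> 1" by simp
  have 2: "(\<lambda>x. (1 - s) * g x + s * h x) \<in> H"
    and "E (\<lambda>x. (1 - s) * g x + s * h x) \<le> (1 - s) * E g + s * E h"
    using E_convex[of g h s] assms adm_H by auto
  note this(2)
  also have "\<dots> \<le> (1 - s) * M + s * M" using assms by (intro add_mono mult_left_mono) (auto simp: adm_def)
  finally show ?thesis using 1 2 by (simp add: adm_def algebra_simps)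
qed

text \<open>On the segment from g to h the Frechet condition bounds \<open>\<phi>\<close> from below
  to first order, while convexity of E and of N bounds it from above by a linear function of the
  step. Dividing by the step turns the local condition into a global inequality.\<close>

lemma Frechet_subdiffD:
  assumes xi: "\<xi> \<in> Frechet_subdiff m p (Phi m p M) g"
  shows "\<xi> \<in> Lq" "g \<in> adm"
    and "h \<in> adm \<Longrightarrow> E g / p + pairing m (\<lambda>x. \<xi> x + K * J p g x) (\<lambda>x. h x - g x) \<le> E h / p"
proof -
  show xiL: "\<xi> \<in> Lq" using xi by (simp add: Frechet_subdiff_def)
  have "Phi m p M g < \<infinity>" using xi by (simp add: Frechet_subdiff_def)
  then show g: "g \<in> adm" by (simp add: Phi_eq split: if_splits)
  note gL = adm_L[OF g] and gH = adm_H[OF g]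
  have \<eta>: "(\<lambda>x. \<xi> x + K * J p g x) \<in> Lq" by (intro Lq_add Lp_cmult J_in_Lq xiL gL)
  assume h: "h \<in> adm"
  note hL = adm_L[OF h] and hH = adm_H[OF h]
  define v where "v = (\<lambda>x. h x - g x)"
  have v: "v \<in> L" unfolding v_def by (intro L_diff hL gL)
  show "E g / p + pairing m (\<lambda>x. \<xi> x + K * J p g x) (\<lambda>x. h x - g x) \<le> E h / p"
  proof (cases "nrm v = 0")
    \<comment> \<open>Punctured neighbourhoods say nothing about an h that agrees with g almost
      everywhere.\<close>
    case True
    then have "AE x in m. v x = 0" using Lp_norm_eq_0_iff[OF v p_pos] by simp
    then have "AE x in m. g x = h x" by eventually_elim (simp add: v_def)
    then have "E h = E g" by (rule E_cong_AE(2)[OF gH hL])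
    moreover have "\<bar>pairing m (\<lambda>x. \<xi> x + K * J p g x) v\<bar> \<le> 0" using pairing_bound[OF \<eta> v] True by simp
    ultimately show ?thesis by (simp add: v_def)
  next
    case False
    then have npos: "nrm v > 0" using Lp_norm_nonneg[of m p v] by linarith
    define Q where "Q g' = (Phi m p M g' - Phi m p M g - ereal (pairing m \<xi> (\<lambda>x. g' x - g x)))
                    / ereal (nrm (\<lambda>x. g' x - g x))" for g'
    have "0 \<le> Liminf (Lp_at m p g) Q" using xi by (simp add: Frechet_subdiff_def Q_def[abs_def])
    then have ev: "eventually (\<lambda>g'. ereal (- e) < Q g') (Lp_at m p g)" if "e > 0" for e
      unfolding le_Liminf_iff using that by auto
    have main: "pairing m (\<lambda>x. \<xi> x + K * J p g x) v \<le> (E h - E g) / p + e" if e: "e > 0" for e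
    proof -
      define d where "d = e / nrm v"
      have d: "d > 0" using e npos by (simp add: d_def)
      have "\<exists>r\<in>{0<..}. eventually (\<lambda>g'. ereal (- d) < Q g')
          (principal {g' \<in> L. 0 < nrm (\<lambda>x. g' x - g x) \<and> nrm (\<lambda>x. g' x - g x) < r})"
      proof (rule eventually_INF_base[THEN iffD1])
        show "eventually (\<lambda>g'. ereal (- d) < Q g') (INF r\<in>{0<..}. principal {g' \<in> L.
            0 < nrm (\<lambda>x. g' x - g x) \<and> nrm (\<lambda>x. g' x - g x) < r})"
          using ev[OF d] by (simp add: Lp_at_def)
        fix a b :: real assume "a \<in> {0<..}" "b \<in> {0<..}"
        then show "\<exists>x\<in>{0<..}. principal {g' \<in> L. 0 < nrm (\<lambda>x. g' x - g x) \<and> nrm (\<lambda>x. g' x - g x) < x}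
           \<le> inf (principal {g' \<in> L. 0 < nrm (\<lambda>x. g' x - g x) \<and> nrm (\<lambda>x. g' x - g x) < a})
                (principal {g' \<in> L. 0 < nrm (\<lambda>x. g' x - g x) \<and> nrm (\<lambda>x. g' x - g x) < b})"
          by (intro bexI[of _ "min a b"]) auto
      qed auto
      then obtain r where r: "r > 0"
        "\<And>g'. g' \<in> L \<Longrightarrow> 0 < nrm (\<lambda>x. g' x - g x) \<Longrightarrow> nrm (\<lambda>x. g' x - g x) < r \<Longrightarrow> ereal (- d) < Q g'"
        by (auto simp: eventually_principal)
      define s where "s = min 1 (r / (2 * nrm v))"
      have s: "0 < s" "s \<le> 1" using r npos by (auto simp: s_def)
      have "s * nrm v \<le> r / (2 * nrm v) * nrm v" using npos by (intro mult_right_mono) (auto simp: s_def)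
      also have "\<dots> < r" using npos r by simp
      finally have sr: "s * nrm v < r" .
      define w where "w = (\<lambda>x. (1 - s) * g x + s * h x)"
      have w: "w \<in> adm" unfolding w_def using g h s by (intro adm_convex) auto
      have wg: "(\<lambda>x. w x - g x) = (\<lambda>x. s * v x)" by (auto simp: w_def v_def algebra_simps)
      have nw: "nrm (\<lambda>x. w x - g x) = s * nrm v" unfolding wg nrm_cmult using s by simp
      have "ereal (- d) < Q w" using r(2)[OF adm_L[OF w]] nw s npos sr by simp
      also have "Q w = ereal ((\<phi> w - \<phi> g - s * pairing m \<xi> v) / (s * nrm v))"
        using w g s npos by (simp add: Q_def Phi_eq nw) (simp add: wg pairing_cmult)
      finally have "- d * (s * nrm v) < \<phi> w - \<phi> g - s * pairing m \<xi> v"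
        using s npos by (simp add: pos_less_divide_eq)
      then have 1: "- (s * e) < \<phi> w - \<phi> g - s * pairing m \<xi> v" using npos by (simp add: d_def mult.commute)
      have 2: "E w \<le> (1 - s) * E g + s * E h" using E_convex[OF gH hH, of s] s by (simp add: w_def)
      \<comment> \<open>Concavity of -K Psi acts in the right direction: it lies below its tangent
        at g.\<close>
      have "N g + p * (s * pairing m (J p g) v) \<le> N w"
        using N_above_tangent'[OF gL adm_L[OF w]] by (simp add: wg pairing_cmult)
      then have "K * (N g + p * (s * pairing m (J p g) v)) \<le> K * N w"
        using M_pos by (intro mult_left_mono) auto
      with 2 have "(E w - K * N w) / p \<le> ((1 - s) * E g + s * E h - K * (N g + p * (s * pairing m (J p g) v))) / p"
        using p_pos by (intro divide_right_mono) linarith+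
      also have "\<dots> = (E g - K * N g) / p + s * ((E h - E g) / p - K * pairing m (J p g) v)"
        using p_pos by (simp add: field_simps)
      finally have "\<phi> w - \<phi> g \<le> s * ((E h - E g) / p - K * pairing m (J p g) v)"
        by (simp add: \<phi>_def diff_divide_distrib)
      with 1 have "s * (pairing m \<xi> v + K * pairing m (J p g) v) \<le> s * ((E h - E g) / p + e)"
        by (simp add: algebra_simps)
      then have "pairing m \<xi> v + K * pairing m (J p g) v \<le> (E h - E g) / p + e"
        using s by (simp add: mult_le_cancel_left_pos)
      then show ?thesis
        using pairing_add_left[OF xiL Lp_cmult[OF J_in_Lq[OF gL]] v, of K] by (simp add: pairing_cmult_left)
    qed
    have "pairing m (\<lambda>x. \<xi> x + K * J p g x) v \<le> (E h - E g) / p"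
      by (rule field_le_epsilon[OF main])
    then show ?thesis by (simp add: v_def diff_divide_distrib)
  qed
qed

section \<open>Continuity and differentiability along the flow\<close>

definition good :: "real \<Rightarrow> ('a \<Rightarrow> real) \<Rightarrow> bool" where
  "good t \<xi> \<longleftrightarrow> 0 < t \<and> \<xi> \<in> Frechet_subdiff m p (Phi m p M) (f t) \<and>
     Lp_has_derivative m q (\<lambda>s. J p (f s)) (\<lambda>x. - \<xi> x) t"

lemma AE_good: "AE t in lborel. 0 < t \<longrightarrow> (\<exists>\<xi>. good t \<xi>)"
proof -
  have "AE t in lborel. t > 0 \<longrightarrow> (\<exists>\<xi> \<in> Frechet_subdiff m p (Phi m p M) (f t).
           Lp_has_derivative m q (\<lambda>s. J p (f s)) (\<lambda>x. - \<xi> x) t)"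
    using flow by (simp add: mirror_flow_def)
  then show ?thesis by eventually_elim (auto simp: good_def)
qed

lemma f_L: "0 \<le> t \<Longrightarrow> f t \<in> L"
  using flow by (simp add: mirror_flow_def)

lemma J_f_ac:
  assumes "0 \<le> a"
  shows "ac_dist a b (\<lambda>s t. Lp_norm m q (\<lambda>x. J p (f t) x - J p (f s) x))"
proof -
  have "Lp_abs_cont m q 0 (max b 1) (\<lambda>t. J p (f t))" using flow by (simp add: mirror_flow_def)
  then show ?thesis by (intro ac_dist_subinterval[OF Lp_abs_cont_ac_dist]) (use assms in auto)
qed

text \<open>Absolute continuity of J f, used for a single interval, gives continuity of J f in L^q,
  and \<open>Breg_symm_le\<close> pulls it back to f.\<close>

lemma f_continuous:
  assumes t: "0 \<le> t" and e: "e > 0"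
  shows "\<exists>\<delta>>0. \<forall>s\<ge>0. \<bar>s - t\<bar> < \<delta> \<longrightarrow> nrm (\<lambda>x. f s x - f t x) < e"
proof -
  define c where "c = 2 * 2 powr (1 - p) / p"
  have c: "c > 0" using p_pos by (simp add: c_def)
  have ce: "c * e powr (p - 1) > 0" using c e by simp
  obtain \<delta> where \<delta>: "\<delta> > 0" "\<And>n s' t'. small_family 0 (t + 1) \<delta> n s' t' \<Longrightarrow>
      (\<Sum>i<n. Lp_norm m q (\<lambda>x. J p (f (t' i)) x - J p (f (s' i)) x)) < c * e powr (p - 1)"
    using ac_distD[OF J_f_ac[of 0 "t + 1"] ce] by blast
  have small: "Lp_norm m q (\<lambda>x. J p (f b) x - J p (f a) x) < c * e powr (p - 1)"
    if "0 \<le> a" "a \<le> b" "b \<le> t + 1" "b - a < \<delta>" for a b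
    using \<delta>(2)[of 1 "\<lambda>_. a" "\<lambda>_. b"] that by (simp add: small_family_def disjoint_family_on_def)
  have lt: "nrm (\<lambda>x. f s x - f t x) < e" if s: "s \<ge> 0" "\<bar>s - t\<bar> < min \<delta> 1" for s
  proof -
    have "Lp_norm m q (\<lambda>x. J p (f s) x - J p (f t) x) < c * e powr (p - 1)"
    proof (cases "s \<le> t")
      case True
      then have "Lp_norm m q (\<lambda>x. J p (f t) x - J p (f s) x) < c * e powr (p - 1)"
        using small[of s t] s by auto
      then show ?thesis by (subst Lp_norm_minus_commute)
    next
      case False
      then show ?thesis using small[of t s] s t by auto
    qed
    then have "c * nrm (\<lambda>x. f s x - f t x) powr (p - 1) < c * e powr (p - 1)"
      using Breg_symm_le[OF f_L[OF t] f_L[OF s(1)]] by (simp add: c_def)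
    then have "nrm (\<lambda>x. f s x - f t x) powr (p - 1) < e powr (p - 1)" using c by simp
    then show ?thesis using p_gt_1 e powr_mono2[of "p - 1" e "nrm (\<lambda>x. f s x - f t x)"] by (meson less_imp_le not_le diff_ge_0_iff_ge)
  qed
  show ?thesis
  proof (intro exI conjI allI impI)
    show "0 < min \<delta> 1" using \<delta>(1) by simp
  qed (use lt in auto)
qed

lemma Lp_conv_f:
  assumes t: "0 \<le> t" and g: "(g \<longlongrightarrow> t) F" "eventually (\<lambda>n. 0 \<le> g n) F"
  shows "Lp_conv m p (\<lambda>n. f (g n)) (f t) F"
  unfolding Lp_conv_def
proof (rule tendstoI)
  fix e :: real assume "e > 0"
  then obtain \<delta> where \<delta>: "\<delta> > 0" "\<And>s. s \<ge> 0 \<Longrightarrow> \<bar>s - t\<bar> < \<delta> \<Longrightarrow> nrm (\<lambda>x. f s x - f t x) < e"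
    using f_continuous[OF t] by blast
  have "eventually (\<lambda>n. dist (g n) t < \<delta>) F" using g(1) \<delta>(1) by (rule tendstoD)
  with g(2) show "eventually (\<lambda>n. dist (nrm (\<lambda>x. f (g n) x - f t x)) 0 < e) F"
    by eventually_elim (use \<delta>(2) in \<open>simp add: dist_real_def\<close>)
qed

text \<open>At almost every time the subdifferential is nonempty, which forces admissibility. Such
  times approach any t from the right, t = 0 included, and the admissible set is closed.\<close>

lemma f_adm:
  assumes t: "0 \<le> t"
  shows "f t \<in> adm"
proof -
  have "\<exists>s. t < s \<and> s < t + 1 / Suc n \<and> f s \<in> adm" for n
  proof -
    have "\<exists>s. t < s \<and> s < t + 1 / Suc n \<and> (0 < s \<longrightarrow> (\<exists>\<xi>. good s \<xi>))"
      by (rule AE_lborel_ex_between[OF AE_good]) simp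
    then obtain s where s: "t < s" "s < t + 1 / Suc n" "0 < s \<longrightarrow> (\<exists>\<xi>. good s \<xi>)" by blast
    then obtain \<xi> where "good s \<xi>" using t by auto
    then have "f s \<in> adm" unfolding good_def using Frechet_subdiffD(2) by blast
    then show ?thesis using s by blast
  qed
  then obtain s where s: "\<And>n. t < s n" "\<And>n. s n < t + 1 / Suc n" "\<And>n. f (s n) \<in> adm" by metis
  have "(\<lambda>n. t + inverse (real (Suc n))) \<longlonglongrightarrow> t + 0" by (intro tendsto_intros LIMSEQ_inverse_real_of_nat)
  then have "s \<longlonglongrightarrow> t"
    by (intro tendsto_sandwich[OF _ _ tendsto_const, of t s _ "\<lambda>n. t + inverse (real (Suc n))"] always_eventually)
      (use s in \<open>auto simp: inverse_eq_divide intro!: less_imp_le\<close>)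
  moreover have "0 \<le> s n" for n using s(1)[of n] t by linarith
  ultimately have conv: "Lp_conv m p (\<lambda>n. f (s n)) (f t) sequentially" by (intro Lp_conv_f t) auto
  have "f t \<in> H" "E (f t) \<le> M"
    using E_lsc[OF trivial_limit_sequentially f_L[OF t] conv, of M] s(3) by (auto simp: adm_def)
  moreover have "(\<lambda>n. N (f (s n))) \<longlonglongrightarrow> N (f t)"
    by (rule N_tendsto[OF _ f_L[OF t] conv]) (use s(3) adm_L in simp)
  then have "N (f t) \<le> 1" by (rule LIMSEQ_le_const2) (use s(3) in \<open>auto simp: adm_def\<close>)
  ultimately show ?thesis by (simp add: adm_def)
qed

lemma J_f_Lq: "0 \<le> t \<Longrightarrow> J p (f t) \<in> Lq"
  using J_in_Lq f_L by blast

lemma J_f_norm_le: "0 \<le> t \<Longrightarrow> Lp_norm m q (J p (f t)) \<le> 1"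
  using adm_nrm[OF f_adm] p_gt_1 powr_mono2[of "p - 1" "nrm (f t)" 1] by (simp add: Lp_norm_J)

lemma has_derivative_pairing:
  assumes t: "0 < t" and der: "Lp_has_derivative m q (\<lambda>s. J p (f s)) (\<lambda>x. - \<xi> x) t" and g: "g \<in> L"
  shows "((\<lambda>s. pairing m (J p (f s)) g) has_real_derivative - pairing m \<xi> g) (at t)"
proof -
  define R where "R h = (\<lambda>x. (J p (f (t + h)) x - J p (f t) x) / h - - \<xi> x)" for h
  have xi: "(\<lambda>x. - \<xi> x) \<in> Lq" and lim: "((\<lambda>h. Lp_norm m q (R h)) \<longlongrightarrow> 0) (at 0)"
    using der by (auto simp: Lp_has_derivative_def Lp_conv_def R_def)
  have ev: "\<forall>\<^sub>F h in at 0. norm ((pairing m (J p (f (t + h))) g - pairing m (J p (f t)) g) / h - - pairing m \<xi> g)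
      \<le> Lp_norm m q (R h) * nrm g"
    unfolding eventually_at
  proof (intro exI[of _ t] conjI ballI impI)
    fix h :: real assume h: "h \<noteq> 0 \<and> dist h 0 < t"
    then have th: "0 \<le> t + h" unfolding dist_real_def by linarith
    note Jth = J_f_Lq[OF th] and Jt = J_f_Lq[OF less_imp_le[OF t]]
    have d: "(\<lambda>x. J p (f (t + h)) x - J p (f t) x) \<in> Lq" by (rule Lq_diff[OF Jth Jt])
    have dh: "(\<lambda>x. (J p (f (t + h)) x - J p (f t) x) / h) \<in> Lq" using Lp_cmult[OF d, of "1 / h"] by simp
    have "pairing m (\<lambda>x. (J p (f (t + h)) x - J p (f t) x) / h) g = (pairing m (J p (f (t + h))) g - pairing m (J p (f t)) g) / h"
      using pairing_cmult_left[of "1/h" "\<lambda>x. J p (f (t + h)) x - J p (f t) x" g] pairing_diff_left[OF Jth Jt g] by simp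
    then have "pairing m (R h) g = (pairing m (J p (f (t + h))) g - pairing m (J p (f t)) g) / h - - pairing m \<xi> g"
      unfolding R_def pairing_diff_left[OF dh xi g] by (simp add: pairing_uminus_left)
    moreover have "R h \<in> Lq" unfolding R_def by (rule Lq_diff[OF dh xi])
    ultimately show "norm ((pairing m (J p (f (t + h))) g - pairing m (J p (f t)) g) / h - - pairing m \<xi> g)
        \<le> Lp_norm m q (R h) * nrm g" using pairing_bound[of "R h" m g] g by simp
  qed (rule t)
  have "((\<lambda>h. (pairing m (J p (f (t + h))) g - pairing m (J p (f t)) g) / h - - pairing m \<xi> g) \<longlongrightarrow> 0) (at 0)"
    by (rule Lim_null_comparison[OF ev tendsto_mult_left_zero[OF lim]])
  then show ?thesis unfolding LIM_zero_iff DERIV_def .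
qed

text \<open>The gradient of the conjugate energy at J (f t) is f t, so the derivative should be that
  of the pairing with f t frozen. By \<open>N_over_q_diff\<close> the two difference quotients
  differ by a bounded factor times the norm of f (t + h) - f t, which tends to 0.\<close>

lemma has_derivative_N:
  assumes t: "0 < t" and der: "Lp_has_derivative m q (\<lambda>s. J p (f s)) (\<lambda>x. - \<xi> x) t"
  shows "((\<lambda>s. N (f s) / q) has_real_derivative - pairing m \<xi> (f t)) (at t)"
proof -
  note ft = f_L[OF less_imp_le[OF t]] and Jt = J_f_Lq[OF less_imp_le[OF t]]
  define R where "R h = (\<lambda>x. (J p (f (t + h)) x - J p (f t) x) / h - - \<xi> x)" for h
  define G where "G s = pairing m (J p (f s)) (f t)" for s
  have xi: "(\<lambda>x. - \<xi> x) \<in> Lq" and lim: "((\<lambda>h. Lp_norm m q (R h)) \<longlongrightarrow> 0) (at 0)"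
    using der by (auto simp: Lp_has_derivative_def Lp_conv_def R_def)
  have dG: "((\<lambda>h. (G (t + h) - G t) / h) \<longlongrightarrow> - pairing m \<xi> (f t)) (at 0)"
    using has_derivative_pairing[OF t der ft] unfolding G_def DERIV_def .
  have cont: "((\<lambda>h. nrm (\<lambda>x. f (t + h) x - f t x)) \<longlongrightarrow> 0) (at 0)"
  proof -
    have "((\<lambda>h. t + h) \<longlongrightarrow> t + 0) (at 0)" by (intro tendsto_intros)
    moreover have "\<forall>\<^sub>F h in at 0. 0 \<le> t + h" unfolding eventually_at
      using t by (intro exI[of _ t]) (auto simp: dist_real_def)
    ultimately show ?thesis using Lp_conv_f[of t "\<lambda>h. t + h" "at 0"] t by (simp add: Lp_conv_def)
  qed
  have ev: "\<forall>\<^sub>F h in at 0. norm ((N (f (t + h)) / q - N (f t) / q) / h - (G (t + h) - G t) / h)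
      \<le> (Lp_norm m q (R h) + Lp_norm m q (\<lambda>x. - \<xi> x)) * nrm (\<lambda>x. f (t + h) x - f t x)"
    unfolding eventually_at
  proof (intro exI[of _ t] conjI ballI impI)
    fix h :: real assume h: "h \<noteq> 0 \<and> dist h 0 < t"
    then have th: "0 \<le> t + h" unfolding dist_real_def by linarith
    note fth = f_L[OF th] and Jth = J_f_Lq[OF th]
    define D where "D = (\<lambda>x. J p (f (t + h)) x - J p (f t) x)"
    have D: "D \<in> Lq" unfolding D_def by (rule Lq_diff[OF Jth Jt])
    have dh: "(\<lambda>x. D x / h) \<in> Lq" using Lp_cmult[OF D, of "1 / h"] by simp
    have Rh: "R h \<in> Lq" unfolding R_def D_def[symmetric] using Lq_diff[OF dh xi] by (simp add: D_def)
    have v: "(\<lambda>x. f (t + h) x - f t x) \<in> L" by (rule L_diff[OF fth ft])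
    have G: "pairing m D (f t) = G (t + h) - G t" unfolding D_def G_def by (rule pairing_diff_left[OF Jth Jt ft])
    have "pairing m D (f t) \<le> N (f (t + h)) / q - N (f t) / q" "N (f (t + h)) / q - N (f t) / q \<le> pairing m D (f (t + h))"
      unfolding D_def using N_over_q_diff[OF ft fth] by auto
    then have "\<bar>(N (f (t + h)) / q - N (f t) / q) - (G (t + h) - G t)\<bar> \<le> \<bar>pairing m D (\<lambda>x. f (t + h) x - f t x)\<bar>"
      using pairing_diff[OF D fth ft] G by linarith
    also have "\<dots> = \<bar>h\<bar> * \<bar>pairing m (\<lambda>x. D x / h) (\<lambda>x. f (t + h) x - f t x)\<bar>"
      using pairing_cmult_left[of "1/h" D "\<lambda>x. f (t + h) x - f t x"] h by (simp add: abs_mult)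
    also have "\<dots> \<le> \<bar>h\<bar> * (Lp_norm m q (\<lambda>x. D x / h) * nrm (\<lambda>x. f (t + h) x - f t x))"
      by (intro mult_left_mono pairing_bound dh v) auto
    also have "\<dots> \<le> \<bar>h\<bar> * ((Lp_norm m q (R h) + Lp_norm m q (\<lambda>x. - \<xi> x)) * nrm (\<lambda>x. f (t + h) x - f t x))"
    proof (intro mult_left_mono mult_right_mono)
      show "Lp_norm m q (\<lambda>x. D x / h) \<le> Lp_norm m q (R h) + Lp_norm m q (\<lambda>x. - \<xi> x)"
        using Lp_norm_triangle[OF q_ge_1 Rh xi] by (simp add: R_def D_def)
    qed auto
    finally have "\<bar>(N (f (t + h)) / q - N (f t) / q) - (G (t + h) - G t)\<bar> / \<bar>h\<bar>
        \<le> (Lp_norm m q (R h) + Lp_norm m q (\<lambda>x. - \<xi> x)) * nrm (\<lambda>x. f (t + h) x - f t x)"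
      using h by (simp add: field_simps)
    then show "norm ((N (f (t + h)) / q - N (f t) / q) / h - (G (t + h) - G t) / h)
      \<le> (Lp_norm m q (R h) + Lp_norm m q (\<lambda>x. - \<xi> x)) * nrm (\<lambda>x. f (t + h) x - f t x)"
      unfolding real_norm_def diff_divide_distrib[symmetric, where c = h] abs_divide .
  qed (rule t)
  have "((\<lambda>h. (Lp_norm m q (R h) + Lp_norm m q (\<lambda>x. - \<xi> x)) * nrm (\<lambda>x. f (t + h) x - f t x))
      \<longlongrightarrow> (0 + Lp_norm m q (\<lambda>x. - \<xi> x)) * 0) (at 0)"
    by (intro tendsto_intros lim cont)
  then have "((\<lambda>h. (N (f (t + h)) / q - N (f t) / q) / h - (G (t + h) - G t) / h) \<longlongrightarrow> 0) (at 0)"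
    by (intro Lim_null_comparison[OF ev]) simp
  from tendsto_add[OF this dG]
  have "((\<lambda>h. (N (f (t + h)) / q - N (f t) / q) / h) \<longlongrightarrow> - pairing m \<xi> (f t)) (at 0)" by simp
  then show ?thesis unfolding DERIV_def .
qed

text \<open>The derivative of the divergence is the pairing of \<xi> with g - f t. The subgradient
  inequality bounds it, and the terms containing K add up to K times the divergence.\<close>

lemma EVI:
  assumes good: "good t \<xi>" and g: "g \<in> adm"
  shows "\<exists>D. ((\<lambda>s. Breg g (f s)) has_real_derivative D) (at t) \<and> D \<le> K * Breg g (f t) + (\<phi> g - \<phi> (f t))"
proof -
  have t: "0 < t" and xi: "\<xi> \<in> Frechet_subdiff m p (Phi m p M) (f t)"
    and der: "Lp_has_derivative m q (\<lambda>s. J p (f s)) (\<lambda>x. - \<xi> x) t"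
    using good by (auto simp: good_def)
  note ft = f_L[OF less_imp_le[OF t]] and gL = adm_L[OF g]
  have xiL: "\<xi> \<in> Lq" using Frechet_subdiffD(1)[OF xi] .
  have v: "(\<lambda>x. g x - f t x) \<in> L" by (rule L_diff[OF gL ft])
  have "((\<lambda>s. Breg g (f s)) has_real_derivative (0 + - pairing m \<xi> (f t) - - pairing m \<xi> g)) (at t)"
    unfolding Breg_def
    by (intro DERIV_diff DERIV_add DERIV_const has_derivative_N[OF t der] has_derivative_pairing[OF t der gL])
  moreover have "E (f t) / p + pairing m (\<lambda>x. \<xi> x + K * J p (f t) x) (\<lambda>x. g x - f t x) \<le> E g / p"
    by (rule Frechet_subdiffD(3)[OF xi g])
  then have "pairing m \<xi> g - pairing m \<xi> (f t) + K * pairing m (J p (f t)) (\<lambda>x. g x - f t x) \<le> E g / p - E (f t) / p"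
    using pairing_add_left[OF xiL Lp_cmult[OF J_in_Lq[OF ft]] v, of K] pairing_diff[OF xiL gL ft]
    by (simp add: pairing_cmult_left)
  then have "0 + - pairing m \<xi> (f t) - - pairing m \<xi> g \<le> K * Breg g (f t) + (\<phi> g - \<phi> (f t))"
    unfolding Breg_alt[OF ft gL] \<phi>_def by (simp add: algebra_simps)
  ultimately show ?thesis by blast
qed

section \<open>Absolute continuity of real quantities along the flow\<close>

lemma pairing_ac:
  assumes a: "0 \<le> a" and g: "g \<in> L"
  shows "ac_dist a b (\<lambda>s t. \<bar>pairing m (J p (f t)) g - pairing m (J p (f s)) g\<bar>)"
proof (rule ac_dist_dominated[OF J_f_ac[OF a, of b], of "nrm g"])
  fix s t assume st: "a \<le> s" "s \<le> t" "t \<le> b"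
  have J: "J p (f s) \<in> Lq" "J p (f t) \<in> Lq" using a st by (auto intro: J_f_Lq)
  have "\<bar>pairing m (J p (f t)) g - pairing m (J p (f s)) g\<bar> \<le> Lp_norm m q (\<lambda>x. J p (f t) x - J p (f s) x) * nrm g"
    using pairing_bound[OF Lq_diff[OF J(2,1)] g] pairing_diff_left[OF J(2,1) g] by simp
  moreover have "0 \<le> nrm g * (t - s)" using st by simp
  ultimately show "\<bar>pairing m (J p (f t)) g - pairing m (J p (f s)) g\<bar>
      \<le> nrm g * Lp_norm m q (\<lambda>x. J p (f t) x - J p (f s) x) + nrm g * (t - s)"
    by (simp add: mult.commute)
qed simp

lemma N_diff_le:
  assumes "0 \<le> s" "0 \<le> t"
  shows "\<bar>N (f t) / q - N (f s) / q\<bar> \<le> Lp_norm m q (\<lambda>x. J p (f t) x - J p (f s) x)"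
proof -
  note fs = f_L[OF assms(1)] and ft = f_L[OF assms(2)]
  define D where "D = (\<lambda>x. J p (f t) x - J p (f s) x)"
  have D: "D \<in> Lq" unfolding D_def using assms by (intro Lq_diff J_f_Lq) auto
  have bd: "\<bar>pairing m D g\<bar> \<le> Lp_norm m q D" if "g \<in> adm" for g
  proof -
    have "\<bar>pairing m D g\<bar> \<le> Lp_norm m q D * nrm g" by (rule pairing_bound[OF D adm_L[OF that]])
    also have "\<dots> \<le> Lp_norm m q D * 1" by (intro mult_left_mono adm_nrm that) auto
    finally show ?thesis by simp
  qed
  show ?thesis
    using N_over_q_diff[OF fs ft] bd[OF f_adm[OF assms(1)]] bd[OF f_adm[OF assms(2)]]
    unfolding D_def[symmetric] by linarith
qed

lemma N_ac:
  assumes a: "0 \<le> a"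
  shows "ac_dist a b (\<lambda>s t. \<bar>N (f t) / q - N (f s) / q\<bar>)"
proof (rule ac_dist_dominated[OF J_f_ac[OF a, of b], of 1])
  fix s t assume st: "a \<le> s" "s \<le> t" "t \<le> b"
  show "\<bar>N (f t) / q - N (f s) / q\<bar> \<le> 1 * Lp_norm m q (\<lambda>x. J p (f t) x - J p (f s) x) + 1 * (t - s)"
    using N_diff_le[of s t] a st by simp
qed simp

lemma Breg_ac:
  assumes a: "0 \<le> a" and g: "g \<in> L"
  shows "ac_dist a b (\<lambda>s t. \<bar>Breg g (f t) - Breg g (f s)\<bar>)"
proof (rule ac_dist_dominated[OF J_f_ac[OF a, of b], of "1 + nrm g"])
  fix s t assume st: "a \<le> s" "s \<le> t" "t \<le> b"
  define d where "d = Lp_norm m q (\<lambda>x. J p (f t) x - J p (f s) x)"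
  have J: "J p (f s) \<in> Lq" "J p (f t) \<in> Lq" using a st by (auto intro: J_f_Lq)
  have "\<bar>pairing m (J p (f t)) g - pairing m (J p (f s)) g\<bar> \<le> d * nrm g"
    unfolding d_def using pairing_bound[OF Lq_diff[OF J(2,1)] g] pairing_diff_left[OF J(2,1) g] by simp
  moreover have "\<bar>N (f t) / q - N (f s) / q\<bar> \<le> d" unfolding d_def using N_diff_le[of s t] a st by simp
  moreover have "0 \<le> (1 + nrm g) * (t - s)" using st by simp
  ultimately show "\<bar>Breg g (f t) - Breg g (f s)\<bar> \<le> (1 + nrm g) * d + (1 + nrm g) * (t - s)"
    unfolding Breg_def by (simp add: distrib_right mult.commute[of "nrm g" d])
qed simp

lemma pairing_f_bounded:
  assumes "0 \<le> t" "g \<in> L"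
  shows "\<bar>pairing m (J p (f t)) g\<bar> \<le> nrm g"
proof -
  have "\<bar>pairing m (J p (f t)) g\<bar> \<le> Lp_norm m q (J p (f t)) * nrm g"
    by (rule pairing_bound[OF J_f_Lq[OF assms(1)] assms(2)])
  also have "\<dots> \<le> 1 * nrm g" by (intro mult_right_mono J_f_norm_le assms) auto
  finally show ?thesis by simp
qed

lemma Breg_f_bounded:
  assumes "0 \<le> t" "g \<in> L"
  shows "\<bar>Breg g (f t)\<bar> \<le> N g / p + 1 / q + nrm g"
proof -
  have "N (f t) / q \<le> 1 / q" using f_adm[OF assms(1)] q_pos by (intro divide_right_mono) (auto simp: adm_def)
  moreover have "0 \<le> N (f t) / q" "0 \<le> N g / p" using q_pos p_pos by auto
  ultimately show ?thesis using pairing_f_bounded[OF assms] unfolding Breg_def by linarith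
qed

section \<open>Monotonicity of the functional\<close>

lemma K_pos: "K > 0"
  using M_pos by simp

text \<open>E is lower semicontinuous and N continuous along the flow, so the times at which
  \<open>\<phi>\<close> stays below a level form a closed set, although \<open>\<phi>\<close> is not
  yet known to be continuous.\<close>

lemma \<phi>_closed:
  assumes r: "r \<longlonglongrightarrow> t" "\<And>n. 0 \<le> r n" and le: "\<And>n. \<phi> (f (r n)) \<le> c"
  shows "\<phi> (f t) \<le> c"
proof -
  have t: "0 \<le> t" by (rule LIMSEQ_le_const[OF r(1)]) (use r(2) in blast)
  have conv: "Lp_conv m p (\<lambda>n. f (r n)) (f t) sequentially" by (rule Lp_conv_f[OF t r(1)]) (simp add: r(2))
  have Nlim: "(\<lambda>n. N (f (r n))) \<longlonglongrightarrow> N (f t)" by (rule N_tendsto[OF _ f_L[OF t] conv]) (simp add: f_L r(2))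
  have El: "E (f (r n)) \<le> p * c + K * N (f (r n))" for n
    using le[of n] p_pos by (simp add: \<phi>_def field_simps)
  have "E (f t) \<le> (p * c + K * N (f t)) + e" if e: "e > 0" for e
  proof (rule E_lsc(2)[OF trivial_limit_sequentially f_L[OF t] conv])
    have "(\<lambda>n. p * c + K * N (f (r n))) \<longlonglongrightarrow> p * c + K * N (f t)" by (intro tendsto_intros Nlim)
    then have "\<forall>\<^sub>F n in sequentially. p * c + K * N (f (r n)) < (p * c + K * N (f t)) + e"
      using e by (intro order_tendstoD) auto
    then show "\<forall>\<^sub>F n in sequentially. f (r n) \<in> H \<and> E (f (r n)) \<le> (p * c + K * N (f t)) + e"
    proof eventually_elim
      case (elim n)
      then show ?case using El[of n] adm_H[OF f_adm[OF r(2)]] by (auto intro: order_trans)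
    qed
  qed
  then have "E (f t) \<le> p * c + K * N (f t)" by (rule field_le_epsilon)
  then show ?thesis using p_pos by (simp add: \<phi>_def field_simps)
qed

lemma last_time:
  assumes cl: "\<And>r l. r \<longlonglongrightarrow> l \<Longrightarrow> (\<And>n. a \<le> r n \<and> r n \<le> b \<and> P (r n)) \<Longrightarrow> P l"
    and a: "P a" "a \<le> b"
  shows "\<exists>c. a \<le> c \<and> c \<le> (b::real) \<and> P c \<and> (\<forall>r. c < r \<and> r \<le> b \<longrightarrow> \<not> P r)"
proof -
  define S where "S = {r. a \<le> r \<and> r \<le> b \<and> P r}"
  have "closed S"
    unfolding closed_sequential_limits
  proof (intro allI impI, elim conjE)
    fix r l assume r: "\<forall>n. r n \<in> S" "r \<longlonglongrightarrow> l"
    have "a \<le> l" by (rule LIMSEQ_le_const[OF r(2)]) (use r(1) in \<open>auto simp: S_def\<close>)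
    moreover have "l \<le> b" by (rule LIMSEQ_le_const2[OF r(2)]) (use r(1) in \<open>auto simp: S_def\<close>)
    moreover have "P l" by (rule cl[OF r(2)]) (use r(1) in \<open>auto simp: S_def\<close>)
    ultimately show "l \<in> S" by (simp add: S_def)
  qed
  moreover have "bounded S" by (rule bounded_subset[OF bounded_closed_interval[of a b]]) (auto simp: S_def)
  ultimately have "compact S" by (simp add: compact_eq_bounded_closed)
  moreover have "S \<noteq> {}" using a by (auto simp: S_def)
  ultimately obtain c where c: "c \<in> S" "\<forall>r\<in>S. r \<le> c" using compact_attains_sup by blast
  have "\<not> P r" if "c < r" "r \<le> b" for r
  proof
    assume "P r"
    then have "r \<in> S" using c(1) that by (auto simp: S_def)
    then show False using c(2) that by auto
  qed
  then show ?thesis using c(1) by (intro exI[of _ c]) (auto simp: S_def)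
qed

lemma AE_good_between:
  assumes "0 \<le> a" and "\<And>t \<xi>. a < t \<Longrightarrow> t < b \<Longrightarrow> good t \<xi> \<Longrightarrow> P t"
  shows "AE t in lborel. a < t \<and> t < b \<longrightarrow> P t"
  using AE_good
proof eventually_elim
  case (elim t)
  show ?case
  proof
    assume t: "a < t \<and> t < b"
    then obtain \<xi> where "good t \<xi>" using elim assms(1) by force
    then show "P t" using assms(2) t by blast
  qed
qed

text \<open>The base point lies on the trajectory, so the divergence starts from 0 and is driven by
  the loss e of the functional alone.\<close>

lemma Breg_gronwall:
  assumes s: "0 \<le> s" "s \<le> t" and e: "0 \<le> e"
    and le: "\<And>r. s < r \<Longrightarrow> r < t \<Longrightarrow> \<phi> (f s) - \<phi> (f r) \<le> e"
  shows "Breg (f s) (f t) \<le> exp (K * (t - s)) * (e * (t - s))"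
proof -
  note fs = f_adm[OF s(1)]
  have "Breg (f s) (f t) \<le> exp (K * (t - s)) * (Breg (f s) (f s) + e * (t - s))"
  proof (rule ac_gronwall[OF s(2) Breg_ac[OF s(1) adm_L[OF fs]]])
    fix r assume "r \<in> {s..t}"
    then show "\<bar>Breg (f s) (f r)\<bar> \<le> N (f s) / p + 1 / q + nrm (f s)"
      using s by (intro Breg_f_bounded adm_L[OF fs]) auto
  next
    show "AE r in lborel. s < r \<and> r < t \<longrightarrow>
        (\<exists>D. ((\<lambda>r. Breg (f s) (f r)) has_real_derivative D) (at r) \<and> D \<le> K * Breg (f s) (f r) + e)"
      by (rule AE_good_between[OF s(1)]) (use EVI[OF _ fs] le in force)
  qed (use K_pos e in auto)
  then show ?thesis by (simp add: Breg_self adm_L[OF fs])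
qed

text \<open>
  The flow is only absolutely continuous after applying the duality map, so no chain rule is
  available for \<open>\<phi>\<close> along it. Monotonicity comes from the evolution variational inequality based at
  the last time at which \<open>\<phi>\<close> did not exceed its old value: Gronwall then forces the flow to be
  constant afterwards.
\<close>

lemma \<phi>_decreasing:
  assumes s: "0 \<le> s" "s \<le> t"
  shows "\<phi> (f t) \<le> \<phi> (f s)"
proof (rule ccontr)
  assume no: "\<not> \<phi> (f t) \<le> \<phi> (f s)"
  have "\<exists>c. s \<le> c \<and> c \<le> t \<and> \<phi> (f c) \<le> \<phi> (f s) \<and> (\<forall>r. c < r \<and> r \<le> t \<longrightarrow> \<not> \<phi> (f r) \<le> \<phi> (f s))"
  proof (rule last_time)
    fix r l assume r: "r \<longlonglongrightarrow> l" "\<And>n. s \<le> r n \<and> r n \<le> t \<and> \<phi> (f (r n)) \<le> \<phi> (f s)"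
    then show "\<phi> (f l) \<le> \<phi> (f s)" using s(1) by (intro \<phi>_closed[OF r(1)]) (auto intro: order_trans)
  qed (use s in auto)
  then obtain c where c: "s \<le> c" "c \<le> t" "\<phi> (f c) \<le> \<phi> (f s)" "\<And>r. c < r \<Longrightarrow> r \<le> t \<Longrightarrow> \<not> \<phi> (f r) \<le> \<phi> (f s)"
    by blast
  have c0: "0 \<le> c" and t0: "0 \<le> t" using s c by auto
  note fc = f_adm[OF c0]
  \<comment> \<open>After \<open>c\<close> the functional exceeds its value at s, hence also its
    value at \<open>c\<close>, so the driving term is 0.\<close>
  have "Breg (f c) (f t) \<le> exp (K * (t - c)) * (0 * (t - c))"
  proof (rule Breg_gronwall[OF c0 c(2) order_refl])
    fix r assume "c < r" "r < t"
    then show "\<phi> (f c) - \<phi> (f r) \<le> 0" using c(3) c(4)[of r] by simp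
  qed
  then have "Breg (f c) (f t) \<le> 0" by simp
  then have "2 powr (1 - p) / p * N (\<lambda>x. f c x - f t x) \<le> 0"
    using Breg_ge[OF f_L[OF t0] f_L[OF c0]] by linarith
  then have "N (\<lambda>x. f c x - f t x) = 0"
    using p_pos Lp_pow_nonneg[of m p "\<lambda>x. f c x - f t x"] by (simp add: mult_le_0_iff divide_le_0_iff)
  then have "AE x in m. f c x - f t x = 0"
    using Lp_pow_eq_0_iff[OF L_diff[OF f_L[OF c0] f_L[OF t0]] p_pos] by simp
  then have eq: "AE x in m. f c x = f t x" by eventually_elim simp
  have "E (f t) = E (f c)" by (rule E_cong_AE(2)[OF adm_H[OF fc] f_L[OF t0] eq])
  moreover have "N (f t) = N (f c)"
    using Lp_pow_cong_AE[OF Lp_measurable[OF f_L[OF c0]] Lp_measurable[OF f_L[OF t0]] eq] by simp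
  ultimately have "\<phi> (f t) = \<phi> (f c)" by (simp add: \<phi>_def)
  then show False using no c(3) by simp
qed

section \<open>Confinement to the sphere and preservation of the centring\<close>

lemma f_start:
  shows "E (f 0) = E f0" "N (f 0) = 1" "pairing m (J p (f 0)) (\<lambda>x. 1) = 0"
proof -
  have f0: "f0 \<in> H" "N f0 = 1" "pairing m (J p f0) (\<lambda>x. 1) = 0" using f0_centered by (auto simp: centered_def)
  have "AE x in m. f 0 x = f0 x" using flow by (simp add: mirror_flow_def)
  then have eq: "AE x in m. f0 x = f 0 x" by eventually_elim simp
  show "E (f 0) = E f0" by (rule E_cong_AE(2)[OF f0(1) f_L eq]) simp
  show "N (f 0) = 1"
    using Lp_pow_cong_AE[OF Lp_measurable[OF H_L[OF f0(1)]] Lp_measurable[OF f_L[of 0]] eq, of p] f0(2) by simp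
  have "pairing m (J p f0) (\<lambda>x. 1) = pairing m (J p (f 0)) (\<lambda>x. 1)"
    unfolding pairing_def
  proof (rule integral_cong_AE)
    show "(\<lambda>x. J p f0 x * 1) \<in> borel_measurable m" "(\<lambda>x. J p (f 0) x * 1) \<in> borel_measurable m"
      using measurable_J[OF Lp_measurable[OF H_L[OF f0(1)]]] measurable_J[OF Lp_measurable[OF f_L[of 0]]] by simp_all
    show "AE x in m. J p f0 x * 1 = J p (f 0) x * 1" using eq by eventually_elim (simp add: J_def)
  qed
  then show "pairing m (J p (f 0)) (\<lambda>x. 1) = 0" using f0(3) by simp
qed

lemma E_f_le:
  assumes "0 \<le> t"
  shows "E (f t) \<le> E f0 - K * (1 - N (f t))"
proof -
  have "(E (f t) - K * N (f t)) / p \<le> (E f0 - K * 1) / p"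
    using \<phi>_decreasing[of 0 t] assms by (simp add: \<phi>_def f_start diff_divide_distrib)
  then have "E (f t) - K * N (f t) \<le> E f0 - K * 1" using p_pos by (simp only: divide_le_cancel)
  then show ?thesis by (simp add: algebra_simps)
qed

lemma E_f_le_E_f0:
  assumes "0 \<le> t"
  shows "E (f t) \<le> E f0"
proof -
  have "0 \<le> K * (1 - N (f t))" using K_pos f_adm[OF assms] by (intro mult_nonneg_nonneg) (auto simp: adm_def)
  then show ?thesis using E_f_le[OF assms] by simp
qed

text \<open>The dilations (1 + s) f t with small s > 0 stay admissible because both constraints are
  strict; the first-order condition is one half of Euler's identity.\<close>

lemma interior_subgradient:
  assumes t: "0 \<le> t" and Nt: "N (f t) < 1" and xi: "\<xi> \<in> Frechet_subdiff m p (Phi m p M) (f t)"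
  shows "pairing m \<xi> (f t) + K * N (f t) \<le> E (f t)"
proof -
  note ft = f_L[OF t] and fH = adm_H[OF f_adm[OF t]]
  have xiL: "\<xi> \<in> Lq" by (rule Frechet_subdiffD(1)[OF xi])
  define a where "a = pairing m (\<lambda>x. \<xi> x + K * J p (f t) x) (f t)"
  have a: "a = pairing m \<xi> (f t) + K * N (f t)"
    unfolding a_def using pairing_add_left[OF xiL Lp_cmult[OF J_in_Lq[OF ft]] ft, of K]
    by (simp add: pairing_cmult_left pairing_J_self)
  define \<psi> where "\<psi> s = (1 + s) powr p * E (f t) / p - s * a" for s
  have d: "(\<psi> has_real_derivative (p * (1 + 0) powr (p - 1) * E (f t) / p - a)) (at 0)"
    unfolding \<psi>_def by (auto intro!: derivative_eq_intros)
  have l: "((\<lambda>s. (1 + s) powr p * c) \<longlongrightarrow> c) (at 0)" for c :: real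
  proof -
    have "((\<lambda>s. (1 + s) powr p * c) \<longlongrightarrow> (1 + 0) powr p * c) (at (0::real))" by (intro tendsto_intros) auto
    then show ?thesis by simp
  qed
  have "\<forall>\<^sub>F s in at 0. (1 + s) powr p * N (f t) < 1" using l Nt by (rule order_tendstoD)
  moreover have "E (f t) < M" using E_f_le_E_f0[OF t] E_f0_less_M by simp
  then have "\<forall>\<^sub>F s in at 0. (1 + s) powr p * E (f t) < M" by (rule order_tendstoD(2)[OF l])
  ultimately have "\<forall>\<^sub>F s in at 0. (1 + s) powr p * N (f t) < 1 \<and> (1 + s) powr p * E (f t) < M"
    by eventually_elim blast
  then obtain \<delta> where \<delta>: "\<delta> > 0"
    "\<And>s. s \<noteq> 0 \<Longrightarrow> \<bar>s\<bar> < \<delta> \<Longrightarrow> (1 + s) powr p * N (f t) < 1 \<and> (1 + s) powr p * E (f t) < M"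
    by (auto simp: eventually_at dist_real_def)
  have \<psi>pos: "\<psi> 0 \<le> \<psi> s" if s: "0 < s" "s < \<delta>" for s
  proof -
    have adm: "(\<lambda>x. (1 + s) * f t x) \<in> adm"
      using \<delta>(2)[of s] s by (simp add: adm_def E_cmult[OF fH] Lp_pow_cmult)
    have "E (f t) / p + pairing m (\<lambda>x. \<xi> x + K * J p (f t) x) (\<lambda>x. (1 + s) * f t x - f t x) \<le> E (\<lambda>x. (1 + s) * f t x) / p"
      by (rule Frechet_subdiffD(3)[OF xi adm])
    moreover have "(\<lambda>x. (1 + s) * f t x - f t x) = (\<lambda>x. s * f t x)" by (simp add: algebra_simps)
    ultimately show ?thesis using s by (simp add: pairing_cmult E_cmult(2)[OF fH] \<psi>_def a_def)
  qed
  have "0 \<le> p * (1 + 0) powr (p - 1) * E (f t) / p - a"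
    by (rule right_minimum_derivative_nonneg[OF d \<delta>(1) \<psi>pos])
  then show ?thesis using p_pos a by simp
qed

text \<open>After the last time on the sphere the flow would run inside the ball, where the norm
  does not decrease, so it could not have left the sphere.\<close>

lemma N_f:
  assumes t: "0 \<le> t"
  shows "N (f t) = 1"
proof (rule ccontr)
  assume "N (f t) \<noteq> 1"
  then have lt: "N (f t) < 1" using f_adm[OF t] by (simp add: adm_def)
  have "\<exists>c. 0 \<le> c \<and> c \<le> t \<and> 1 \<le> N (f c) \<and> (\<forall>r. c < r \<and> r \<le> t \<longrightarrow> \<not> 1 \<le> N (f r))"
  proof (rule last_time)
    fix r l assume r: "r \<longlonglongrightarrow> l" "\<And>n. 0 \<le> r n \<and> r n \<le> t \<and> 1 \<le> N (f (r n))"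
    then have l: "0 \<le> l" by (intro LIMSEQ_le_const[OF r(1)]) blast
    have "(\<lambda>n. N (f (r n))) \<longlonglongrightarrow> N (f l)"
      using r by (intro N_tendsto[OF _ f_L[OF l] Lp_conv_f[OF l r(1)]] always_eventually allI f_L) auto
    then show "1 \<le> N (f l)" by (rule LIMSEQ_le_const) (use r(2) in blast)
  qed (use t f_start in auto)
  then obtain c where c: "0 \<le> c" "c \<le> t" "1 \<le> N (f c)" "\<And>r. c < r \<Longrightarrow> r \<le> t \<Longrightarrow> \<not> 1 \<le> N (f r)"
    by blast
  have "- (N (f t) / q) \<le> - (N (f c) / q)"
  proof (rule ac_nonincreasing[OF c(2), where F = "\<lambda>t. - (N (f t) / q)"])
    show "ac_dist c t (\<lambda>s t. \<bar>- (N (f t) / q) - - (N (f s) / q)\<bar>)"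
      using N_ac[OF c(1), of t] by (simp add: abs_minus_commute)
    show "AE r in lborel. c < r \<and> r < t \<longrightarrow> (\<exists>D. ((\<lambda>t. - (N (f t) / q)) has_real_derivative D) (at r) \<and> D \<le> 0)"
    proof (rule AE_good_between[OF c(1)])
      fix r \<xi> assume r: "c < r" "r < t" "good r \<xi>"
      have r0: "0 < r" using r c by simp
      have Nr: "N (f r) < 1" using c(4)[of r] r by simp
      have "pairing m \<xi> (f r) + K * N (f r) \<le> E (f r)"
        using r Nr r0 by (intro interior_subgradient) (auto simp: good_def)
      moreover have "E (f r) \<le> E f0 - K * (1 - N (f r))" using r0 by (intro E_f_le) simp
      ultimately have "pairing m \<xi> (f r) \<le> E f0 - K" by (simp add: algebra_simps)
      \<comment> \<open>E f0 - K equals -(p + 1); this is where the size of M is used.\<close>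
      then have "pairing m \<xi> (f r) \<le> 0" using M_eq p_pos by simp
      moreover have "((\<lambda>t. - (N (f t) / q)) has_real_derivative - (- pairing m \<xi> (f r))) (at r)"
        using r by (intro DERIV_minus has_derivative_N) (auto simp: good_def)
      ultimately show "\<exists>D. ((\<lambda>t. - (N (f t) / q)) has_real_derivative D) (at r) \<and> D \<le> 0" by auto
    qed
  qed
  then have "N (f c) \<le> N (f t)" using q_pos by (simp add: divide_le_cancel)
  then show False using c(3) lt by simp
qed

text \<open>Constancy of N makes \<xi> annihilate f t, so the multiplier in
  \<open>constrained_subgradient\<close> is K - E (f t). The resulting subgradient of the energy
  annihilates constants, and K cancels.\<close>

lemma good_pairing_const:
  assumes "good t \<xi>"
  shows "pairing m \<xi> (\<lambda>x. 1) = - E (f t) * pairing m (J p (f t)) (\<lambda>x. 1)"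
proof -
  have t: "0 < t" and xi: "\<xi> \<in> Frechet_subdiff m p (Phi m p M) (f t)"
    and der: "Lp_has_derivative m q (\<lambda>s. J p (f s)) (\<lambda>x. - \<xi> x) t"
    using assms by (auto simp: good_def)
  note t0 = less_imp_le[OF t]
  note ft = f_L[OF t0]
  have xiL: "\<xi> \<in> Lq" by (rule Frechet_subdiffD(1)[OF xi])
  define \<eta> where "\<eta> = (\<lambda>x. \<xi> x + K * J p (f t) x)"
  have \<eta>: "\<eta> \<in> Lq" unfolding \<eta>_def by (intro Lq_add Lp_cmult J_in_Lq xiL ft)
  have pe: "pairing m \<eta> g = pairing m \<xi> g + K * pairing m (J p (f t)) g" if "g \<in> L" for g
    unfolding \<eta>_def using pairing_add_left[OF xiL Lp_cmult[OF J_in_Lq[OF ft]] that, of K] by (simp add: pairing_cmult_left)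
  have "- pairing m \<xi> (f t) = 0"
  proof (rule DERIV_local_const[OF has_derivative_N[OF t der] t], intro allI impI)
    fix s assume "\<bar>t - s\<bar> < t"
    then have "0 \<le> s" by linarith
    then show "N (f t) / q = N (f s) / q" using t by (simp add: N_f)
  qed
  then have "pairing m \<xi> (f t) = 0" by simp
  then have \<eta>f: "pairing m \<eta> (f t) = K" by (simp add: pe[OF ft] pairing_J_self N_f[OF t0])
  have "(\<lambda>x. \<eta> x - (pairing m \<eta> (f t) - E (f t)) * J p (f t) x) \<in> Ch_subdiff m p (f t)"
  proof (rule constrained_subgradient[OF adm_H[OF f_adm[OF t0]] N_f[OF t0] _ \<eta>])
    show "E (f t) < M" using E_f_le_E_f0[OF t0] E_f0_less_M by simp
    fix g assume "g \<in> H" "N g \<le> 1" "E g \<le> M"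
    then show "E (f t) / p + pairing m \<eta> (\<lambda>x. g x - f t x) \<le> E g / p"
      unfolding \<eta>_def by (intro Frechet_subdiffD(3)[OF xi]) (simp add: adm_def)
  qed
  then have "pairing m (\<lambda>x. \<eta> x - (K - E (f t)) * J p (f t) x) (\<lambda>x. 1) = 0"
    unfolding \<eta>f by (rule subdiff_const)
  then have "pairing m \<eta> (\<lambda>x. 1) = (K - E (f t)) * pairing m (J p (f t)) (\<lambda>x. 1)"
    using pairing_diff_left[OF \<eta> Lp_cmult[OF J_in_Lq[OF ft]] Lp_const[of 1], of "K - E (f t)"]
    by (simp add: pairing_cmult_left)
  then show ?thesis using pe[OF Lp_const[of 1]] by (simp add: algebra_simps)
qed

text \<open>The mean z of J f t solves the linear equation z' = E (f t) z with z 0 = 0. Gronwall is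
  applied to the square of z, which treats both signs at once.\<close>

lemma f_centered:
  assumes t: "0 \<le> t"
  shows "f t \<in> centered"
proof -
  define z where "z s = pairing m (J p (f s)) (\<lambda>x. 1)" for s
  define B where "B = nrm (\<lambda>x. 1)"
  have B: "B \<ge> 0" by (simp add: B_def)
  have zB: "\<bar>z s\<bar> \<le> B" if "0 \<le> s" for s
    unfolding z_def B_def by (rule pairing_f_bounded[OF that Lp_const])
  have "(z t)\<^sup>2 \<le> exp (2 * E f0 * (t - 0)) * ((z 0)\<^sup>2 + 0 * (t - 0))"
  proof (rule ac_gronwall[OF t, where F = "\<lambda>s. (z s)\<^sup>2"])
    show "ac_dist 0 t (\<lambda>s t. \<bar>(z t)\<^sup>2 - (z s)\<^sup>2\<bar>)"
    proof (rule ac_dist_dominated[OF pairing_ac[of 0 "\<lambda>x. 1" t]])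
      fix s r :: real assume sr: "0 \<le> s" "s \<le> r" "r \<le> t"
      have "\<bar>(z r)\<^sup>2 - (z s)\<^sup>2\<bar> = \<bar>z r + z s\<bar> * \<bar>z r - z s\<bar>" by (simp add: power2_eq_square square_diff_square_factored abs_mult)
      also have "\<dots> \<le> (2 * B) * \<bar>z r - z s\<bar>"
      proof (rule mult_right_mono)
        show "\<bar>z r + z s\<bar> \<le> 2 * B" using zB[of r] zB[of s] sr by linarith
      qed simp
      also have "\<dots> \<le> (2 * B) * \<bar>z r - z s\<bar> + (2 * B) * (r - s)" using B sr by simp
      finally show "\<bar>(z r)\<^sup>2 - (z s)\<^sup>2\<bar> \<le> (2 * B) * \<bar>pairing m (J p (f r)) (\<lambda>x. 1) - pairing m (J p (f s)) (\<lambda>x. 1)\<bar> + (2 * B) * (r - s)"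
        by (simp add: z_def)
    qed (use B Lp_const in auto)
    show "\<bar>(z s)\<^sup>2\<bar> \<le> B\<^sup>2" if "s \<in> {0..t}" for s
      using power_mono[OF zB[of s], of 2] that by simp
    show "AE s in lborel. 0 < s \<and> s < t \<longrightarrow> (\<exists>D. ((\<lambda>s. (z s)\<^sup>2) has_real_derivative D) (at s) \<and> D \<le> 2 * E f0 * (z s)\<^sup>2 + 0)"
    proof (rule AE_good_between)
      fix s \<xi> assume s: "0 < s" "s < t" "good s \<xi>"
      have "(z has_real_derivative - pairing m \<xi> (\<lambda>x. 1)) (at s)"
        unfolding z_def using s by (intro has_derivative_pairing Lp_const) (auto simp: good_def)
      then have dz: "(z has_real_derivative E (f s) * z s) (at s)" by (simp add: good_pairing_const[OF s(3)] z_def)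
      have "((\<lambda>s. (z s)\<^sup>2) has_real_derivative 2 * E (f s) * (z s)\<^sup>2) (at s)"
        by (auto intro!: derivative_eq_intros dz simp: power2_eq_square)
      moreover have "2 * E (f s) * (z s)\<^sup>2 \<le> 2 * E f0 * (z s)\<^sup>2"
        using E_f_le_E_f0[of s] s by (intro mult_right_mono) auto
      ultimately show "\<exists>D. ((\<lambda>s. (z s)\<^sup>2) has_real_derivative D) (at s) \<and> D \<le> 2 * E f0 * (z s)\<^sup>2 + 0" by auto
    qed simp
  qed (use E_nonneg in auto)
  moreover have "z 0 = 0" by (simp add: z_def f_start)
  ultimately have "(z t)\<^sup>2 \<le> 0" by simp
  then have "z t = 0" by simp
  then show ?thesis using adm_H[OF f_adm[OF t]] N_f[OF t] by (simp add: centered_def z_def)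
qed

section \<open>Long-time behaviour and limit points\<close>

lemma E_f_decreasing:
  assumes "0 \<le> s" "s \<le> t"
  shows "E (f t) \<le> E (f s)"
  using \<phi>_decreasing[OF assms] N_f assms p_pos by (simp add: \<phi>_def divide_le_cancel)

definition ls :: real where
  "ls = Inf ((\<lambda>t. E (f t)) ` {0..})"

lemma ls_le: "0 \<le> t \<Longrightarrow> ls \<le> E (f t)"
  unfolding ls_def by (intro cInf_lower bdd_belowI2[of _ 0] imageI E_nonneg) auto

lemma E_f_tendsto: "((\<lambda>t. E (f t)) \<longlongrightarrow> ls) at_top"
proof (rule order_tendstoI)
  fix a assume a: "a < ls"
  show "\<forall>\<^sub>F t in at_top. a < E (f t)"
    using eventually_ge_at_top[of "0::real"] by eventually_elim (use ls_le a in force)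
next
  fix a assume "ls < a"
  then obtain t where t: "0 \<le> t" "E (f t) < a"
    unfolding ls_def using cInf_lessD[of "(\<lambda>t. E (f t)) ` {0..}" a] by auto
  show "\<forall>\<^sub>F t in at_top. E (f t) < a"
    using eventually_ge_at_top[of t] by eventually_elim (use E_f_decreasing t in force)
qed

lemma ls_less_M: "ls < M"
  using ls_le[of 0] f_start(1) E_f0_less_M by simp

text \<open>The displacement is driven by the energy still to be lost, E (f t) - ls, which tends to
  0; on the sphere \<open>\<phi>\<close> and E / p differ by a constant only.\<close>

lemma f_slow:
  assumes t: "0 \<le> t" and \<tau>: "0 \<le> \<tau>" "\<tau> \<le> 1"
  shows "nrm (\<lambda>x. f (t + \<tau>) x - f t x) \<le> (exp K * (E (f t) - ls) / 2 powr (1 - p)) powr (1 / p)"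
proof -
  define e where "e = (E (f t) - ls) / p"
  have e: "e \<ge> 0" using ls_le[OF t] p_pos by (simp add: e_def)
  have t\<tau>: "0 \<le> t + \<tau>" using t \<tau> by simp
  have "Breg (f t) (f (t + \<tau>)) \<le> exp (K * ((t + \<tau>) - t)) * (e * ((t + \<tau>) - t))"
  proof (rule Breg_gronwall[OF t _ e])
    fix r assume r: "t < r"
    have r0: "0 \<le> r" using r t by simp
    have "\<phi> (f t) - \<phi> (f r) = (E (f t) - E (f r)) / p"
      by (simp add: \<phi>_def N_f[OF t] N_f[OF r0] diff_divide_distrib)
    also have "\<dots> \<le> e" unfolding e_def using ls_le[OF r0] p_pos by (intro divide_right_mono) auto
    finally show "\<phi> (f t) - \<phi> (f r) \<le> e" .
  qed (use \<tau> in simp)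
  also have "\<dots> = exp (K * \<tau>) * (e * \<tau>)" by simp
  also have "\<dots> \<le> exp K * (e * 1)"
    using K_pos \<tau> e by (intro mult_mono) (auto simp: mult_left_le)
  finally have "Breg (f t) (f (t + \<tau>)) \<le> exp K * e" by simp
  then have "2 powr (1 - p) / p * N (\<lambda>x. f t x - f (t + \<tau>) x) \<le> exp K * e"
    using Breg_ge[OF f_L[OF t\<tau>] f_L[OF t]] by linarith
  then have "N (\<lambda>x. f t x - f (t + \<tau>) x) \<le> exp K * (E (f t) - ls) / 2 powr (1 - p)"
    using p_pos by (simp add: e_def field_simps)
  then have "N (\<lambda>x. f t x - f (t + \<tau>) x) powr (1 / p) \<le> (exp K * (E (f t) - ls) / 2 powr (1 - p)) powr (1 / p)"
    using p_pos by (intro powr_mono2) auto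
  then show ?thesis by (subst Lp_norm_minus_commute) (simp add: Lp_norm_eq_pow)
qed

lemma omega_eigenfunction:
  assumes fs: "fs \<in> omega_limit m p f"
  shows "N fs = 1" "E fs = ls" "eigenfunction m p ls fs"
proof -
  obtain t where t: "\<And>n. 0 \<le> t n" "filterlim t at_top sequentially" and fsL: "fs \<in> L"
    and conv: "Lp_conv m p (\<lambda>n. f (t n)) fs sequentially"
    using fs by (auto simp: omega_limit_def)
  have "(\<lambda>n. N (f (t n))) \<longlonglongrightarrow> N fs" by (rule N_tendsto[OF _ fsL conv]) (simp add: f_L t)
  then show N1: "N fs = 1" by (simp add: N_f t LIMSEQ_const_iff)
  have Elim: "(\<lambda>n. E (f (t n))) \<longlonglongrightarrow> ls" by (rule filterlim_compose[OF E_f_tendsto t(2)])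
  have *: "fs \<in> H \<and> E fs \<le> ls + e" if e: "e > 0" for e
  proof -
    have "\<forall>\<^sub>F n in sequentially. E (f (t n)) < ls + e" using Elim by (rule order_tendstoD) (use e in simp)
    then have "\<forall>\<^sub>F n in sequentially. f (t n) \<in> H \<and> E (f (t n)) \<le> ls + e"
      by eventually_elim (use adm_H f_adm t in auto)
    then show ?thesis using E_lsc[OF trivial_limit_sequentially fsL conv] by blast
  qed
  have fsH: "fs \<in> H" using *[of 1] by simp
  have Ele: "E fs \<le> ls" by (rule field_le_epsilon) (simp add: *)
  have fs_adm: "fs \<in> adm" using fsH N1 Ele ls_less_M by (simp add: adm_def)
  \<comment> \<open>The inequality carries the limit \<open>ls\<close> in place of E fs, for which
    only E fs <= ls is known so far; testing it with \<open>fs\<close> itself closes the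
    gap.\<close>
  have sub: "ls / p + K * pairing m (J p fs) (\<lambda>x. h x - fs x) \<le> E h / p" if h: "h \<in> adm" for h
  proof -
    note hL = adm_L[OF h]
    \<comment> \<open>Bounds the error of replacing the flow by \<open>fs\<close> in the divergence,
      uniformly over the unit interval after \<open>t n\<close>: slowness of the flow plus the
      distance at time \<open>t n\<close>. The 2 is the sum of two unit norms.\<close>
    define b where "b n = (p - 1) * ((exp K * (E (f (t n)) - ls) / 2 powr (1 - p)) powr (1 / p)
        + nrm (\<lambda>x. f (t n) x - fs x)) * (2 + nrm h) powr (p - 1)" for n
    have "(\<lambda>n. exp K * (E (f (t n)) - ls) / 2 powr (1 - p)) \<longlonglongrightarrow> exp K * (ls - ls) / 2 powr (1 - p)"
      by (intro tendsto_intros Elim) simp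
    then have lim: "(\<lambda>n. (exp K * (E (f (t n)) - ls) / 2 powr (1 - p)) powr (1 / p)) \<longlonglongrightarrow> 0 powr (1 / p)"
      using ls_le t p_pos by (intro tendsto_powr2) auto
    have "b \<longlonglongrightarrow> (p - 1) * (0 powr (1/p) + 0) * (2 + nrm h) powr (p - 1)"
      unfolding b_def using conv unfolding Lp_conv_def
      by (intro tendsto_mult[OF tendsto_mult[OF tendsto_const tendsto_add[OF lim]] tendsto_const])
    then have b0: "b \<longlonglongrightarrow> 0" by simp
    have bb: "\<bar>Breg h (f (t n + \<tau>)) - Breg h fs\<bar> \<le> b n" if \<tau>: "0 \<le> \<tau>" "\<tau> \<le> 1" for n \<tau>
    proof -
      have t\<tau>: "0 \<le> t n + \<tau>" using t(1)[of n] \<tau> by simp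
      have "\<bar>Breg h (f (t n + \<tau>)) - Breg h fs\<bar> = \<bar>pairing m (J p (f (t n + \<tau>))) h - pairing m (J p fs) h\<bar>"
        by (simp add: Breg_def N_f[OF t\<tau>] N1)
      also have "\<dots> \<le> (p - 1) * nrm (\<lambda>x. f (t n + \<tau>) x - fs x) * (nrm (f (t n + \<tau>)) + nrm fs + nrm h) powr (p - 1)"
        by (rule J_pairing_diff_le[OF f_L[OF t\<tau>] fsL hL])
      also have "nrm (f (t n + \<tau>)) + nrm fs + nrm h = 2 + nrm h"
        using N_f[OF t\<tau>] N1 by (simp add: nrm_eq_1_iff[symmetric])
      also have "(p - 1) * nrm (\<lambda>x. f (t n + \<tau>) x - fs x) * (2 + nrm h) powr (p - 1) \<le> b n"
        unfolding b_def
      proof (intro mult_right_mono mult_left_mono)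
        show "nrm (\<lambda>x. f (t n + \<tau>) x - fs x) \<le> (exp K * (E (f (t n)) - ls) / 2 powr (1 - p)) powr (1 / p)
            + nrm (\<lambda>x. f (t n) x - fs x)"
          using nrm_triangle_diff[OF f_L[OF t\<tau>] f_L[OF t(1)[of n]] fsL] f_slow[OF t(1)[of n] \<tau>] by linarith
      qed (use p_gt_1 in auto)
      finally show ?thesis .
    qed
    \<comment> \<open>The evolution variational inequality integrated over the unit interval: the
      divergence changes by at most 2 b n there, and every error vanishes in the limit.\<close>
    have ineq: "- 2 * b n \<le> \<phi> h - (ls / p - K / p) + K * (Breg h fs + b n)" for n
    proof -
      have "Breg h (f (t n + 1)) - Breg h (f (t n)) \<le> (\<phi> h - (ls / p - K / p) + K * (Breg h fs + b n)) * ((t n + 1) - t n)"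
      proof (rule ac_mean_value[OF _ Breg_ac[OF t(1) hL]])
        show "AE r in lborel. t n < r \<and> r < t n + 1 \<longrightarrow> (\<exists>D. ((\<lambda>r. Breg h (f r)) has_real_derivative D) (at r)
            \<and> D \<le> \<phi> h - (ls / p - K / p) + K * (Breg h fs + b n))"
        proof (rule AE_good_between[OF t(1)])
          fix r \<xi> assume r: "t n < r" "r < t n + 1" "good r \<xi>"
          have r0: "0 \<le> r" using r t(1)[of n] by simp
          have "ls / p - K / p \<le> \<phi> (f r)" using ls_le[OF r0] p_pos by (simp add: \<phi>_def N_f[OF r0] divide_right_mono)
          moreover have "K * Breg h (f r) \<le> K * (Breg h fs + b n)"
            using bb[of "r - t n" n] r K_pos by (intro mult_left_mono) auto
          ultimately show "\<exists>D. ((\<lambda>r. Breg h (f r)) has_real_derivative D) (at r)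
            \<and> D \<le> \<phi> h - (ls / p - K / p) + K * (Breg h fs + b n)"
            using EVI[OF r(3) h] by force
        qed
      qed simp
      then show ?thesis using bb[of 0 n] bb[of 1 n] by simp
    qed
    have "(\<lambda>n. - 2 * b n) \<longlonglongrightarrow> - 2 * 0" by (intro tendsto_intros b0)
    moreover have "(\<lambda>n. \<phi> h - (ls / p - K / p) + K * (Breg h fs + b n)) \<longlonglongrightarrow> \<phi> h - (ls / p - K / p) + K * (Breg h fs + 0)"
      by (intro tendsto_intros b0)
    ultimately have "- 2 * 0 \<le> \<phi> h - (ls / p - K / p) + K * (Breg h fs + 0)"
      by (rule LIMSEQ_le) (use ineq in blast)
    then show ?thesis
      unfolding \<phi>_def Breg_alt[OF fsL hL] N1 by (simp add: algebra_simps)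
  qed
  have "ls / p \<le> E fs / p" using sub[OF fs_adm] by (simp add: pairing_def)
  then show Els: "E fs = ls" using Ele p_pos by (simp add: divide_le_cancel)
  define \<eta> where "\<eta> = (\<lambda>x. K * J p fs x)"
  have \<eta>f: "pairing m \<eta> fs = K" by (simp add: \<eta>_def pairing_cmult_left pairing_J_self N1)
  have "(\<lambda>x. \<eta> x - (pairing m \<eta> fs - E fs) * J p fs x) \<in> Ch_subdiff m p fs"
  proof (rule constrained_subgradient[OF fsH N1])
    show "E fs < M" using Els ls_less_M by simp
    show "\<eta> \<in> Lq" unfolding \<eta>_def by (intro Lp_cmult J_in_Lq fsL)
    fix g assume "g \<in> H" "N g \<le> 1" "E g \<le> M"
    then show "E fs / p + pairing m \<eta> (\<lambda>x. g x - fs x) \<le> E g / p"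
      unfolding \<eta>_def pairing_cmult_left Els by (intro sub) (simp add: adm_def)
  qed
  \<comment> \<open>The multiplier is K - ls, so K cancels and only the eigenvalue remains.\<close>
  moreover have "(\<lambda>x. \<eta> x - (pairing m \<eta> fs - E fs) * J p fs x) = (\<lambda>x. ls * J p fs x)"
    by (simp add: \<eta>f Els) (simp add: \<eta>_def algebra_simps)
  ultimately show "eigenfunction m p ls fs" using N1 by (intro eigenfunctionI) auto
qed

lemma omega_subsequence:
  assumes cpt: "compact_embedding m p" and t: "\<And>n. 0 \<le> t n" "filterlim t at_top sequentially"
  shows "\<exists>r fs. strict_mono (r :: nat \<Rightarrow> nat) \<and> fs \<in> omega_limit m p f \<and> Lp_conv m p (\<lambda>n. f (t (r n))) fs sequentially"
proof -
  have "\<exists>r fs. strict_mono (r :: nat \<Rightarrow> nat) \<and> fs \<in> L \<and> Lp_conv m p (\<lambda>n. f (t (r n))) fs sequentially"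
    using t(1) adm_H[OF f_adm] N_f E_f_le_E_f0 by (intro compact_sequence[OF cpt, of "\<lambda>n. f (t n)" "E f0"]) auto
  then obtain r fs where r: "strict_mono (r :: nat \<Rightarrow> nat)" "fs \<in> L" "Lp_conv m p (\<lambda>n. f (t (r n))) fs sequentially" by blast
  moreover have "filterlim (\<lambda>n. t (r n)) at_top sequentially"
    by (rule filterlim_compose[OF t(2) filterlim_subseq[OF r(1)]])
  ultimately have "fs \<in> omega_limit m p f"
    unfolding omega_limit_def using t(1) by (intro CollectI conjI exI[of _ "\<lambda>n. t (r n)"]) auto
  then show ?thesis using r by blast
qed

lemma omega_nonempty:
  assumes "compact_embedding m p"
  shows "omega_limit m p f \<noteq> {}"
  using omega_subsequence[OF assms, of real] filterlim_real_sequentially by auto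

text \<open>
  If the eigenspace is a line, the \<open>\<omega>\<close>-limit set consists of two antipodal points at distance \<open>2\<close>;
  oscillating between them would create a limit point at distance \<open>1\<close> from \<open>fs\<close>.
\<close>

lemma convergence_simple:
  assumes cpt: "compact_embedding m p" and fs: "fs \<in> omega_limit m p f"
    and simple: "\<And>g. g \<in> omega_limit m p f \<Longrightarrow> \<exists>a b :: real. (a, b) \<noteq> (0, 0) \<and> (AE x in m. a * fs x + b * g x = 0)"
  shows "Lp_conv m p f fs at_top"
proof -
  have omega: "g \<in> L" "N g = 1" if "g \<in> omega_limit m p f" for g
    using omega_eigenfunction(1)[OF that] that by (auto simp: omega_limit_def)
  note fsL = omega(1)[OF fs]
  define d where "d s = nrm (\<lambda>x. f s x - fs x)" for s
  have dist: "nrm (\<lambda>x. g x - fs x) \<in> {0, 2}" if g: "g \<in> omega_limit m p f" for g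
  proof -
    note gL = omega(1)[OF g]
    note [measurable] = Lp_measurable[OF fsL] Lp_measurable[OF gL]
    have n1: "nrm fs = 1" "nrm g = 1" using omega(2)[OF g] omega(2)[OF fs] by (simp_all add: nrm_eq_1_iff)
    obtain a b where ab: "(a, b) \<noteq> (0, 0)" and eq: "AE x in m. a * fs x + b * g x = 0" using simple[OF g] by blast
    have "nrm (\<lambda>x. a * fs x) = nrm (\<lambda>x. (- b) * g x)"
    proof (rule Lp_norm_cong_AE)
      show "AE x in m. a * fs x = (- b) * g x" using eq by eventually_elim (simp add: eq_neg_iff_add_eq_0)
    qed measurable
    \<comment> \<open>Both functions have unit norm, so dependence forces coefficients of equal
      modulus: g is fs or its negative.\<close>
    then have "\<bar>a\<bar> = \<bar>b\<bar>" using n1 by (simp only: nrm_cmult)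
    then have nz: "a \<noteq> 0" and ab': "b = a \<or> b = - a" using ab by auto
    show ?thesis
    proof (cases "b = a")
      case True
      have "nrm (\<lambda>x. g x - fs x) = nrm (\<lambda>x. 2 * g x)"
      proof (rule Lp_norm_cong_AE)
        show "AE x in m. g x - fs x = 2 * g x"
          using eq
        proof eventually_elim
          case (elim x)
          then have "a * (fs x + g x) = 0" using True by (simp add: distrib_left)
          then show ?case using nz by simp
        qed
      qed measurable
      then show ?thesis using n1 by (simp add: nrm_cmult)
    next
      case False
      then have b: "b = - a" using ab' by simp
      have "AE x in m. g x - fs x = 0"
        using eq
      proof eventually_elim
        case (elim x)
        then have "a * (g x - fs x) = 0" using b by (auto simp: algebra_simps)
        then show ?case using nz by simp
      qed
      then show ?thesis using Lp_norm_eq_0_iff[OF L_diff[OF gL fsL] p_pos] by simp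
    qed
  qed
  have d_cont: "continuous_on {0..} d"
    unfolding continuous_on_def
  proof
    fix s :: real assume s: "s \<in> {0..}"
    have "((\<lambda>r. r) \<longlongrightarrow> s) (at s within {0..})" by (rule tendsto_ident_at)
    moreover have ev: "\<forall>\<^sub>F r in at s within {0..}. 0 \<le> r" by (simp add: eventually_at_filter)
    ultimately have "Lp_conv m p f (f s) (at s within {0..})" using s by (intro Lp_conv_f) auto
    then have "Lp_conv m p (\<lambda>r x. f r x - fs x) (\<lambda>x. f s x - fs x) (at s within {0..})" by (simp add: Lp_conv_def)
    then show "(d \<longlongrightarrow> d s) (at s within {0..})"
      unfolding d_def using s ev fsL
      by (intro Lp_norm_tendsto[OF p_ge_1] L_diff f_L) (auto elim!: eventually_mono intro!: L_diff f_L)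
  qed
  \<comment> \<open>A value taken at arbitrarily late times would, by compactness, be the distance
    of some limit point from fs.\<close>
  have no1: "\<exists>T. \<forall>s\<ge>T. 0 \<le> s \<longrightarrow> d s \<noteq> c" if c: "c \<noteq> 0" "c \<noteq> 2" for c
  proof (rule ccontr)
    assume no: "\<not> ?thesis"
    have "\<exists>s. real n \<le> s \<and> 0 \<le> s \<and> d s = c" for n using no by blast
    then obtain s where s: "\<And>n. real n \<le> s n" "\<And>n. 0 \<le> s n" "\<And>n. d (s n) = c" by metis
    have "filterlim s at_top sequentially"
      by (rule filterlim_at_top_mono[OF filterlim_real_sequentially]) (use s in auto)
    then obtain r g where g: "g \<in> omega_limit m p f" "Lp_conv m p (\<lambda>n. f (s (r n))) g sequentially"
      using omega_subsequence[OF cpt, of s] s(2) by blast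
    have "Lp_conv m p (\<lambda>n x. f (s (r n)) x - fs x) (\<lambda>x. g x - fs x) sequentially" using g(2) by (simp add: Lp_conv_def)
    then have "(\<lambda>n. nrm (\<lambda>x. f (s (r n)) x - fs x)) \<longlonglongrightarrow> nrm (\<lambda>x. g x - fs x)"
      using s(2) omega(1)[OF g(1)] fsL by (intro Lp_norm_tendsto[OF p_ge_1] L_diff f_L always_eventually allI) auto
    then have "nrm (\<lambda>x. g x - fs x) = c" using s(3) by (simp add: d_def LIMSEQ_const_iff)
    then show False using dist[OF g(1)] c by auto
  qed
  obtain t where t: "\<And>n. 0 \<le> t n" "filterlim t at_top sequentially" "Lp_conv m p (\<lambda>n. f (t n)) fs sequentially"
    using fs by (auto simp: omega_limit_def)
  show ?thesis
    unfolding Lp_conv_def d_def[symmetric]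
  proof (rule order_tendstoI)
    fix a :: real assume "a < 0"
    then show "\<forall>\<^sub>F s in at_top. a < d s" by (intro always_eventually) (auto simp: d_def intro: order_less_le_trans)
  next
    fix a :: real assume a: "0 < a"
    \<comment> \<open>A level strictly between 0 and 2 and at most a: once the distance is below it
      at a late time, continuity forbids crossing it again.\<close>
    define c where "c = min a 1"
    have c: "0 < c" "c \<le> a" "c \<noteq> 2" using a by (auto simp: c_def)
    obtain T where T: "\<And>s. T \<le> s \<Longrightarrow> 0 \<le> s \<Longrightarrow> d s \<noteq> c" using no1[of c] c by auto
    have "\<forall>\<^sub>F n in sequentially. d (t n) < c"
      using t(3) c(1) unfolding Lp_conv_def d_def by (rule order_tendstoD)
    moreover have "\<forall>\<^sub>F n in sequentially. max T 0 \<le> t n" using t(2) unfolding filterlim_at_top by blast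
    ultimately have "\<forall>\<^sub>F n in sequentially. d (t n) < c \<and> max T 0 \<le> t n" by eventually_elim simp
    then obtain n where n: "d (t n) < c" "T \<le> t n" "0 \<le> t n" using eventually_happens[of _ sequentially] by force
    have lt: "d s < c" if s: "t n \<le> s" for s
    proof (rule ccontr)
      assume "\<not> d s < c"
      then have "c \<le> d s" by simp
      moreover have "continuous_on {t n..s} d" by (rule continuous_on_subset[OF d_cont]) (use n in auto)
      ultimately obtain r where "t n \<le> r" "r \<le> s" "d r = c" using IVT'[of d "t n" c s] n s by auto
      then show False using T[of r] n by auto
    qed
    show "\<forall>\<^sub>F s in at_top. d s < a"
      using eventually_ge_at_top[of "t n"] by eventually_elim (use lt c(2) order_less_le_trans in blast)
  qed
qed

end

section \<open>Flow and minimisation combined\<close>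

theorem theorem1p2:
  fixes m :: "('a::metric_space) measure" and p :: real
  assumes "sets m = sets borel" and "emeasure m (space m) < \<infinity>"
    and "2 \<le> p"
    and "compact_embedding m p"
  shows "\<exists>\<delta>>0. \<forall>(f0 :: 'a \<Rightarrow> real) (f :: real \<Rightarrow> 'a \<Rightarrow> real) (M :: real).
    f0 \<in> Lp_sphere m p \<and> Ch m p f0 < \<infinity> \<and> (\<integral>x. J p f0 x \<partial>m) = 0 \<and>
    M = p * (real_of_ereal (Ch m p f0) + 1) \<and>
    mirror_flow m p (Phi m p M) f0 f \<longrightarrow>
    (\<exists>ls :: real.
       (((\<lambda>t. ereal p * Ch m p (f t)) \<longlongrightarrow> ereal ls) at_top \<and>
        lambda1 m p \<le> ereal ls \<and>
        eigenvalue m p ls \<and>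
        (\<forall>fs \<in> omega_limit m p f. eigenfunction m p ls fs)) \<and>
       (\<exists>l1 :: real. lambda1 m p = ereal l1 \<and>
        eigenvalue m p l1 \<and>
        (simple_eigenvalue m p l1 \<and> isolated_eigenvalue m p l1 \<and>
         ereal p * Ch m p f0 \<le> ereal (l1 + \<delta>) \<longrightarrow>
           (\<exists>fs. fs \<in> Lp_sphere m p \<and> eigenfunction m p ls fs \<and> Lp_conv m p f fs at_top))))"
proof -
  have "finite_measure m" using assms(2) by (intro finite_measureI) simp
  then interpret cheeger m p
    by (intro cheeger.intro finite_Lp.intro finite_Lp_axioms.intro cheeger_axioms.intro assms)
  \<comment> \<open>The radius is fixed before the initial datum and depends on m and p alone. If
    \<open>lambda1\<close> is not an isolated eigenvalue, 1 serves, the condition being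
    void.\<close>
  obtain \<delta> :: real where \<delta>: "\<delta> > 0"
    "\<And>l1. lambda1 m p = ereal l1 \<Longrightarrow> isolated_eigenvalue m p l1 \<Longrightarrow> \<forall>k \<in> {l1<..l1 + \<delta>}. \<not> eigenvalue m p k"
  proof (cases "\<exists>l1. lambda1 m p = ereal l1 \<and> isolated_eigenvalue m p l1")
    case True
    then obtain l1 where l1: "lambda1 m p = ereal l1" "isolated_eigenvalue m p l1" by blast
    then obtain d where "d > 0" "\<forall>k \<in> {l1<..l1 + d}. \<not> eigenvalue m p k" by (auto simp: isolated_eigenvalue_def)
    then show ?thesis using l1 that[of d] by auto
  next
    case False
    then show ?thesis using that[of 1] by auto
  qed
  show ?thesis
  proof (rule exI[of _ \<delta>], intro conjI allI impI \<delta>(1), goal_cases)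
    case H: (1 f0 f M)
    have f0: "f0 \<in> centered"
      using H by (auto simp: centered_def H_iff_Ch Lp_sphere_def nrm_eq_1_iff pairing_def)
    then have f0H: "f0 \<in> H1p m p" by (simp add: centered_def)
    interpret mirror_setting m p f0 f M
      using H f0 by unfold_locales (auto simp: E_def distrib_left)
    obtain g where g: "g \<in> centered" "\<And>h. h \<in> centered \<Longrightarrow> E g \<le> E h"
      using ex_minimizer[OF assms(4)] f0 by blast
    have l1: "lambda1 m p = ereal (E g)" by (rule lambda1_eq[OF g])
    have ev1: "eigenvalue m p (E g)" using minimizer_eigenfunction[OF g] by (auto simp: eigenvalue_def)
    have lim: "((\<lambda>t. ereal p * Ch m p (f t)) \<longlongrightarrow> ereal ls) at_top"
    proof (rule Lim_transform_eventually)
      show "((\<lambda>t. ereal (E (f t))) \<longlongrightarrow> ereal ls) at_top" by (intro tendsto_intros E_f_tendsto)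
      show "\<forall>\<^sub>F t in at_top. ereal (E (f t)) = ereal p * Ch m p (f t)"
        using eventually_ge_at_top[of "0::real"]
        by eventually_elim (use p_pos Ch_eq_E[OF adm_H[OF f_adm]] in simp)
    qed
    \<comment> \<open>Every f t with t >= 0 is a competitor for the minimum, since the flow
      preserves norm and centring.\<close>
    have gls: "E g \<le> ls"
      unfolding ls_def by (intro cInf_greatest) (auto intro: g(2) f_centered)
    obtain fs where fs: "fs \<in> omega_limit m p f" using omega_nonempty[OF assms(4)] by blast
    have evs: "eigenvalue m p ls" using omega_eigenfunction(3)[OF fs] by (auto simp: eigenvalue_def)
    have conv: "\<exists>fs. fs \<in> Lp_sphere m p \<and> eigenfunction m p ls fs \<and> Lp_conv m p f fs at_top"
      if simple: "simple_eigenvalue m p (E g)" and iso: "isolated_eigenvalue m p (E g)"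
        and close: "ereal p * Ch m p f0 \<le> ereal (E g + \<delta>)"
    proof -
      \<comment> \<open>\<open>ls\<close> is an eigenvalue in \<open>{E g..E g + \<delta>}\<close>,
        and isolation excludes all but the left end point.\<close>
      have "ls \<le> E f0" using ls_le[of 0] f_start(1) by simp
      also have "E f0 \<le> E g + \<delta>" using close p_pos by (simp add: Ch_eq_E[OF f0H])
      finally have "ls \<notin> {E g<..E g + \<delta>} \<longrightarrow> ls = E g" using gls by auto
      then have eq: "ls = E g" using \<delta>(2)[OF l1 iso] evs by blast
      have "Lp_conv m p f fs at_top"
      proof (rule convergence_simple[OF assms(4) fs])
        fix h assume h: "h \<in> omega_limit m p f"
        have "eigenfunction m p (E g) fs \<and> eigenfunction m p (E g) h"
          using omega_eigenfunction(3)[OF fs] omega_eigenfunction(3)[OF h] by (simp add: eq)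
        then show "\<exists>a b :: real. (a, b) \<noteq> (0, 0) \<and> (AE x in m. a * fs x + b * h x = 0)"
          using simple[unfolded simple_eigenvalue_def, THEN conjunct2, rule_format, of fs h] by simp
      qed
      moreover have "fs \<in> Lp_sphere m p"
        using fs omega_eigenfunction(1)[OF fs] by (simp add: Lp_sphere_def omega_limit_def nrm_eq_1_iff)
      ultimately show ?thesis using omega_eigenfunction(3)[OF fs] by blast
    qed
    show ?case
    proof (rule exI[of _ ls], intro conjI ballI lim evs, rule_tac [3] exI[of _ "E g"])
      show "lambda1 m p \<le> ereal ls" using l1 gls by simp
      show "eigenfunction m p ls h" if "h \<in> omega_limit m p f" for h
        by (rule omega_eigenfunction(3)[OF that])
    next
      show "lambda1 m p = ereal (E g) \<and> eigenvalue m p (E g) \<and>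
        (simple_eigenvalue m p (E g) \<and> isolated_eigenvalue m p (E g) \<and>
         ereal p * Ch m p f0 \<le> ereal (E g + \<delta>) \<longrightarrow>
           (\<exists>fs. fs \<in> Lp_sphere m p \<and> eigenfunction m p ls fs \<and> Lp_conv m p f fs at_top))"
        using l1 ev1 conv by blast
    qed
  qed
qed

end
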